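(* For $i=1,2$, let $C_i$ be a connected finite simplicial complex, $p_i:X_i\to C_i$ its simplicial universal covering, and identify $G_i=\pi_1(C_i)$ with the deck group. Assume $G_1,G_2$ are residually finite and let $\Phi:\widehat G_1\xrightarrow{\cong}\widehat G_2$ be a continuous isomorphism, with induced isomorphisms $\Phi_m:G_1/K_m(G_1)\to G_2/K_m(G_2)$. Suppose that for an increasing unbounded sequence $(m_j)$ there are $\Phi_{m_j}$-equivariant isomorphisms $$\mathcal I_\bullet\bigl(K_{m_j}(G_1)\backslash X_1\bigr)\xrightarrow{\cong}\mathcal I_\bullet\bigl(K_{m_j}(G_2)\backslash X_2\bigr)$$ (not required to be related to one another for different $j$). Then compatible such isomorphisms can be selected at all chosen levels, and if $F:\widehat{\mathcal I}_\bullet(X_1)\to\widehat{\mathcal I}_\bullet(X_2)$ is the resulting inverse limit isomorphism, then there are $u\in\widehat G_2$ and an isomorphism $h:G_1\xrightarrow{\cong}G_2$ such that $\Phi=\operatorname{Inn}(u)\circ\widehat h$ and $u^{-1}F$ maps every original simplex and codimension one occurrence onto its original counterpart (i.e. it maps the original simplices and occurrences of $X_1$ onto those of $X_2$). The resulting map is an $h$-equivariant simplicial isomorphism $X_1\to X_2$ and descends to a simplicial, hence PL, homeomorphism $C_1\to C_2$ inducing $h$ up to basepoint conjugacy. If, in addition, finite families of invariant subcomplexes of $X_1$ and $X_2$ (indexed by a common finite label set) are distinguished and the finite maps preserve them by permutations in a fixed finite permutation group, then the selected maps all involve the same permutation and the descended homeomorphism preserves the corresponding subcomplexes.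
   Context: $K_m(G)=\bigcap_{[G:L]\le m}L$ (intersection of all subgroups of index $\le m$). $\operatorname{Inn}(u)(x)=uxu^{-1}$. For a finite dimensional simplicial complex $X$, $\mathcal I_\bullet(X)$ (full cellular residual complex) consists of the sets $X^k$ of open $k$-simplices, the occurrence sets $I_{k,k-1}(X)=\{(\sigma,\tau)\in X^k\times X^{k-1}:\tau\text{ is a face of }\sigma\}$, and the projections $p_{k,k-1}(\sigma,\tau)=\sigma$, $q_{k,k-1}(\sigma,\tau)=\tau$. For a group $N$ acting simplicially, $\mathcal I_\bullet(N\backslash X):=N\backslash\mathcal I_\bullet(X)$ componentwise, i.e. with occurrence sets $N\backslash I_{k,k-1}(X)$ (distinct occurrence orbits stay distinct even if their incident quotient cells coincide). An isomorphism is a family of bijections of all cell and occurrence sets commuting with all $p$ and $q$. $\widehat{\mathcal I}_\bullet(X_i)=\varprojlim_m\mathcal I_\bullet(K_m(G_i)\backslash X_i)$ componentwise, with its $\widehat G_i$-action; original simplices and occurrences are the points in the canonical images of $X_i^k$ and $I_{k,k-1}(X_i)$. For $k\ge j$, an equivariant isomorphism at level $m_k$ descends uniquely to level $m_j$; compatible means the selected map at level $m_k$ descends to the selected map at level $m_j$. A distinguished invariant subcomplex $Z_\lambda\subseteq X$ specifies the subsets $Z_\lambda^k\subseteq X^k$ and $I_{k,k-1}(Z_\lambda)\subseteq I_{k,k-1}(X)$; a map preserves families $(Z_{1,\lambda}),(Z_{2,\lambda})$ by a permutation $\sigma$ if it sends these subsets (or their quotient images) for $Z_{1,\lambda}$ onto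 those for $Z_{2,\sigma(\lambda)}$, with the same $\sigma$ in all dimensions. *)

theory Defs
  imports
    "HOL-Analysis.Analysis"
    "HOL-Analysis.Finite_Function_Topology"
    "HOL-Algebra.Product_Groups"
    "HOL-Algebra.Group_Action"
begin

section \<open>Simplicial complexes and their geometric realizations\<close>

text \<open>Complexes are abstract: sets of nonempty finite vertex sets, possibly infinite
  (the library's \<open>simplicial_complex\<close> is a finite complex inside a Euclidean space).\<close>

definition abstract_complex :: "'v set set \<Rightarrow> bool" where
  "abstract_complex X \<longleftrightarrow>
     (\<forall>s\<in>X. finite s \<and> s \<noteq> {} \<and> (\<forall>t. t \<subseteq> s \<and> t \<noteq> {} \<longrightarrow> t \<in> X))"

abbreviation verts :: "'v set set \<Rightarrow> 'v set" where
  "verts X \<equiv> \<Union> X"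

definition simplicial_map :: "'v set set \<Rightarrow> 'w set set \<Rightarrow> ('v \<Rightarrow> 'w) \<Rightarrow> bool" where
  "simplicial_map X Y f \<longleftrightarrow> (\<forall>s\<in>X. f ` s \<in> Y)"

definition simplicial_iso :: "'v set set \<Rightarrow> 'w set set \<Rightarrow> ('v \<Rightarrow> 'w) \<Rightarrow> bool" where
  "simplicial_iso X Y f \<longleftrightarrow>
     bij_betw f (verts X) (verts Y) \<and> (\<forall>s. s \<subseteq> verts X \<longrightarrow> (f ` s \<in> Y \<longleftrightarrow> s \<in> X))"

text \<open>Points of the realization are finitely supported barycentric coordinate functions.  The
  type of finitely supported functions carries the \<open>l\<^sup>1\<close> norm, so the realization gets the
  barycentric metric topology.  It is the weak topology when the complex is locally finite, as
  every complex below is: it is finite or covers a finite complex.\<close>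

definition closed_simplex :: "'v set \<Rightarrow> ('v \<Rightarrow>\<^sub>0 real) set" where
  "closed_simplex s = convex hull ((\<lambda>v. Poly_Mapping.single v 1) ` s)"

definition realization :: "'v set set \<Rightarrow> ('v \<Rightarrow>\<^sub>0 real) set" where
  "realization X = (\<Union>s\<in>X. closed_simplex s)"

text \<open>The linear extension of a vertex map.\<close>

definition realize :: "('v \<Rightarrow> 'w) \<Rightarrow> ('v \<Rightarrow>\<^sub>0 real) \<Rightarrow> ('w \<Rightarrow>\<^sub>0 real)" where
  "realize f x = (\<Sum>v\<in>Poly_Mapping.keys x. Poly_Mapping.single (f v) (Poly_Mapping.lookup x v))"

definition connected_finite_complex :: "'v set set \<Rightarrow> bool" where
  "connected_finite_complex C \<longleftrightarrow>
     abstract_complex C \<and> finite C \<and> C \<noteq> {} \<and> connected (realization C)"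

definition universal_covering :: "'v set set \<Rightarrow> ('v \<Rightarrow> 'w) \<Rightarrow> 'w set set \<Rightarrow> bool" where
  "universal_covering X p C \<longleftrightarrow>
     abstract_complex X \<and> simplicial_map X C p \<and>
     covering_space (realization X) (realize p) (realization C) \<and>
     simply_connected (realization X)"

text \<open>Deck transformations of a simplicial covering are simplicial, so they are given by their
  action on vertices.\<close>

definition deck_group :: "'v set set \<Rightarrow> ('v \<Rightarrow> 'w) \<Rightarrow> ('v \<Rightarrow> 'v) monoid" where
  "deck_group X p = (BijGroup (verts X))
     \<lparr>carrier := {g \<in> Bij (verts X). simplicial_iso X X g \<and> (\<forall>v\<in>verts X. p (g v) = p v)}\<rparr>"

text \<open>Piecewise linear maps between compact polyhedra.\<close>

definition piecewise_linear_on ::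
    "'a::real_normed_vector set \<Rightarrow> ('a \<Rightarrow> 'b::real_normed_vector) \<Rightarrow> bool" where
  "piecewise_linear_on S f \<longleftrightarrow> continuous_on S f \<and>
     (\<exists>\<T>. finite \<T> \<and> \<Union>\<T> = S \<and> (\<forall>T\<in>\<T>. polytope T) \<and>
        (\<forall>T\<in>\<T>. \<forall>x\<in>T. \<forall>y\<in>T. \<forall>t\<in>{0..1}.
           f ((1 - t) *\<^sub>R x + t *\<^sub>R y) = (1 - t) *\<^sub>R f x + t *\<^sub>R f y))"

definition PL_homeomorphism ::
    "'a::real_normed_vector set \<Rightarrow> 'b::real_normed_vector set \<Rightarrow> ('a \<Rightarrow> 'b) \<Rightarrow> bool" where
  "PL_homeomorphism S T f \<longleftrightarrow>
     (\<exists>g. homeomorphism S T f g \<and> piecewise_linear_on S f \<and> piecewise_linear_on T g)"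


section \<open>Fundamental groups\<close>

definition path_class :: "'a::topological_space set \<Rightarrow> (real \<Rightarrow> 'a) \<Rightarrow> (real \<Rightarrow> 'a) set" where
  "path_class S \<gamma> = {\<delta>. homotopic_paths S \<gamma> \<delta>}"

definition fundamental_group ::
    "'a::real_normed_vector set \<Rightarrow> 'a \<Rightarrow> (real \<Rightarrow> 'a) set monoid" where
  "fundamental_group S c =
     \<lparr>carrier = {path_class S \<gamma> |\<gamma>. path \<gamma> \<and> path_image \<gamma> \<subseteq> S \<and> pathstart \<gamma> = c \<and> pathfinish \<gamma> = c},
      monoid.mult = (\<lambda>a b. \<Union>\<gamma>\<in>a. \<Union>\<delta>\<in>b. path_class S (\<gamma> +++ \<delta>)),
      one = path_class S (linepath c c)\<rparr>"

definition pi1_map ::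
    "'b::topological_space set \<Rightarrow> ('a::topological_space \<Rightarrow> 'b) \<Rightarrow> (real \<Rightarrow> 'a) set \<Rightarrow> (real \<Rightarrow> 'b) set" where
  "pi1_map T f a = (\<Union>\<gamma>\<in>a. path_class T (f \<circ> \<gamma>))"

text \<open>The isomorphism from the fundamental group at \<open>pathfinish \<delta>\<close> to that at \<open>pathstart \<delta>\<close>.\<close>

definition change_basepoint ::
    "'a::real_normed_vector set \<Rightarrow> (real \<Rightarrow> 'a) \<Rightarrow> (real \<Rightarrow> 'a) set \<Rightarrow> (real \<Rightarrow> 'a) set" where
  "change_basepoint S \<delta> a = (\<Union>\<gamma>\<in>a. path_class S (\<delta> +++ \<gamma> +++ reversepath \<delta>))"

text \<open>For \<open>x\<close> in the realization of \<open>X\<close>, the identification of the fundamental group of the base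
  at the image of \<open>x\<close> with the deck group: the class of a loop goes to the deck transformation
  taking \<open>x\<close> to the end of the lift starting at \<open>x\<close>.\<close>

definition deck_of_loop ::
    "'v set set \<Rightarrow> ('v \<Rightarrow> 'w) \<Rightarrow> ('v \<Rightarrow>\<^sub>0 real) \<Rightarrow> (real \<Rightarrow> ('w \<Rightarrow>\<^sub>0 real)) set \<Rightarrow> 'v \<Rightarrow> 'v" where
  "deck_of_loop X p x a =
     (THE g. g \<in> carrier (deck_group X p) \<and>
        (\<exists>\<gamma>\<in>a. \<exists>l. path l \<and> path_image l \<subseteq> realization X \<and> (\<forall>t\<in>{0..1}. realize p (l t) = \<gamma> t) \<and>
           pathstart l = x \<and> pathfinish l = realize g x))"

text \<open>The simplicial map \<open>f\<close> on the bases induces \<open>h\<close> on the deck groups up to basepoint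
  conjugacy: for all basepoints (and chosen points above them) and all connecting paths, the
  induced map of fundamental groups is \<open>h\<close> followed by an inner automorphism.\<close>

definition induces_up_to_conjugacy ::
    "'c set set \<Rightarrow> ('c \<Rightarrow> 'a) \<Rightarrow> 'a set set \<Rightarrow> 'd set set \<Rightarrow> ('d \<Rightarrow> 'b) \<Rightarrow> 'b set set
      \<Rightarrow> ('a \<Rightarrow> 'b) \<Rightarrow> (('c \<Rightarrow> 'c) \<Rightarrow> ('d \<Rightarrow> 'd)) \<Rightarrow> bool" where
  "induces_up_to_conjugacy X1 p1 C1 X2 p2 C2 f h \<longleftrightarrow>
     (\<forall>x1\<in>realization X1. \<forall>x2\<in>realization X2. \<forall>\<delta>.
        path \<delta> \<and> path_image \<delta> \<subseteq> realization C2 \<and>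
        pathstart \<delta> = realize p2 x2 \<and> pathfinish \<delta> = realize f (realize p1 x1) \<longrightarrow>
        (\<exists>k\<in>carrier (deck_group X2 p2).
           \<forall>a\<in>carrier (fundamental_group (realization C1) (realize p1 x1)).
             deck_of_loop X2 p2 x2
               (change_basepoint (realization C2) \<delta> (pi1_map (realization C2) (realize f) a)) =
             k \<otimes>\<^bsub>deck_group X2 p2\<^esub> h (deck_of_loop X1 p1 x1 a)
               \<otimes>\<^bsub>deck_group X2 p2\<^esub> inv\<^bsub>deck_group X2 p2\<^esub> k))"


section \<open>Subgroups of bounded index and profinite completions\<close>

text \<open>The cardinality of an infinite set is \<open>0\<close>, hence the explicit finiteness condition.  No
  subgroup has index at most \<open>0\<close>, so \<open>K_sub G 0 = carrier G = K_sub G 1\<close>.\<close>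

definition K_sub :: "('g, 'z) monoid_scheme \<Rightarrow> nat \<Rightarrow> 'g set" where
  "K_sub G m = carrier G \<inter>
     \<Inter>{L. subgroup L G \<and> finite (rcosets\<^bsub>G\<^esub> L) \<and> card (rcosets\<^bsub>G\<^esub> L) \<le> m}"

definition K_group :: "('g, 'z) monoid_scheme \<Rightarrow> nat \<Rightarrow> ('g, 'z) monoid_scheme" where
  "K_group G m = G\<lparr>carrier := K_sub G m\<rparr>"

definition fi_normal :: "('g, 'z) monoid_scheme \<Rightarrow> 'g set set" where
  "fi_normal G = {N. N \<lhd> G \<and> finite (rcosets\<^bsub>G\<^esub> N)}"

definition residually_finite :: "('g, 'z) monoid_scheme \<Rightarrow> bool" where
  "residually_finite G \<longleftrightarrow> (\<forall>g\<in>carrier G. g \<noteq> \<one>\<^bsub>G\<^esub> \<longrightarrow> (\<exists>N\<in>fi_normal G. g \<notin> N))"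

text \<open>The inverse limit of all finite quotients.  Elements of the quotients are cosets, and the
  transition map for \<open>N \<subseteq> M\<close> sends a coset of \<open>N\<close> to the coset of \<open>M\<close> containing it.\<close>

definition profinite_completion :: "('g, 'z) monoid_scheme \<Rightarrow> ('g set \<Rightarrow> 'g set) monoid" where
  "profinite_completion G = (product_group (fi_normal G) (\<lambda>N. G Mod N))
     \<lparr>carrier := {x \<in> carrier (product_group (fi_normal G) (\<lambda>N. G Mod N)).
                    \<forall>N\<in>fi_normal G. \<forall>M\<in>fi_normal G. N \<subseteq> M \<longrightarrow> x N \<subseteq> x M}\<rparr>"

definition profinite_topology :: "('g, 'z) monoid_scheme \<Rightarrow> ('g set \<Rightarrow> 'g set) topology" where
  "profinite_topology G =
     subtopology (product_topology (\<lambda>N. discrete_topology (carrier (G Mod N))) (fi_normal G))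
       (carrier (profinite_completion G))"

text \<open>The homomorphism of completions induced by a homomorphism of groups.\<close>

definition completion_map ::
    "('g, 'y) monoid_scheme \<Rightarrow> ('h, 'z) monoid_scheme \<Rightarrow> ('g \<Rightarrow> 'h)
      \<Rightarrow> ('g set \<Rightarrow> 'g set) \<Rightarrow> ('h set \<Rightarrow> 'h set)" where
  "completion_map G H h x =
     (\<lambda>M\<in>fi_normal H. M <#>\<^bsub>H\<^esub> (h ` x {g \<in> carrier G. h g \<in> M}))"

definition Inn :: "('g, 'z) monoid_scheme \<Rightarrow> 'g \<Rightarrow> 'g \<Rightarrow> 'g" where
  "Inn G u x = u \<otimes>\<^bsub>G\<^esub> x \<otimes>\<^bsub>G\<^esub> inv\<^bsub>G\<^esub> u"

text \<open>The map \<open>\<Phi>\<^sub>m\<close> induced by \<open>\<Phi>\<close> on the quotients by \<open>K_sub\<close>.  For a finitely generated group,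
  \<open>K_sub G m\<close> is a normal subgroup of finite index and \<open>x (K_sub G m)\<close> is the image of \<open>x\<close> in
  \<open>G Mod K_sub G m\<close>.\<close>

definition induced_level_map ::
    "('g, 'y) monoid_scheme \<Rightarrow> ('h, 'z) monoid_scheme \<Rightarrow> (('g set \<Rightarrow> 'g set) \<Rightarrow> ('h set \<Rightarrow> 'h set))
      \<Rightarrow> nat \<Rightarrow> 'g set \<Rightarrow> 'h set" where
  "induced_level_map G H \<Phi> m c =
     (THE d. \<exists>x\<in>carrier (profinite_completion G). x (K_sub G m) = c \<and> \<Phi> x (K_sub H m) = d)"


section \<open>Cellular residual complexes\<close>

text \<open>\<open>occs I k\<close> is the set of occurrences of \<open>k\<close>-cells in \<open>(k+1)\<close>-cells, \<open>I\<^sub>k\<^sub>+\<^sub>1\<^sub>,\<^sub>k\<close>; accordingly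
  \<open>upper I k\<close> and \<open>lower I k\<close> are the projections \<open>p\<^sub>k\<^sub>+\<^sub>1\<^sub>,\<^sub>k\<close> and \<open>q\<^sub>k\<^sub>+\<^sub>1\<^sub>,\<^sub>k\<close>.\<close>

record ('c, 'o) residual_complex =
  cells :: "nat \<Rightarrow> 'c set"
  occs :: "nat \<Rightarrow> 'o set"
  upper :: "nat \<Rightarrow> 'o \<Rightarrow> 'c"
  lower :: "nat \<Rightarrow> 'o \<Rightarrow> 'c"

record ('c, 'o, 'd, 'p) residual_map =
  cmap :: "nat \<Rightarrow> 'c \<Rightarrow> 'd"
  omap :: "nat \<Rightarrow> 'o \<Rightarrow> 'p"

definition residual_iso ::
    "('c, 'o) residual_complex \<Rightarrow> ('d, 'p) residual_complex \<Rightarrow> ('c, 'o, 'd, 'p) residual_map \<Rightarrow> bool" where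
  "residual_iso I J f \<longleftrightarrow> (\<forall>k.
     bij_betw (cmap f k) (cells I k) (cells J k) \<and>
     bij_betw (omap f k) (occs I k) (occs J k) \<and>
     (\<forall>e\<in>occs I k. cmap f (Suc k) (upper I k e) = upper J k (omap f k e) \<and>
                   cmap f k (lower I k e) = lower J k (omap f k e)))"

definition simplices :: "'v set set \<Rightarrow> nat \<Rightarrow> 'v set set" where
  "simplices X k = {s \<in> X. card s = Suc k}"

definition occurrences :: "'v set set \<Rightarrow> nat \<Rightarrow> ('v set \<times> 'v set) set" where
  "occurrences X k = {(s, t). s \<in> simplices X (Suc k) \<and> t \<in> simplices X k \<and> t \<subseteq> s}"

definition full_complex :: "'v set set \<Rightarrow> ('v set, 'v set \<times> 'v set) residual_complex" where
  "full_complex X =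
     \<lparr>cells = simplices X, occs = occurrences X, upper = (\<lambda>k. fst), lower = (\<lambda>k. snd)\<rparr>"

definition cell_act :: "('v \<Rightarrow> 'v) \<Rightarrow> 'v set \<Rightarrow> 'v set" where
  "cell_act g s = g ` s"

definition occ_act :: "('v \<Rightarrow> 'v) \<Rightarrow> 'v set \<times> 'v set \<Rightarrow> 'v set \<times> 'v set" where
  "occ_act g e = (g ` fst e, g ` snd e)"

text \<open>The projections send an orbit to the orbit of the image of a representative; as they are
  equivariant, that is the image of the orbit.\<close>

definition residual_quotient ::
    "('g, 'z) monoid_scheme \<Rightarrow> ('g \<Rightarrow> 'c \<Rightarrow> 'c) \<Rightarrow> ('g \<Rightarrow> 'o \<Rightarrow> 'o) \<Rightarrow> ('c, 'o) residual_complex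
      \<Rightarrow> ('c set, 'o set) residual_complex" where
  "residual_quotient N \<phi> \<psi> I =
     \<lparr>cells = (\<lambda>k. orbits N (cells I k) \<phi>),
      occs = (\<lambda>k. orbits N (occs I k) \<psi>),
      upper = (\<lambda>k e. upper I k ` e),
      lower = (\<lambda>k e. lower I k ` e)\<rparr>"

text \<open>For a group \<open>G\<close> of simplicial automorphisms of \<open>X\<close>, the complex of \<open>K\<^sub>m(G)\X\<close>.\<close>

definition level_complex ::
    "('v \<Rightarrow> 'v) monoid \<Rightarrow> 'v set set \<Rightarrow> nat \<Rightarrow> ('v set set, ('v set \<times> 'v set) set) residual_complex" where
  "level_complex G X m = residual_quotient (K_group G m) cell_act occ_act (full_complex X)"

text \<open>For a normal subgroup \<open>N\<close>, the coset \<open>A = N g\<close> sends the orbit \<open>B = N s\<close> to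
  \<open>N (g s) = translate \<phi> A B\<close>.  If \<open>N \<subseteq> M\<close>, the projection of orbits of \<open>N\<close> to orbits of \<open>M\<close>
  is \<open>translate \<phi> M\<close>.\<close>

definition translate :: "('g \<Rightarrow> 'x \<Rightarrow> 'x) \<Rightarrow> 'g set \<Rightarrow> 'x set \<Rightarrow> 'x set" where
  "translate \<phi> A B = {\<phi> g x |g x. g \<in> A \<and> x \<in> B}"

type_synonym ('v, 'w) level_map =
  "('v set set, ('v set \<times> 'v set) set, 'w set set, ('w set \<times> 'w set) set) residual_map"

text \<open>\<open>\<Phi>\<^sub>m\<close>-equivariant isomorphisms of the complexes of \<open>K\<^sub>m(G1)\X1\<close> and \<open>K\<^sub>m(G2)\X2\<close>.\<close>

definition level_iso ::
    "('v \<Rightarrow> 'v) monoid \<Rightarrow> 'v set set \<Rightarrow> ('w \<Rightarrow> 'w) monoid \<Rightarrow> 'w set set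
      \<Rightarrow> ((('v \<Rightarrow> 'v) set \<Rightarrow> ('v \<Rightarrow> 'v) set) \<Rightarrow> (('w \<Rightarrow> 'w) set \<Rightarrow> ('w \<Rightarrow> 'w) set))
      \<Rightarrow> nat \<Rightarrow> ('v, 'w) level_map \<Rightarrow> bool" where
  "level_iso G1 X1 G2 X2 \<Phi> m f \<longleftrightarrow>
     residual_iso (level_complex G1 X1 m) (level_complex G2 X2 m) f \<and>
     (\<forall>c\<in>carrier (G1 Mod K_sub G1 m). \<forall>k.
        (\<forall>s\<in>cells (level_complex G1 X1 m) k.
           cmap f k (translate cell_act c s) =
           translate cell_act (induced_level_map G1 G2 \<Phi> m c) (cmap f k s)) \<and>
        (\<forall>e\<in>occs (level_complex G1 X1 m) k.
           omap f k (translate occ_act c e) =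
           translate occ_act (induced_level_map G1 G2 \<Phi> m c) (omap f k e)))"

text \<open>The map \<open>f\<close> at level \<open>n\<close> descends to the map \<open>g\<close> at level \<open>m\<close>, where \<open>m \<le> n\<close>.\<close>

definition level_descends ::
    "('v \<Rightarrow> 'v) monoid \<Rightarrow> 'v set set \<Rightarrow> ('w \<Rightarrow> 'w) monoid
      \<Rightarrow> nat \<Rightarrow> ('v, 'w) level_map \<Rightarrow> nat \<Rightarrow> ('v, 'w) level_map \<Rightarrow> bool" where
  "level_descends G1 X1 G2 n f m g \<longleftrightarrow> (\<forall>k.
     (\<forall>s\<in>cells (level_complex G1 X1 n) k.
        cmap g k (translate cell_act (K_sub G1 m) s) = translate cell_act (K_sub G2 m) (cmap f k s)) \<and>
     (\<forall>e\<in>occs (level_complex G1 X1 n) k.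
        omap g k (translate occ_act (K_sub G1 m) e) = translate occ_act (K_sub G2 m) (omap f k e)))"

definition compatible_selection ::
    "('v \<Rightarrow> 'v) monoid \<Rightarrow> 'v set set \<Rightarrow> ('w \<Rightarrow> 'w) monoid \<Rightarrow> 'w set set
      \<Rightarrow> ((('v \<Rightarrow> 'v) set \<Rightarrow> ('v \<Rightarrow> 'v) set) \<Rightarrow> (('w \<Rightarrow> 'w) set \<Rightarrow> ('w \<Rightarrow> 'w) set))
      \<Rightarrow> (nat \<Rightarrow> nat) \<Rightarrow> (nat \<Rightarrow> ('v, 'w) level_map) \<Rightarrow> bool" where
  "compatible_selection G1 X1 G2 X2 \<Phi> m f \<longleftrightarrow>
     (\<forall>j. level_iso G1 X1 G2 X2 \<Phi> (m j) (f j)) \<and>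
     (\<forall>j k. j \<le> k \<longrightarrow> level_descends G1 X1 G2 (m k) (f k) (m j) (f j))"


section \<open>The completed complexes\<close>

definition completed_complex ::
    "('v \<Rightarrow> 'v) monoid \<Rightarrow> 'v set set
      \<Rightarrow> (nat \<Rightarrow> 'v set set, nat \<Rightarrow> ('v set \<times> 'v set) set) residual_complex" where
  "completed_complex G X =
     \<lparr>cells = (\<lambda>k. {\<xi>. (\<forall>m. \<xi> m \<in> cells (level_complex G X m) k) \<and>
                       (\<forall>m n. m \<le> n \<longrightarrow> \<xi> m = translate cell_act (K_sub G m) (\<xi> n))}),
      occs = (\<lambda>k. {\<xi>. (\<forall>m. \<xi> m \<in> occs (level_complex G X m) k) \<and>
                      (\<forall>m n. m \<le> n \<longrightarrow> \<xi> m = translate occ_act (K_sub G m) (\<xi> n))}),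
      upper = (\<lambda>k \<xi> m. upper (level_complex G X m) k (\<xi> m)),
      lower = (\<lambda>k \<xi> m. lower (level_complex G X m) k (\<xi> m))\<rparr>"

definition completed_act ::
    "('g, 'z) monoid_scheme \<Rightarrow> ('g \<Rightarrow> 'x \<Rightarrow> 'x) \<Rightarrow> ('g set \<Rightarrow> 'g set) \<Rightarrow> (nat \<Rightarrow> 'x set) \<Rightarrow> nat \<Rightarrow> 'x set" where
  "completed_act G \<phi> u \<xi> = (\<lambda>m. translate \<phi> (u (K_sub G m)) (\<xi> m))"

text \<open>The canonical map sending a simplex or an occurrence to a point of the completed complex;
  the original simplices and occurrences are its values.\<close>

definition original :: "('g, 'z) monoid_scheme \<Rightarrow> ('g \<Rightarrow> 'x \<Rightarrow> 'x) \<Rightarrow> 'x \<Rightarrow> nat \<Rightarrow> 'x set" where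
  "original G \<phi> x = (\<lambda>m. orbit (K_group G m) \<phi> x)"

type_synonym ('v, 'w) completed_map =
  "(nat \<Rightarrow> 'v set set, nat \<Rightarrow> ('v set \<times> 'v set) set,
    nat \<Rightarrow> 'w set set, nat \<Rightarrow> ('w set \<times> 'w set) set) residual_map"

text \<open>\<open>F\<close> is the inverse limit of the isomorphisms \<open>f j\<close> at the levels \<open>m j\<close>.  As \<open>m\<close> is
  unbounded, the coordinates at these levels determine \<open>F\<close>.\<close>

definition limit_iso ::
    "('v \<Rightarrow> 'v) monoid \<Rightarrow> 'v set set \<Rightarrow> ('w \<Rightarrow> 'w) monoid \<Rightarrow> 'w set set
      \<Rightarrow> (nat \<Rightarrow> nat) \<Rightarrow> (nat \<Rightarrow> ('v, 'w) level_map) \<Rightarrow> ('v, 'w) completed_map \<Rightarrow> bool" where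
  "limit_iso G1 X1 G2 X2 m f F \<longleftrightarrow>
     residual_iso (completed_complex G1 X1) (completed_complex G2 X2) F \<and>
     (\<forall>j k. (\<forall>\<xi>\<in>cells (completed_complex G1 X1) k. cmap F k \<xi> (m j) = cmap (f j) k (\<xi> (m j))) \<and>
            (\<forall>\<xi>\<in>occs (completed_complex G1 X1) k. omap F k \<xi> (m j) = omap (f j) k (\<xi> (m j))))"

definition twisted_map ::
    "('w \<Rightarrow> 'w) monoid \<Rightarrow> (('w \<Rightarrow> 'w) set \<Rightarrow> ('w \<Rightarrow> 'w) set) \<Rightarrow> ('v, 'w) completed_map
      \<Rightarrow> ('v, 'w) completed_map" where
  "twisted_map G2 u F =
     \<lparr>cmap = (\<lambda>k \<xi>. completed_act G2 cell_act (inv\<^bsub>profinite_completion G2\<^esub> u) (cmap F k \<xi>)),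
      omap = (\<lambda>k \<xi>. completed_act G2 occ_act (inv\<^bsub>profinite_completion G2\<^esub> u) (omap F k \<xi>))\<rparr>"

definition maps_originals_onto ::
    "('v \<Rightarrow> 'v) monoid \<Rightarrow> 'v set set \<Rightarrow> ('w \<Rightarrow> 'w) monoid \<Rightarrow> 'w set set \<Rightarrow> ('v, 'w) completed_map \<Rightarrow> bool" where
  "maps_originals_onto G1 X1 G2 X2 E \<longleftrightarrow> (\<forall>k.
     cmap E k ` (original G1 cell_act ` simplices X1 k) = original G2 cell_act ` simplices X2 k \<and>
     omap E k ` (original G1 occ_act ` occurrences X1 k) = original G2 occ_act ` occurrences X2 k)"

text \<open>On original simplices and occurrences, \<open>E\<close> is given by the vertex map \<open>f\<close>.\<close>

definition restricts_to ::
    "('v \<Rightarrow> 'v) monoid \<Rightarrow> 'v set set \<Rightarrow> ('w \<Rightarrow> 'w) monoid \<Rightarrow> ('v, 'w) completed_map \<Rightarrow> ('v \<Rightarrow> 'w) \<Rightarrow> bool" where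
  "restricts_to G1 X1 G2 E f \<longleftrightarrow> (\<forall>k.
     (\<forall>s\<in>simplices X1 k. cmap E k (original G1 cell_act s) = original G2 cell_act (f ` s)) \<and>
     (\<forall>(s, t)\<in>occurrences X1 k.
        omap E k (original G1 occ_act (s, t)) = original G2 occ_act (f ` s, f ` t)))"

definition vertex_equivariant ::
    "('v \<Rightarrow> 'v) monoid \<Rightarrow> 'v set set \<Rightarrow> (('v \<Rightarrow> 'v) \<Rightarrow> ('w \<Rightarrow> 'w)) \<Rightarrow> ('v \<Rightarrow> 'w) \<Rightarrow> bool" where
  "vertex_equivariant G X h f \<longleftrightarrow> (\<forall>g\<in>carrier G. \<forall>v\<in>verts X. f (g v) = h g (f v))"

definition descends_to :: "'c set set \<Rightarrow> ('c \<Rightarrow> 'a) \<Rightarrow> ('d \<Rightarrow> 'b) \<Rightarrow> ('c \<Rightarrow> 'd) \<Rightarrow> ('a \<Rightarrow> 'b) \<Rightarrow> bool" where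
  "descends_to X1 p1 p2 f fb \<longleftrightarrow> (\<forall>v\<in>verts X1. fb (p1 v) = p2 (f v))"


section \<open>Distinguished families of subcomplexes\<close>

definition invariant_subcomplex :: "('v \<Rightarrow> 'v) monoid \<Rightarrow> 'v set set \<Rightarrow> 'v set set \<Rightarrow> bool" where
  "invariant_subcomplex G X Z \<longleftrightarrow>
     Z \<subseteq> X \<and> abstract_complex Z \<and> (\<forall>g\<in>carrier G. \<forall>s\<in>Z. g ` s \<in> Z)"

text \<open>As \<open>Z\<close> is invariant, the image of \<open>Z\<close> in the complex of \<open>K\<^sub>m(G)\X\<close> is the complex of
  \<open>K\<^sub>m(G)\Z\<close>.\<close>

definition preserves_families ::
    "('v \<Rightarrow> 'v) monoid \<Rightarrow> ('w \<Rightarrow> 'w) monoid \<Rightarrow> nat \<Rightarrow> 'l set \<Rightarrow> ('l \<Rightarrow> 'v set set) \<Rightarrow> ('l \<Rightarrow> 'w set set)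
      \<Rightarrow> ('l \<Rightarrow> 'l) \<Rightarrow> ('v, 'w) level_map \<Rightarrow> bool" where
  "preserves_families G1 G2 m \<Lambda> Z1 Z2 \<sigma> f \<longleftrightarrow> (\<forall>l\<in>\<Lambda>. \<forall>k.
     cmap f k ` cells (level_complex G1 (Z1 l) m) k = cells (level_complex G2 (Z2 (\<sigma> l)) m) k \<and>
     omap f k ` occs (level_complex G1 (Z1 l) m) k = occs (level_complex G2 (Z2 (\<sigma> l)) m) k)"

end

theory Submission
  imports Defs
begin

text \<open>The levels are finite, so by compactness equivariant isomorphisms can be chosen compatibly, and
  their limit \<open>F\<close> is \<open>\<Phi>\<close>-equivariant.  The completion of \<open>G\<close> acts freely on the completed complex, and
  every completed cell is a translate of an original one.  Translating by some \<open>u\<close>, we may assume that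
  \<open>F\<close> sends one original vertex to an original vertex.  By freeness, a completed occurrence incident
  to an original simplex is itself original; as \<open>X1\<close> is connected, \<open>F\<close> therefore maps all original
  simplices and occurrences to original ones, and so does its inverse.  The resulting bijection of
  simplices is induced by a vertex map, and comparing its values on one orbit with the action of
  \<open>\<Phi>\<close> yields the isomorphism \<open>h\<close>.\<close>


section \<open>Subgroups of bounded index\<close>

text \<open>The levels are finite because the deck group is finitely generated, and a finitely
  generated group has only finitely many subgroups of bounded index. Descent from level n to level m
  rests on \<open>\<Phi>\<close> respecting the subgroups \<open>K_sub\<close> themselves and not
  only the topology: a subgroup of index at most m pulls back to one of index at most m. That
  argument is available on the image of \<open>G1\<close>, and continuity carries it to the whole
  completion. The obstacle is that a limit isomorphism has no reason to respect original cells,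
  since the completed complex has many more points. Freeness turns originality into a statement
  about group elements: a completed occurrence is x times an original one, with x in the completion,
  and if one of its projections is original then x lies in the group itself. Residual finiteness
  keeps distinct original cells distinct, so that a map of original points is a map of
  simplices.\<close>

context group
begin

lemma rcos_eq_iff:
  assumes "subgroup L G" "a \<in> carrier G" "b \<in> carrier G"
  shows "L #> a = L #> b \<longleftrightarrow> a \<otimes> inv b \<in> L"
proof -
  have L: "L \<subseteq> carrier G" and ab: "a \<otimes> inv b \<in> carrier G"
    using assms by (auto dest: subgroup.subset)
  have "L #> a = L #> b \<longleftrightarrow> L #> (a \<otimes> inv b) = L"
    using coset_mult_inv1[OF _ assms(2,3) L] coset_mult_inv2[OF _ assms(2,3) L] by metis
  also have "\<dots> \<longleftrightarrow> a \<otimes> inv b \<in> L"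
    using coset_join1[OF _ ab assms(1)] coset_join2[OF ab assms(1)] by metis
  finally show ?thesis .
qed

text \<open>Sending each value of \<open>f\<close> to the coset of one chosen preimage is onto the
  cosets. Here \<open>f\<close> may be any function that separates cosets, for instance one built
  from a choice of representatives.\<close>

lemma index_le:
  assumes L: "subgroup L G" and D: "finite D" and f: "\<And>a. a \<in> carrier G \<Longrightarrow> f a \<in> D"
    and sep: "\<And>a b. \<lbrakk>a \<in> carrier G; b \<in> carrier G; f a = f b\<rbrakk> \<Longrightarrow> a \<otimes> inv b \<in> L"
  shows "finite (rcosets L)" "card (rcosets L) \<le> card D"
proof -
  define r where "r d = L #> (SOME a. a \<in> carrier G \<and> f a = d)" for d
  have "L #> a = r (f a)" if a: "a \<in> carrier G" for a
  proof -
    define b where "b = (SOME b. b \<in> carrier G \<and> f b = f a)"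
    have b: "b \<in> carrier G \<and> f b = f a"
      unfolding b_def by (rule someI) (use a in blast)
    then have "L #> a = L #> b"
      using sep[of a b] rcos_eq_iff[OF L a, of b] a by simp
    then show ?thesis by (simp only: r_def b_def)
  qed
  then have "rcosets L \<subseteq> r ` D"
    using f by (force simp: RCOSETS_def)
  then show "finite (rcosets L)" "card (rcosets L) \<le> card D"
    using D by (auto intro: finite_subset surj_card_le)
qed

text \<open>\<open>g \<mapsto> L #> h g\<close> separates the cosets of the preimage. With
  conjugations for \<open>h\<close> this gives normality of \<open>K_sub\<close>; with general
  homomorphisms it serves to compare completions.\<close>

lemma index_le_vimage:
  assumes H: "group H" and h: "h \<in> hom G H" and L: "subgroup L H" and fin: "finite (rcosets\<^bsub>H\<^esub> L)"
  shows "subgroup {g \<in> carrier G. h g \<in> L} G"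
    and "finite (rcosets {g \<in> carrier G. h g \<in> L})"
    and "card (rcosets {g \<in> carrier G. h g \<in> L}) \<le> card (rcosets\<^bsub>H\<^esub> L)"
proof -
  interpret H: group H by (rule H)
  interpret h: group_hom G H h using h by unfold_locales
  show sg: "subgroup {g \<in> carrier G. h g \<in> L} G"
  proof (rule subgroupI)
    have "\<one> \<in> {g \<in> carrier G. h g \<in> L}" using L by (simp add: subgroup.one_closed)
    then show "{g \<in> carrier G. h g \<in> L} \<noteq> {}" by blast
  qed (use L in \<open>auto simp: subgroup.m_closed subgroup.m_inv_closed\<close>)
  have sep: "a \<otimes> inv b \<in> {g \<in> carrier G. h g \<in> L}"
    if "a \<in> carrier G" "b \<in> carrier G" "L #>\<^bsub>H\<^esub> h a = L #>\<^bsub>H\<^esub> h b" for a b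
    using that H.rcos_eq_iff[OF L, of "h a" "h b"] by auto
  have mem: "L #>\<^bsub>H\<^esub> h a \<in> rcosets\<^bsub>H\<^esub> L" if "a \<in> carrier G" for a
    using that L by (auto intro!: H.rcosetsI dest: subgroup.subset)
  show "finite (rcosets {g \<in> carrier G. h g \<in> L})"
    "card (rcosets {g \<in> carrier G. h g \<in> L}) \<le> card (rcosets\<^bsub>H\<^esub> L)"
    by (rule index_le[OF sg fin mem sep]; assumption)+
qed

section \<open>The subgroups \<open>K_sub G m\<close>: normality, and finite index in finitely
  generated groups\<close>

lemma K_sub_subset: "K_sub G m \<subseteq> carrier G"
  by (auto simp: K_sub_def)

lemma K_sub_antimono: "m \<le> n \<Longrightarrow> K_sub G n \<subseteq> K_sub G m"
  unfolding K_sub_def by (auto dest: le_trans)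

lemma K_sub_subset_finite_index:
  "\<lbrakk>subgroup L G; finite (rcosets L); card (rcosets L) \<le> m\<rbrakk> \<Longrightarrow> K_sub G m \<subseteq> L"
  by (auto simp: K_sub_def)

lemma subgroup_K_sub: "subgroup (K_sub G m) G"
  unfolding K_sub_def
  by (rule subgroupI) (auto simp: subgroup.m_closed subgroup.m_inv_closed subgroup.one_closed
      intro!: exI[of _ \<one>])

lemma conj_hom: "g \<in> carrier G \<Longrightarrow> (\<lambda>x. g \<otimes> x \<otimes> inv g) \<in> hom G G"
proof (rule homI)
  fix x y assume "g \<in> carrier G" "x \<in> carrier G" "y \<in> carrier G"
  moreover from this have "inv g \<otimes> (g \<otimes> (y \<otimes> inv g)) = y \<otimes> inv g"
    by (simp add: m_assoc[symmetric])
  ultimately show "g \<otimes> (x \<otimes> y) \<otimes> inv g = g \<otimes> x \<otimes> inv g \<otimes> (g \<otimes> y \<otimes> inv g)"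
    by (simp add: m_assoc)
qed auto

text \<open>Conjugation pulls a subgroup of index at most \<open>m\<close> back to another such
  subgroup, so the family whose intersection is taken is stable under it.\<close>

lemma normal_K_sub: "K_sub G m \<lhd> G"
proof (rule normal_invI[OF subgroup_K_sub])
  fix g k assume g: "g \<in> carrier G" and k: "k \<in> K_sub G m"
  show "g \<otimes> k \<otimes> inv g \<in> K_sub G m"
  proof -
    have "g \<otimes> k \<otimes> inv g \<in> L"
      if L: "subgroup L G" "finite (rcosets L)" "card (rcosets L) \<le> m" for L
    proof -
      note pre = index_le_vimage[OF group_axioms conj_hom[OF g] L(1,2)]
      have "K_sub G m \<subseteq> {x \<in> carrier G. g \<otimes> x \<otimes> inv g \<in> L}"
        using K_sub_subset_finite_index[OF pre(1,2)] pre(3) L(3) le_trans by blast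
      then show ?thesis using k by blast
    qed
    moreover have "k \<in> carrier G" using k K_sub_subset by blast
    ultimately show ?thesis using g by (simp add: K_sub_def)
  qed
qed

text \<open>Level 0 is thereby the quotient by the whole group. It is the bottom of every tower
  below and the place where orbits of the group are compared.\<close>

lemma K_sub_0: "K_sub G 0 = carrier G"
proof -
  have "rcosets L \<noteq> {}" for L by (auto simp: RCOSETS_def)
  then show ?thesis by (auto simp: K_sub_def)
qed

text \<open>A subgroup of index at most \<open>n\<close> is encoded by the transition table of the generators on its
  cosets, numbered below \<open>n\<close>.\<close>

lemma finite_bounded_index_subgroups:
  assumes S: "finite S" "S \<subseteq> carrier G" and gen: "generate G S = carrier G"
  shows "finite {L. subgroup L G \<and> finite (rcosets L) \<and> card (rcosets L) \<le> n}" (is "finite ?\<L>")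
proof -
  define numbers where "numbers L b \<longleftrightarrow> (\<forall>g\<in>carrier G. b g < n) \<and>
    (\<forall>g\<in>carrier G. \<forall>h\<in>carrier G. b g = b h \<longleftrightarrow> L #> g = L #> h)" for L and b :: "'a \<Rightarrow> nat"
  have "\<exists>b. numbers L b" if L: "L \<in> ?\<L>" for L
  proof -
    obtain e where e: "bij_betw e (rcosets L) {0..<card (rcosets L)}"
      using L ex_bij_betw_finite_nat by blast
    have mem: "L #> g \<in> rcosets L" if "g \<in> carrier G" for g
      using that L by (auto intro!: rcosetsI dest: subgroup.subset)
    show ?thesis
      unfolding numbers_def
    proof (intro exI[of _ "\<lambda>g. e (L #> g)"] conjI ballI)
      show "e (L #> g) < n" if "g \<in> carrier G" for g
        using bij_betw_apply[OF e mem[OF that]] L by auto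
      show "e (L #> g) = e (L #> h) \<longleftrightarrow> L #> g = L #> h" if "g \<in> carrier G" "h \<in> carrier G" for g h
        using bij_betw_imp_inj_on[OF e] mem that by (auto dest: inj_onD)
    qed
  qed
  then obtain b where b: "\<And>L. L \<in> ?\<L> \<Longrightarrow> numbers L (b L)"
    by metis
  have b_less: "b L g < n" if "L \<in> ?\<L>" "g \<in> carrier G" for L g
    using b[OF that(1)] that(2) by (auto simp: numbers_def)
  have b_eq: "b L g = b L h \<longleftrightarrow> L #> g = L #> h"
    if "L \<in> ?\<L>" "g \<in> carrier G" "h \<in> carrier G" for L g h
    using b[OF that(1)] that(2,3) by (auto simp: numbers_def)
  have b_mult: "b L (g \<otimes> s) = b L (h \<otimes> s)"
    if "L \<in> ?\<L>" "g \<in> carrier G" "h \<in> carrier G" "s \<in> carrier G" "b L g = b L h" for L g h s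
    using that b_eq by (simp add: coset_mult_assoc[symmetric] subgroup.subset)
  \<comment> \<open>The first entry records which number \<open>L\<close> itself received, since the
    numbering of the cosets is an arbitrary bijection.\<close>
  define code where "code L = (b L \<one>, {(b L g, s, b L (g \<otimes> s)) |g s. g \<in> carrier G \<and> s \<in> S})" for L
  have "code ` ?\<L> \<subseteq> {..<n} \<times> Pow ({..<n} \<times> S \<times> {..<n})"
    using b_less S by (auto simp: code_def)
  then have fin: "finite (code ` ?\<L>)"
    by (rule finite_subset) (use S in auto)
  have sub: "L \<subseteq> L'" if L: "L \<in> ?\<L>" and L': "L' \<in> ?\<L>" and eq: "code L = code L'" for L L'
  proof -
    \<comment> \<open>Every row in the table of \<open>L\<close> is a row in the table of
      \<open>L'\<close>, though possibly witnessed there by another group element.\<close>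
    have step: "\<exists>h. h \<in> carrier G \<and> b L' h = b L g \<and> b L' (h \<otimes> s) = b L (g \<otimes> s)"
      if "g \<in> carrier G" "s \<in> S" for g s
    proof -
      have "(b L g, s, b L (g \<otimes> s)) \<in> snd (code L')"
        unfolding eq[symmetric] using that by (auto simp: code_def)
      then show ?thesis by (auto simp: code_def)
    qed
    \<comment> \<open>Equal tables describe the same action on numbers, so right multiplication by a
      word in the generators takes equally numbered cosets to equally numbered cosets.\<close>
    have act: "b L (a \<otimes> g) = b L' (a' \<otimes> g)"
      if "g \<in> generate G S" "a \<in> carrier G" "a' \<in> carrier G" "b L a = b L' a'" for g a a'
      using that
    proof (induction g arbitrary: a a' rule: generate.induct)
      case one
      then show ?case by simp
    next
      case (incl s)
      obtain h where "h \<in> carrier G" "b L' h = b L a" "b L' (h \<otimes> s) = b L (a \<otimes> s)"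
        using step incl by blast
      then show ?case
        using b_mult[OF L', of h a' s] incl S by auto
    next
      \<comment> \<open>The row starting at \<open>a \<otimes> inv s\<close> ends at
        \<open>a\<close>; read backwards, it gives the action of \<open>inv s\<close>.\<close>
      case (inv s)
      then have s: "s \<in> carrier G" using S by auto
      obtain h where h: "h \<in> carrier G" "b L' h = b L (a \<otimes> inv s)" "b L' (h \<otimes> s) = b L a"
        using step[of "a \<otimes> inv s" s] inv s by (auto simp: m_assoc)
      then have "b L' (h \<otimes> s \<otimes> inv s) = b L' (a' \<otimes> inv s)"
        using b_mult[OF L', of "h \<otimes> s" a' "inv s"] inv s by auto
      then show ?case using h s by (simp add: m_assoc)
    next
      case (eng g h)
      have "g \<in> carrier G" "h \<in> carrier G"
        using eng.hyps generate_in_carrier[OF S(2)] by auto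
      then show ?case
        using eng.IH(2)[of "a \<otimes> g" "a' \<otimes> g"] eng.IH(1)[of a a'] eng.prems by (simp add: m_assoc)
    qed
    show ?thesis
    proof
      fix g assume g: "g \<in> L"
      then have gc: "g \<in> carrier G" using L subgroup.subset by blast
      have L1: "L #> g = L #> \<one>" and iff: "L' #> g = L' #> \<one> \<longleftrightarrow> g \<in> L'"
        using L L' g gc by (auto simp: rcos_eq_iff)
      have "b L \<one> = b L' \<one>" using eq by (simp add: code_def)
      then have "b L g = b L' g"
        using act[of g \<one> \<one>] gc gen by auto
      then have "b L' g = b L' \<one>"
        using b_eq[OF L gc one_closed] L1 \<open>b L \<one> = b L' \<one>\<close> by simp
      then show "g \<in> L'" using b_eq[OF L' gc one_closed] iff by simp
    qed
  qed
  have "inj_on code ?\<L>"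
    by (rule inj_onI, rule subset_antisym) (simp_all only: sub)
  then show ?thesis using fin finite_imageD by blast
qed

text \<open>The cosets modulo the finitely many subgroups of index at most \<open>n\<close>, taken
  together, separate the cosets of the intersection.\<close>

lemma finite_index_K_sub:
  assumes "finite S" "S \<subseteq> carrier G" "generate G S = carrier G"
  shows "finite (rcosets (K_sub G n))"
proof -
  define \<L> where "\<L> = {L. subgroup L G \<and> finite (rcosets L) \<and> card (rcosets L) \<le> n}"
  have fin: "finite (\<Pi>\<^sub>E L\<in>\<L>. rcosets L)"
    using finite_bounded_index_subgroups[OF assms, of n]
    by (auto intro!: finite_PiE simp: \<L>_def)
  show ?thesis
  proof (rule index_le(1)[OF subgroup_K_sub fin, of "\<lambda>g. \<lambda>L\<in>\<L>. L #> g"])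
    fix a assume "a \<in> carrier G"
    then show "(\<lambda>L\<in>\<L>. L #> a) \<in> (\<Pi>\<^sub>E L\<in>\<L>. rcosets L)"
      by (auto simp: \<L>_def intro!: rcosetsI dest: subgroup.subset)
  next
    fix a b assume ab: "a \<in> carrier G" "b \<in> carrier G"
      and eq: "(\<lambda>L\<in>\<L>. L #> a) = (\<lambda>L\<in>\<L>. L #> b)"
    have "a \<otimes> inv b \<in> L" if "L \<in> \<L>" for L
      using fun_cong[OF eq, of L] that ab rcos_eq_iff[of L a b] by (auto simp: \<L>_def)
    then show "a \<otimes> inv b \<in> K_sub G n"
      using ab by (auto simp: K_sub_def \<L>_def)
  qed
qed

end

section \<open>Profinite completions\<close>

text \<open>The form in which finite generation is passed on: the theory of completions below works
  from the finiteness of the quotients by \<open>K_sub\<close>.\<close>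

locale finite_K = group G for G (structure) +
  assumes finite_rcosets_K_sub: "finite (rcosets (K_sub G m))"
begin

abbreviation K where "K m \<equiv> K_sub G m"
abbreviation hat where "hat \<equiv> profinite_completion G"

lemma K_fi_normal [simp, intro]: "K m \<in> fi_normal G"
  using normal_K_sub finite_rcosets_K_sub by (simp add: fi_normal_def)

text \<open>The subgroups \<open>K m\<close> are cofinal: \<open>N\<close> contains
  \<open>K m\<close> once \<open>m\<close> is its index. Hence an element of the completion is known
  from its coordinates at these subgroups.\<close>

lemma ex_K_subset:
  assumes "N \<in> fi_normal G" obtains m where "K m \<subseteq> N"
  using assms K_sub_subset_finite_index[of N "card (rcosets N)"]
  by (auto simp: fi_normal_def normal_def)

lemma fi_normalD:
  assumes "N \<in> fi_normal G"
  shows "N \<lhd> G" "subgroup N G" "finite (rcosets N)" "N \<subseteq> carrier G" "group (G Mod N)"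
  using assms by (auto simp: fi_normal_def normal_imp_subgroup subgroup.subset normal.factorgroup_is_group)

lemma hat_iff:
  "x \<in> carrier hat \<longleftrightarrow> x \<in> extensional (fi_normal G) \<and>
     (\<forall>N\<in>fi_normal G. \<exists>g\<in>carrier G. x N = N #> g) \<and>
     (\<forall>N\<in>fi_normal G. \<forall>M\<in>fi_normal G. N \<subseteq> M \<longrightarrow> x N \<subseteq> x M)"
proof -
  have "c \<in> rcosets N \<longleftrightarrow> (\<exists>g\<in>carrier G. c = N #> g)" for c N
    by (auto simp: RCOSETS_def)
  then show ?thesis
    by (simp add: profinite_completion_def PiE_iff FactGroup_def conj_ac)
qed

lemma subgroup_hat: "subgroup (carrier hat) (product_group (fi_normal G) (\<lambda>N. G Mod N))"
proof -
  let ?P = "product_group (fi_normal G) (\<lambda>N. G Mod N)"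
  interpret P: group ?P by (rule product_group) (simp add: fi_normalD)
  have sub: "carrier hat \<subseteq> carrier ?P"
    by (auto simp: profinite_completion_def)
  show ?thesis
  proof (rule P.subgroupI[OF sub])
    have "(\<lambda>N\<in>fi_normal G. N) \<in> carrier hat"
      by (auto simp: hat_iff fi_normalD(4) intro!: bexI[of _ \<one>])
    then show "carrier hat \<noteq> {}" by blast
  next
    fix x assume x: "x \<in> carrier hat"
    then have xP: "x \<in> (\<Pi>\<^sub>E i\<in>fi_normal G. carrier (G Mod i))" using sub by auto
    have "inv\<^bsub>G Mod N\<^esub> x N = set_inv (x N)" if "N \<in> fi_normal G" for N
      using normal.inv_FactGroup[OF fi_normalD(1)[OF that]] xP that by (auto simp: PiE_iff)
    then have inv: "inv\<^bsub>?P\<^esub> x = (\<lambda>N\<in>fi_normal G. set_inv (x N))"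
      using inv_product_group[OF xP fi_normalD(5)] by (auto intro!: restrict_ext)
    have "inv\<^bsub>?P\<^esub> x \<in> carrier ?P" using x sub by blast
    moreover have "x N \<subseteq> x M \<Longrightarrow> set_inv (x N) \<subseteq> set_inv (x M)" for N M
      by (auto simp: SET_INV_def)
    ultimately show "inv\<^bsub>?P\<^esub> x \<in> carrier hat"
      using x by (auto simp: profinite_completion_def inv)
  next
    fix x y assume xy: "x \<in> carrier hat" "y \<in> carrier hat"
    then have "x \<otimes>\<^bsub>?P\<^esub> y \<in> carrier ?P" using sub by blast
    moreover have "\<lbrakk>x N \<subseteq> x M; y N \<subseteq> y M\<rbrakk> \<Longrightarrow> x N <#> y N \<subseteq> x M <#> y M" for N M
      by (auto simp: set_mult_def)
    ultimately show "x \<otimes>\<^bsub>?P\<^esub> y \<in> carrier hat"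
      using xy by (auto simp: profinite_completion_def FactGroup_def)
  qed
qed

sublocale hat: group "profinite_completion G"
proof -
  interpret P: group "product_group (fi_normal G) (\<lambda>N. G Mod N)"
    by (rule product_group) (simp add: fi_normalD)
  show "group hat"
    using P.subgroup_imp_group[OF subgroup_hat] by (simp add: profinite_completion_def)
qed

lemma hat_mult: "N \<in> fi_normal G \<Longrightarrow> (x \<otimes>\<^bsub>hat\<^esub> y) N = x N <#> y N"
  by (simp add: profinite_completion_def FactGroup_def)

lemma hat_one: "N \<in> fi_normal G \<Longrightarrow> \<one>\<^bsub>hat\<^esub> N = N"
  by (simp add: profinite_completion_def)

lemma hat_coset:
  assumes "x \<in> carrier hat" "N \<in> fi_normal G" "g \<in> x N"
  shows "g \<in> carrier G" "x N = N #> g"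
proof -
  obtain h where h: "h \<in> carrier G" "x N = N #> h"
    using assms by (auto simp: hat_iff)
  show g: "g \<in> carrier G"
    using h assms fi_normalD(4)[of N] r_coset_subset_G by blast
  show "x N = N #> g"
    using h assms repr_independence[of g N h] fi_normalD(2)[of N] by simp
qed

lemma hat_coset_ex:
  assumes "x \<in> carrier hat" "N \<in> fi_normal G"
  obtains g where "g \<in> carrier G" "g \<in> x N" "x N = N #> g"
proof -
  obtain h where h: "h \<in> carrier G" "x N = N #> h"
    using assms by (auto simp: hat_iff)
  then show ?thesis using that rcos_self[of h N] fi_normalD(2)[of N] assms by auto
qed

lemma hat_mono:
  "\<lbrakk>x \<in> carrier hat; N \<in> fi_normal G; M \<in> fi_normal G; N \<subseteq> M\<rbrakk> \<Longrightarrow> x N \<subseteq> x M"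
  by (auto simp: hat_iff)

lemma hat_coset_mono:
  assumes "x \<in> carrier hat" "N \<in> fi_normal G" "M \<in> fi_normal G" "N \<subseteq> M" "g \<in> carrier G" "x N = N #> g"
  shows "x M = M #> g"
  using assms hat_coset(2)[of x M g] hat_mono[of x N M] rcos_self[of g N] fi_normalD(2)[of N] by auto

lemma hat_mult_coset:
  assumes "N \<in> fi_normal G" "a \<in> carrier G" "b \<in> carrier G" "x N = N #> a" "y N = N #> b"
  shows "(x \<otimes>\<^bsub>hat\<^esub> y) N = N #> (a \<otimes> b)"
  using assms normal.rcos_sum[OF fi_normalD(1)] by (simp add: hat_mult)

lemma hat_inv_coset:
  assumes "x \<in> carrier hat" "N \<in> fi_normal G" "a \<in> carrier G" "x N = N #> a"
  shows "(inv\<^bsub>hat\<^esub> x) N = N #> inv a"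
proof -
  obtain b where b: "b \<in> carrier G" "(inv\<^bsub>hat\<^esub> x) N = N #> b"
    using hat_coset_ex[OF hat.inv_closed[OF assms(1)] assms(2)] by blast
  then have "N #> (b \<otimes> a) = N"
    using hat_mult_coset[of N b a "inv\<^bsub>hat\<^esub> x" x] assms by (simp add: hat_one)
  then have "b \<otimes> a \<in> N" using coset_join1 b assms fi_normalD by auto
  then have "N #> b = N #> inv a"
    using b assms by (simp add: rcos_eq_iff fi_normalD)
  then show ?thesis using b by simp
qed

lemma hat_eqI:
  assumes x: "x \<in> carrier hat" and y: "y \<in> carrier hat" and eq: "\<And>m. x (K m) = y (K m)"
  shows "x = y"
proof
  fix N
  show "x N = y N"
  proof (cases "N \<in> fi_normal G")
    case True
    obtain m where m: "K m \<subseteq> N" using ex_K_subset[OF True] .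
    obtain g where g: "g \<in> carrier G" "x (K m) = K m #> g"
      using hat_coset_ex[OF x, of "K m"] by auto
    show ?thesis
      using hat_coset_mono[OF x _ True m g] hat_coset_mono[OF y _ True m g(1)] eq[of m] g by simp
  next
    case False
    then show ?thesis using x y by (auto simp: hat_iff extensional_def)
  qed
qed

text \<open>The completion is already the inverse limit of the quotients by the subgroups \<open>K m\<close>.\<close>

lemma hat_of_thread:
  assumes c: "\<And>m. c m \<in> rcosets (K m)" and mono: "\<And>m n. m \<le> n \<Longrightarrow> c n \<subseteq> c m"
  shows "\<exists>x\<in>carrier hat. \<forall>m. x (K m) = c m"
proof -
  have "\<exists>a. a \<in> carrier G \<and> c m = K m #> a" for m
    using c[of m] by (auto simp: RCOSETS_def)
  then obtain a where a: "\<And>m. a m \<in> carrier G" "\<And>m. c m = K m #> a m" by metis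
  have a_mem: "a p \<in> c m" if "m \<le> p" for m p
    using mono[OF that] rcos_self[OF a(1) subgroup_K_sub, of p] a(2)[of p] by auto
  have step: "N #> a p = N #> a m" if "N \<in> fi_normal G" "K m \<subseteq> N" "m \<le> p" for N m p
  proof -
    have "a p \<in> N #> a m"
      using a_mem[OF \<open>m \<le> p\<close>] a(2)[of m] that by (auto simp: r_coset_def)
    then show ?thesis using repr_independence[of "a p" N "a m"] that a fi_normalD by auto
  qed
  have indep: "N #> a m = N #> a n" if "N \<in> fi_normal G" "K m \<subseteq> N" "K n \<subseteq> N" for N m n
    using step[OF that(1,2), of "max m n"] step[OF that(1,3), of "max m n"] by simp
  \<comment> \<open>By \<open>indep\<close> any level inside \<open>N\<close> gives the same coset,
    so the choices for different \<open>N\<close> fit together.\<close>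
  define i where "i N = (SOME m. K m \<subseteq> N)" for N
  have i: "K (i N) \<subseteq> N" if "N \<in> fi_normal G" for N
    unfolding i_def by (rule someI_ex) (use ex_K_subset[OF that] in blast)
  define x where "x = (\<lambda>N\<in>fi_normal G. N #> a (i N))"
  have "x \<in> carrier hat"
    unfolding hat_iff
  proof (intro conjI ballI impI)
    show "x \<in> extensional (fi_normal G)" by (simp add: x_def)
    show "\<exists>g\<in>carrier G. x N = N #> g" if "N \<in> fi_normal G" for N
      using that a by (auto simp: x_def)
    fix N M assume NM: "N \<in> fi_normal G" "M \<in> fi_normal G" "N \<subseteq> M"
    have "N #> a (i N) \<subseteq> M #> a (i N)" using NM by (auto simp: r_coset_def)
    also have "\<dots> = M #> a (i M)" using indep[of M "i N" "i M"] i[of N] i[of M] NM by blast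
    finally show "x N \<subseteq> x M" using NM by (simp add: x_def)
  qed
  moreover have "x (K m) = c m" for m
    using indep[of "K m" "i (K m)" m] i[of "K m"] a(2)[of m] by (simp add: x_def)
  ultimately show ?thesis by blast
qed

section \<open>The canonical map of a group to its completion\<close>

definition embed where "embed g = (\<lambda>N\<in>fi_normal G. N #> g)"

lemma embed_K [simp]: "embed g (K m) = K m #> g"
  by (simp add: embed_def)

lemma embed_apply: "N \<in> fi_normal G \<Longrightarrow> embed g N = N #> g"
  by (simp add: embed_def)

lemma embed_closed [simp, intro]: "g \<in> carrier G \<Longrightarrow> embed g \<in> carrier hat"
  by (auto simp: hat_iff embed_def r_coset_def)

lemma embed_mult:
  assumes "g \<in> carrier G" "h \<in> carrier G"
  shows "embed (g \<otimes> h) = embed g \<otimes>\<^bsub>hat\<^esub> embed h"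
proof (rule hat_eqI)
  show "embed (g \<otimes> h) (K m) = (embed g \<otimes>\<^bsub>hat\<^esub> embed h) (K m)" for m
    using assms hat_mult_coset[of "K m" g h "embed g" "embed h"] by simp
qed (use assms in auto)

lemma embed_inj:
  assumes rf: "residually_finite G" and "g \<in> carrier G" "h \<in> carrier G" "embed g = embed h"
  shows "g = h"
proof (rule ccontr)
  assume "g \<noteq> h"
  then have "g \<otimes> inv h \<noteq> \<one>"
    using assms by (metis inv_closed inv_inv inv_equality)
  then obtain N where N: "N \<in> fi_normal G" "g \<otimes> inv h \<notin> N"
    using rf assms by (auto simp: residually_finite_def)
  have "N #> g = N #> h" using embed_apply[OF N(1)] assms(4) by metis
  then show False using N assms rcos_eq_iff[of N g h] fi_normalD by auto
qed

end

section \<open>Isomorphisms of completions that respect the subgroups \<open>K_sub\<close>\<close>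

locale completion_iso = G1: finite_K G1 + G2: finite_K G2
  for G1 :: "'g monoid" and G2 :: "'h monoid"
    and \<Phi> :: "('g set \<Rightarrow> 'g set) \<Rightarrow> ('h set \<Rightarrow> 'h set)" +
  assumes \<Phi>: "\<Phi> \<in> iso (profinite_completion G1) (profinite_completion G2)"
    and \<Phi>_level: "\<lbrakk>x \<in> carrier (profinite_completion G1); y \<in> carrier (profinite_completion G1);
      x (K_sub G1 m) = y (K_sub G1 m)\<rbrakk> \<Longrightarrow> \<Phi> x (K_sub G2 m) = \<Phi> y (K_sub G2 m)"
begin

lemma \<Phi>_closed [simp, intro]: "x \<in> carrier G1.hat \<Longrightarrow> \<Phi> x \<in> carrier G2.hat"
  using \<Phi> by (auto simp: iso_def hom_def)

lemma \<Phi>_mult: "\<lbrakk>x \<in> carrier G1.hat; y \<in> carrier G1.hat\<rbrakk> \<Longrightarrow> \<Phi> (x \<otimes>\<^bsub>G1.hat\<^esub> y) = \<Phi> x \<otimes>\<^bsub>G2.hat\<^esub> \<Phi> y"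
  using \<Phi> by (auto simp: iso_def hom_def)

text \<open>\<open>\<Phi>_level\<close> makes the description that defines
  \<open>\<Phi>\<^sub>m\<close> unique. From here on the level maps are computed on elements of the
  completion.\<close>

lemma induced_level_map_eq:
  "x \<in> carrier G1.hat \<Longrightarrow> induced_level_map G1 G2 \<Phi> m (x (K_sub G1 m)) = \<Phi> x (K_sub G2 m)"
  unfolding induced_level_map_def by (rule the_equality) (use \<Phi>_level in blast)+

end

text \<open>A basic open set constrains finitely many coordinates, and one level lies below all of
  them. The bound \<open>m \<le> n\<close> allows a prescribed coarser coordinate to be controlled
  at the same time.\<close>

lemma profinite_nbhd:
  fixes G (structure)
  assumes "finite_K G" and U: "openin (profinite_topology G) U" and x: "x \<in> U"
  obtains n where "m \<le> n" "\<And>y. \<lbrakk>y \<in> carrier (profinite_completion G); y (K_sub G n) = x (K_sub G n)\<rbrakk> \<Longrightarrow> y \<in> U"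
proof -
  interpret finite_K G by fact
  let ?T = "\<lambda>N. discrete_topology (carrier (G Mod N))"
  obtain V where V: "openin (product_topology ?T (fi_normal G)) V" and UV: "U = V \<inter> carrier hat"
    using U unfolding profinite_topology_def openin_subtopology by blast
  have xV: "x \<in> V" and xh: "x \<in> carrier hat" using x UV by auto
  have "\<exists>W. finite {i \<in> fi_normal G. W i \<noteq> topspace (?T i)} \<and> (\<forall>i\<in>fi_normal G. openin (?T i) (W i)) \<and>
         x \<in> Pi\<^sub>E (fi_normal G) W \<and> Pi\<^sub>E (fi_normal G) W \<subseteq> V"
    using V xV unfolding openin_product_topology_alt by blast
  then obtain W where fin: "finite {i \<in> fi_normal G. W i \<noteq> topspace (?T i)}"
    and xW: "x \<in> Pi\<^sub>E (fi_normal G) W" and WV: "Pi\<^sub>E (fi_normal G) W \<subseteq> V" by blast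
  define F where "F = {i \<in> fi_normal G. W i \<noteq> topspace (?T i)}"
  have "\<exists>k. K k \<subseteq> N" if "N \<in> F" for N
    using that ex_K_subset[of N] by (auto simp: F_def)
  then obtain k where k: "\<And>N. N \<in> F \<Longrightarrow> K (k N) \<subseteq> N" by metis
  define n where "n = Max (insert m (k ` F))"
  have finF: "finite F" using fin by (simp add: F_def)
  have mn: "m \<le> n" and kn: "\<And>N. N \<in> F \<Longrightarrow> k N \<le> n"
    using finF by (auto simp: n_def)
  show thesis
  proof (rule that[OF mn])
    fix y assume y: "y \<in> carrier hat" and eq: "y (K n) = x (K n)"
    have "y N \<in> W N" if N: "N \<in> fi_normal G" for N
    proof (cases "N \<in> F")
      case True
      then have KN: "K n \<subseteq> N" using k kn K_sub_antimono by blast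
      obtain g where "g \<in> carrier G" "x (K n) = K n #> g"
        using hat_coset_ex[OF xh, of "K n"] by auto
      then have "y N = x N"
        using hat_coset_mono[OF xh _ N KN] hat_coset_mono[OF y _ N KN] eq by simp
      then show ?thesis using xW N by auto
    next
      case False
      then show ?thesis using N y by (auto simp: F_def profinite_completion_def PiE_iff)
    qed
    moreover have "y \<in> extensional (fi_normal G)" using y by (simp add: hat_iff)
    ultimately have "y \<in> Pi\<^sub>E (fi_normal G) W" by (simp add: PiE_iff)
    then show "y \<in> U" using WV y UV by blast
  qed
qed

text \<open>Continuity alone gives some level of \<open>G1\<close> that controls level
  \<open>m\<close> of \<open>G2\<close>; the point is that level \<open>m\<close> itself does. Along
  \<open>g \<mapsto> \<Phi> (embed g)\<close> a subgroup of index at most \<open>m\<close> pulls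
  back to a subgroup of index at most \<open>m\<close>. This settles the elements of
  \<open>G1\<close>, and these are dense.\<close>

lemma completion_isoI:
  assumes "finite_K G1" "finite_K G2"
    and \<Phi>: "\<Phi> \<in> iso (profinite_completion G1) (profinite_completion G2)"
    and cont: "continuous_map (profinite_topology G1) (profinite_topology G2) \<Phi>"
  shows "completion_iso G1 G2 \<Phi>"
proof -
  interpret G1: finite_K G1 by fact
  interpret G2: finite_K G2 by fact
  have \<Phi>_closed: "x \<in> carrier G1.hat \<Longrightarrow> \<Phi> x \<in> carrier G2.hat" for x
    using \<Phi> by (auto simp: iso_def hom_def)
  have \<Phi>_mult: "\<lbrakk>x \<in> carrier G1.hat; y \<in> carrier G1.hat\<rbrakk> \<Longrightarrow> \<Phi> (x \<otimes>\<^bsub>G1.hat\<^esub> y) = \<Phi> x \<otimes>\<^bsub>G2.hat\<^esub> \<Phi> y" for x y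
    using \<Phi> by (auto simp: iso_def hom_def)
  have \<Phi>_one: "\<Phi> \<one>\<^bsub>G1.hat\<^esub> = \<one>\<^bsub>G2.hat\<^esub>"
    using \<Phi> hom_one[OF _ G1.hat.is_group G2.hat.is_group] by (auto simp: iso_def)
  have top1: "topspace (profinite_topology G1) = carrier G1.hat"
    by (auto simp: profinite_topology_def profinite_completion_def)
  have dense: "\<Phi> (G1.embed g) (K_sub G2 m) = K_sub G2 m" if g: "g \<in> K_sub G1 m" for g m
  proof -
    have gc: "g \<in> carrier G1" using g G1.K_sub_subset by blast
    obtain a where a: "a \<in> carrier G2" "a \<in> \<Phi> (G1.embed g) (K_sub G2 m)"
      using G2.hat_coset_ex[OF \<Phi>_closed, of "G1.embed g" "K_sub G2 m"] gc by auto
    have "a \<in> L" if L: "subgroup L G2" "finite (rcosets\<^bsub>G2\<^esub> L)" "card (rcosets\<^bsub>G2\<^esub> L) \<le> m" for L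
    proof -
      have KL: "K_sub G2 m \<subseteq> L" using G2.K_sub_subset_finite_index L by blast
      \<comment> \<open>\<open>\<Phi> (G1.embed x)\<close> need not come from \<open>G2\<close>, so
        a representative of its coset at \<open>K_sub G2 m\<close> stands in. It is multiplicative
        only modulo \<open>L\<close>, which contains \<open>K_sub G2 m\<close>; that is enough for
        the \<open>x\<close> with \<open>rep x \<in> L\<close> to form a subgroup of index at most
        that of \<open>L\<close>.\<close>
      define rep where "rep x = (SOME b. b \<in> \<Phi> (G1.embed x) (K_sub G2 m))" for x
      have rep: "rep x \<in> carrier G2" "\<Phi> (G1.embed x) (K_sub G2 m) = K_sub G2 m #>\<^bsub>G2\<^esub> rep x"
        if "x \<in> carrier G1" for x
      proof -
        have "rep x \<in> \<Phi> (G1.embed x) (K_sub G2 m)"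
          unfolding rep_def by (rule someI_ex)
            (use G2.hat_coset_ex[OF \<Phi>_closed, of "G1.embed x" "K_sub G2 m"] that in auto)
        then show "rep x \<in> carrier G2" "\<Phi> (G1.embed x) (K_sub G2 m) = K_sub G2 m #>\<^bsub>G2\<^esub> rep x"
          using G2.hat_coset[OF \<Phi>_closed, of "G1.embed x" "K_sub G2 m" "rep x"] that by auto
      qed
      have eqL: "L #>\<^bsub>G2\<^esub> b = L #>\<^bsub>G2\<^esub> c"
        if "b \<in> carrier G2" "c \<in> carrier G2" "K_sub G2 m #>\<^bsub>G2\<^esub> b = K_sub G2 m #>\<^bsub>G2\<^esub> c" for b c
        using that KL G2.rcos_eq_iff[OF L(1)] G2.rcos_eq_iff[OF G2.subgroup_K_sub] by auto
      have rep_mult: "L #>\<^bsub>G2\<^esub> rep (x \<otimes>\<^bsub>G1\<^esub> y) = L #>\<^bsub>G2\<^esub> (rep x \<otimes>\<^bsub>G2\<^esub> rep y)"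
        if "x \<in> carrier G1" "y \<in> carrier G1" for x y
      proof (rule eqL)
        have "\<Phi> (G1.embed (x \<otimes>\<^bsub>G1\<^esub> y)) (K_sub G2 m) = K_sub G2 m #>\<^bsub>G2\<^esub> (rep x \<otimes>\<^bsub>G2\<^esub> rep y)"
          using G2.hat_mult_coset[of "K_sub G2 m" "rep x" "rep y" "\<Phi> (G1.embed x)" "\<Phi> (G1.embed y)"]
            rep(1)[OF that(1)] rep(1)[OF that(2)] rep(2)[OF that(1)] rep(2)[OF that(2)] that
          by (simp add: G1.embed_mult \<Phi>_mult)
        then show "K_sub G2 m #>\<^bsub>G2\<^esub> rep (x \<otimes>\<^bsub>G1\<^esub> y) = K_sub G2 m #>\<^bsub>G2\<^esub> (rep x \<otimes>\<^bsub>G2\<^esub> rep y)"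
          using rep(2)[of "x \<otimes>\<^bsub>G1\<^esub> y"] that by simp
      qed (use rep that in auto)
      have L_one: "L #>\<^bsub>G2\<^esub> b = L #>\<^bsub>G2\<^esub> \<one>\<^bsub>G2\<^esub> \<longleftrightarrow> b \<in> L" if "b \<in> carrier G2" for b
        using that L(1) G2.rcos_eq_iff[OF L(1), of b "\<one>\<^bsub>G2\<^esub>"] by simp
      have mem_mult: "rep (x \<otimes>\<^bsub>G1\<^esub> y) \<in> L \<longleftrightarrow> rep x \<otimes>\<^bsub>G2\<^esub> rep y \<in> L"
        if "x \<in> carrier G1" "y \<in> carrier G1" for x y
        using rep_mult[OF that] L_one[of "rep (x \<otimes>\<^bsub>G1\<^esub> y)"] L_one[of "rep x \<otimes>\<^bsub>G2\<^esub> rep y"]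
          rep(1) that by simp
      have rep_inv: "L #>\<^bsub>G2\<^esub> rep x = L #>\<^bsub>G2\<^esub> inv\<^bsub>G2\<^esub> (rep (inv\<^bsub>G1\<^esub> x))" if x: "x \<in> carrier G1" for x
      proof -
        have "L #>\<^bsub>G2\<^esub> rep \<one>\<^bsub>G1\<^esub> = L #>\<^bsub>G2\<^esub> \<one>\<^bsub>G2\<^esub>"
        proof (rule eqL)
          have "G1.embed \<one>\<^bsub>G1\<^esub> = \<one>\<^bsub>G1.hat\<^esub>"
            by (rule G1.hat_eqI) (auto simp: G1.hat_one G1.K_sub_subset)
          then show "K_sub G2 m #>\<^bsub>G2\<^esub> rep \<one>\<^bsub>G1\<^esub> = K_sub G2 m #>\<^bsub>G2\<^esub> \<one>\<^bsub>G2\<^esub>"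
            using rep(2)[of "\<one>\<^bsub>G1\<^esub>"] \<Phi>_one by (simp add: G2.hat_one G2.K_sub_subset)
        qed (auto simp: rep)
        then have "rep \<one>\<^bsub>G1\<^esub> \<in> L" using L_one[of "rep \<one>\<^bsub>G1\<^esub>"] rep(1)[of "\<one>\<^bsub>G1\<^esub>"] by simp
        then have "rep x \<otimes>\<^bsub>G2\<^esub> rep (inv\<^bsub>G1\<^esub> x) \<in> L"
          using mem_mult[of x "inv\<^bsub>G1\<^esub> x"] x by simp
        then show ?thesis
          using G2.rcos_eq_iff[OF L(1)] rep(1) x by simp
      qed
      let ?L' = "{x \<in> carrier G1. rep x \<in> L}"
      have sep: "x \<otimes>\<^bsub>G1\<^esub> inv\<^bsub>G1\<^esub> y \<in> ?L'"
        if "x \<in> carrier G1" "y \<in> carrier G1" "L #>\<^bsub>G2\<^esub> rep x = L #>\<^bsub>G2\<^esub> rep y" for x y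
        using that mem_mult[of x "inv\<^bsub>G1\<^esub> y"] rep_inv[of y] G2.rcos_eq_iff[OF L(1), of "rep x" "inv\<^bsub>G2\<^esub> rep (inv\<^bsub>G1\<^esub> y)"] rep(1)
        by simp
      have sg: "subgroup ?L' G1"
      proof (rule G1.subgroupI)
        have "\<one>\<^bsub>G1\<^esub> \<in> ?L'" using sep[of "\<one>\<^bsub>G1\<^esub>" "\<one>\<^bsub>G1\<^esub>"] by simp
        then show "?L' \<noteq> {}" by blast
        show "inv\<^bsub>G1\<^esub> x \<in> ?L'" if "x \<in> ?L'" for x
          using sep[of "\<one>\<^bsub>G1\<^esub>" x] \<open>\<one>\<^bsub>G1\<^esub> \<in> ?L'\<close> that L_one[of "rep x"] L_one[of "rep \<one>\<^bsub>G1\<^esub>"] rep(1)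
          by simp
        show "x \<otimes>\<^bsub>G1\<^esub> y \<in> ?L'" if "x \<in> ?L'" "y \<in> ?L'" for x y
          using that mem_mult[of x y] L(1) by (simp add: subgroup.m_closed)
      qed auto
      have mem: "L #>\<^bsub>G2\<^esub> rep x \<in> rcosets\<^bsub>G2\<^esub> L" if "x \<in> carrier G1" for x
        using that L(1) rep(1) by (auto intro!: G2.rcosetsI dest: subgroup.subset)
      have "finite (rcosets\<^bsub>G1\<^esub> ?L')" "card (rcosets\<^bsub>G1\<^esub> ?L') \<le> card (rcosets\<^bsub>G2\<^esub> L)"
        by (rule G1.index_le[OF sg L(2) mem sep]; assumption)+
      then have "K_sub G1 m \<subseteq> ?L'"
        using G1.K_sub_subset_finite_index[OF sg] L(3) by simp
      then have "rep g \<in> L" using g by blast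
      moreover have "L #>\<^bsub>G2\<^esub> a = L #>\<^bsub>G2\<^esub> rep g"
        using a rep[OF gc] G2.hat_coset[OF \<Phi>_closed, of "G1.embed g" "K_sub G2 m" a] gc
        by (intro eqL) auto
      ultimately show ?thesis using L_one[of a] L_one[of "rep g"] a rep(1)[OF gc] by simp
    qed
    then have "a \<in> K_sub G2 m" using a by (auto simp: K_sub_def)
    then show ?thesis
      using G2.hat_coset[OF \<Phi>_closed, of "G1.embed g" "K_sub G2 m" a] a gc
        G2.coset_join2[of a "K_sub G2 m"] G2.subgroup_K_sub by auto
  qed
  \<comment> \<open>Density: by continuity \<open>x\<close> can be replaced by an embedded
    \<open>g\<close> with the same value of \<open>\<Phi>\<close> at level \<open>m\<close>. As
    \<open>m \<le> n\<close>, this \<open>g\<close> still lies in \<open>K_sub G1 m\<close>.\<close>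
  have one_case: "\<Phi> x (K_sub G2 m) = K_sub G2 m"
    if x: "x \<in> carrier G1.hat" and eq: "x (K_sub G1 m) = K_sub G1 m" for x m
  proof -
    let ?V = "{y \<in> carrier G2.hat. y (K_sub G2 m) = \<Phi> x (K_sub G2 m)}"
    have "openin (profinite_topology G2) ?V"
    proof -
      let ?T = "product_topology (\<lambda>N. discrete_topology (carrier (G2 Mod N))) (fi_normal G2)"
      have "openin ?T {y \<in> topspace ?T. y (K_sub G2 m) \<in> {\<Phi> x (K_sub G2 m)}}"
        by (rule openin_continuous_map_preimage[OF continuous_map_product_projection])
          (use \<Phi>_closed[OF x] in \<open>auto simp: profinite_completion_def PiE_iff\<close>)
      then have "openin (subtopology ?T (carrier G2.hat))
          ({y \<in> topspace ?T. y (K_sub G2 m) \<in> {\<Phi> x (K_sub G2 m)}} \<inter> carrier G2.hat)"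
        by (auto simp: openin_subtopology)
      moreover have "{y \<in> topspace ?T. y (K_sub G2 m) \<in> {\<Phi> x (K_sub G2 m)}} \<inter> carrier G2.hat = ?V"
        by (auto simp: profinite_completion_def)
      ultimately show ?thesis by (simp add: profinite_topology_def)
    qed
    then have "openin (profinite_topology G1) {y \<in> topspace (profinite_topology G1). \<Phi> y \<in> ?V}"
      by (rule openin_continuous_map_preimage[OF cont])
    moreover have "x \<in> {y \<in> topspace (profinite_topology G1). \<Phi> y \<in> ?V}"
      using x \<Phi>_closed by (auto simp: top1)
    ultimately obtain n where n: "m \<le> n"
      and nb: "\<And>y. \<lbrakk>y \<in> carrier G1.hat; y (K_sub G1 n) = x (K_sub G1 n)\<rbrakk> \<Longrightarrow>
         y \<in> {y \<in> topspace (profinite_topology G1). \<Phi> y \<in> ?V}"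
      using profinite_nbhd[OF \<open>finite_K G1\<close>, of _ x m] by blast
    obtain g where g: "g \<in> carrier G1" "g \<in> x (K_sub G1 n)" "x (K_sub G1 n) = K_sub G1 n #>\<^bsub>G1\<^esub> g"
      using G1.hat_coset_ex[OF x, of "K_sub G1 n"] by auto
    have "g \<in> K_sub G1 m"
      using G1.hat_mono[OF x, of "K_sub G1 n" "K_sub G1 m"] g(2) eq G1.K_sub_antimono[OF n] by auto
    moreover have "\<Phi> (G1.embed g) (K_sub G2 m) = \<Phi> x (K_sub G2 m)"
      using nb[of "G1.embed g"] g by auto
    ultimately show ?thesis using dense by simp
  qed
  show ?thesis
  proof (unfold_locales, rule \<Phi>)
    fix x y m assume x: "x \<in> carrier G1.hat" and y: "y \<in> carrier G1.hat"
      and eq: "x (K_sub G1 m) = y (K_sub G1 m)"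
    obtain g where g: "g \<in> carrier G1" "x (K_sub G1 m) = K_sub G1 m #>\<^bsub>G1\<^esub> g"
      using G1.hat_coset_ex[OF x, of "K_sub G1 m"] by auto
    have "(x \<otimes>\<^bsub>G1.hat\<^esub> inv\<^bsub>G1.hat\<^esub> y) (K_sub G1 m) = K_sub G1 m"
      using G1.hat_mult_coset[of "K_sub G1 m" g "inv\<^bsub>G1\<^esub> g" x "inv\<^bsub>G1.hat\<^esub> y"]
        G1.hat_inv_coset[OF y, of "K_sub G1 m" g] g eq by (simp add: G1.K_sub_subset)
    then have 1: "\<Phi> (x \<otimes>\<^bsub>G1.hat\<^esub> inv\<^bsub>G1.hat\<^esub> y) (K_sub G2 m) = K_sub G2 m"
      using one_case[of "x \<otimes>\<^bsub>G1.hat\<^esub> inv\<^bsub>G1.hat\<^esub> y" m] x y by simp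
    have "\<Phi> x = \<Phi> (x \<otimes>\<^bsub>G1.hat\<^esub> inv\<^bsub>G1.hat\<^esub> y) \<otimes>\<^bsub>G2.hat\<^esub> \<Phi> y"
      using x y by (simp add: \<Phi>_mult[symmetric] G1.hat.m_assoc)
    moreover obtain b where "b \<in> carrier G2" "\<Phi> y (K_sub G2 m) = K_sub G2 m #>\<^bsub>G2\<^esub> b"
      using G2.hat_coset_ex[OF \<Phi>_closed[OF y], of "K_sub G2 m"] by auto
    ultimately show "\<Phi> x (K_sub G2 m) = \<Phi> y (K_sub G2 m)"
      using G2.hat_mult_coset[of "K_sub G2 m" "\<one>\<^bsub>G2\<^esub>" b "\<Phi> (x \<otimes>\<^bsub>G1.hat\<^esub> inv\<^bsub>G1.hat\<^esub> y)" "\<Phi> y"] 1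
      by (simp add: G2.K_sub_subset)
  qed
qed

section \<open>Free actions and their completions\<close>

text \<open>Simplices and occurrences of each dimension are treated alike as free sets over the
  group; the incidences between them enter later as equivariant maps.\<close>

locale free_action = finite_K G for G (structure) +
  fixes \<phi> :: "'a \<Rightarrow> 'x \<Rightarrow> 'x" and A :: "'x set"
  assumes act_closed: "\<lbrakk>g \<in> carrier G; s \<in> A\<rbrakk> \<Longrightarrow> \<phi> g s \<in> A"
    and act_mult: "\<lbrakk>g \<in> carrier G; h \<in> carrier G; s \<in> A\<rbrakk> \<Longrightarrow> \<phi> (g \<otimes> h) s = \<phi> g (\<phi> h s)"
    and act_one: "s \<in> A \<Longrightarrow> \<phi> \<one> s = s"
    and act_free: "\<lbrakk>g \<in> carrier G; s \<in> A; \<phi> g s = s\<rbrakk> \<Longrightarrow> g = \<one>"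
begin

abbreviation lev where "lev m \<equiv> orbits (K_group G m) A \<phi>"
abbreviation orb where "orb m s \<equiv> orbit (K_group G m) \<phi> s"
abbreviation orig where "orig \<equiv> original G \<phi>"
abbreviation act where "act \<equiv> completed_act G \<phi>"
text \<open>For simplices or occurrences of one dimension this is the corresponding component of
  \<open>completed_complex\<close>, see \<open>completed_simps\<close>.\<close>

definition completion where
  "completion = {\<xi>. (\<forall>m. \<xi> m \<in> lev m) \<and> (\<forall>m n. m \<le> n \<longrightarrow> \<xi> m = translate \<phi> (K m) (\<xi> n))}"

lemma K_carrier: "k \<in> K m \<Longrightarrow> k \<in> carrier G"
  using K_sub_subset by blast

lemma mem_orb: "t \<in> orb m s \<longleftrightarrow> (\<exists>k\<in>K m. t = \<phi> k s)"
  by (auto simp: orbit_def K_group_def)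

lemma levE:
  assumes "B \<in> lev m" obtains s where "s \<in> A" "B = orb m s"
  using assms by (auto simp: orbits_def)

lemma orb_lev [simp, intro]: "s \<in> A \<Longrightarrow> orb m s \<in> lev m"
  by (auto simp: orbits_def)

lemma orb_self: "s \<in> A \<Longrightarrow> s \<in> orb m s"
  unfolding mem_orb using act_one[of s] subgroup.one_closed[OF subgroup_K_sub] by metis

text \<open>Normality of \<open>K m\<close> moves \<open>g\<close> past
  \<open>K n \<subseteq> K m\<close>, so the product set collapses to one orbit. Translates are
  computed on representatives through this formula.\<close>

lemma translate_orb:
  assumes g: "g \<in> carrier G" and s: "s \<in> A" and mn: "m \<le> n"
  shows "translate \<phi> (K m #> g) (orb n s) = orb m (\<phi> g s)"
proof
  have gs: "\<phi> g s \<in> A" using g s act_closed by blast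
  show "translate \<phi> (K m #> g) (orb n s) \<subseteq> orb m (\<phi> g s)"
  proof
    fix t assume "t \<in> translate \<phi> (K m #> g) (orb n s)"
    then obtain k l where k: "k \<in> K m" and l: "l \<in> K n" and t: "t = \<phi> (k \<otimes> g) (\<phi> l s)"
      by (auto simp: translate_def r_coset_def mem_orb)
    have kl: "k \<in> carrier G" "l \<in> carrier G" using k l K_carrier by auto
    have "g \<otimes> l \<otimes> inv g \<in> K m"
      using normal.inv_op_closed2[OF normal_K_sub g] l K_sub_antimono[OF mn] by blast
    then have "k \<otimes> (g \<otimes> l \<otimes> inv g) \<in> K m"
      using k subgroup.m_closed[OF subgroup_K_sub] by blast
    moreover have "t = \<phi> (k \<otimes> (g \<otimes> l \<otimes> inv g)) (\<phi> g s)"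
    proof -
      have "t = \<phi> (k \<otimes> g \<otimes> l) s" using t kl g s by (simp add: act_mult)
      also have "k \<otimes> g \<otimes> l = k \<otimes> (g \<otimes> l \<otimes> inv g) \<otimes> g" using kl g by (simp add: m_assoc)
      also have "\<phi> \<dots> s = \<phi> (k \<otimes> (g \<otimes> l \<otimes> inv g)) (\<phi> g s)" by (rule act_mult) (use kl g s in auto)
      finally show ?thesis .
    qed
    ultimately show "t \<in> orb m (\<phi> g s)" by (auto simp: mem_orb)
  qed
  show "orb m (\<phi> g s) \<subseteq> translate \<phi> (K m #> g) (orb n s)"
  proof
    fix t assume "t \<in> orb m (\<phi> g s)"
    then obtain k where k: "k \<in> K m" "t = \<phi> k (\<phi> g s)" by (auto simp: mem_orb)
    then have "t = \<phi> (k \<otimes> g) s" using g s K_carrier act_mult by auto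
    then show "t \<in> translate \<phi> (K m #> g) (orb n s)"
      using k orb_self[OF s, of n] by (auto simp: translate_def r_coset_def)
  qed
qed

lemma translate_K_orb: "\<lbrakk>s \<in> A; m \<le> n\<rbrakk> \<Longrightarrow> translate \<phi> (K m) (orb n s) = orb m s"
  using translate_orb[of \<one> s m n] by (simp add: K_sub_subset act_one)

lemma translate_lev: "\<lbrakk>B \<in> lev n; m \<le> n\<rbrakk> \<Longrightarrow> translate \<phi> (K m) B \<in> lev m"
  by (auto elim!: levE simp: translate_K_orb)

lemma translate_translate:
  "\<lbrakk>B \<in> lev n; l \<le> m; m \<le> n\<rbrakk> \<Longrightarrow> translate \<phi> (K l) (translate \<phi> (K m) B) = translate \<phi> (K l) B"
  by (auto elim!: levE simp: translate_K_orb)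

lemma orb_mem_eq:
  assumes "s \<in> A" "t \<in> orb m s"
  shows "orb m t = orb m s"
proof -
  obtain k where k: "k \<in> K m" "t = \<phi> k s" using assms by (auto simp: mem_orb)
  have "orb m t = translate \<phi> (K m #> k) (orb m s)"
    using translate_orb[of k s m m] k assms K_carrier by simp
  also have "K m #> k = K m" using coset_join2 k K_carrier subgroup_K_sub by blast
  also have "translate \<phi> (K m) (orb m s) = orb m s" using translate_K_orb assms by simp
  finally show ?thesis .
qed

lemma orb_act_K: "\<lbrakk>s \<in> A; k \<in> K m\<rbrakk> \<Longrightarrow> orb m (\<phi> k s) = orb m s"
  by (rule orb_mem_eq) (auto simp: mem_orb)

lemma act_cancel:
  assumes "g \<in> carrier G" "h \<in> carrier G" "s \<in> A" "\<phi> g s = \<phi> h s"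
  shows "g = h"
proof -
  have "\<phi> (inv h \<otimes> g) s = \<phi> (inv h) (\<phi> h s)" using assms by (simp add: act_mult)
  also have "\<dots> = s" using assms by (simp add: act_mult[symmetric] act_one)
  finally have "inv h \<otimes> g = \<one>" using act_free assms by simp
  then show ?thesis using assms inv_equality by (metis inv_closed inv_inv)
qed

text \<open>Freeness survives in the quotients: at level \<open>m\<close> the quotient by
  \<open>K m\<close> acts freely.\<close>

lemma orb_cancel:
  assumes "g \<in> carrier G" "h \<in> carrier G" "s \<in> A" "orb m (\<phi> g s) = orb m (\<phi> h s)"
  shows "K m #> g = K m #> h"
proof -
  have "\<phi> h s \<in> orb m (\<phi> g s)" using orb_self[of "\<phi> h s" m] act_closed assms by auto
  then obtain k where k: "k \<in> K m" "\<phi> h s = \<phi> k (\<phi> g s)" by (auto simp: mem_orb)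
  then have "\<phi> h s = \<phi> (k \<otimes> g) s" using assms K_carrier by (simp add: act_mult)
  then have "h = k \<otimes> g" using act_cancel[of h "k \<otimes> g" s] assms k K_carrier by auto
  then have "h \<in> K m #> g" using k by (auto simp: r_coset_def)
  then show ?thesis using repr_independence[of h "K m" g] subgroup_K_sub assms by auto
qed

lemma orb_0_mem: "\<lbrakk>s \<in> A; t \<in> A; orb 0 s = orb 0 t\<rbrakk> \<Longrightarrow> \<exists>g\<in>carrier G. t = \<phi> g s"
  using orb_self[of t 0] by (auto simp: mem_orb K_sub_0)

lemma completionD:
  assumes "\<xi> \<in> completion"
  shows "\<xi> m \<in> lev m" "m \<le> n \<Longrightarrow> \<xi> m = translate \<phi> (K m) (\<xi> n)"
  using assms unfolding completion_def by blast+

text \<open>A representative at level \<open>m\<close> also represents all lower coordinates. There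
  need not be one element that represents a completed point at all levels at once.\<close>

lemma completion_below:
  assumes "\<xi> \<in> completion" shows "\<exists>s\<in>A. \<forall>n\<le>m. \<xi> n = orb n s"
proof -
  obtain s where s: "s \<in> A" "\<xi> m = orb m s" using levE[OF completionD(1)[OF assms]] by blast
  then show ?thesis using completionD(2)[OF assms] translate_K_orb by auto
qed

section \<open>The action of the completion on completed points\<close>

lemma orig_completion [simp, intro]: "s \<in> A \<Longrightarrow> orig s \<in> completion"
  by (simp add: completion_def original_def translate_K_orb)

lemma act_at:
  assumes "s \<in> A" "\<xi> m = orb m s" "g \<in> carrier G" "x (K m) = K m #> g"
  shows "act x \<xi> m = orb m (\<phi> g s)"
  using assms translate_orb[of g s m m] by (simp add: completed_act_def)

lemma act_completion [simp, intro]: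
  assumes x: "x \<in> carrier hat" and \<xi>: "\<xi> \<in> completion"
  shows "act x \<xi> \<in> completion"
  unfolding completion_def
proof (intro CollectI conjI allI impI)
  fix m
  obtain s where s: "s \<in> A" "\<xi> m = orb m s" using levE[OF completionD(1)[OF \<xi>]] by blast
  obtain g where g: "g \<in> carrier G" "x (K m) = K m #> g" using hat_coset_ex[OF x, of "K m"] by auto
  show "act x \<xi> m \<in> lev m" using act_at[of s \<xi> m g x] s g act_closed by simp
next
  fix m n :: nat assume mn: "m \<le> n"
  obtain s where s: "s \<in> A" "\<And>l. l \<le> n \<Longrightarrow> \<xi> l = orb l s" using completion_below[OF \<xi>, of n] by blast
  obtain g where g: "g \<in> carrier G" "x (K n) = K n #> g" using hat_coset_ex[OF x, of "K n"] by auto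
  have "x (K m) = K m #> g" using hat_coset_mono[OF x _ _ K_sub_antimono[OF mn] g] by auto
  then have "act x \<xi> m = orb m (\<phi> g s)" using act_at[of s \<xi> m g x] s mn g by simp
  also have "\<dots> = translate \<phi> (K m) (act x \<xi> n)"
    using act_at[of s \<xi> n g x] s mn g act_closed by (simp add: translate_K_orb)
  finally show "act x \<xi> m = translate \<phi> (K m) (act x \<xi> n)" .
qed

lemma completion_eqI:
  assumes "\<xi> \<in> completion" "\<eta> \<in> completion" and cof: "\<forall>n. \<exists>j. n \<le> M j"
    and eq: "\<And>j::nat. \<xi> (M j) = \<eta> (M j)"
  shows "\<xi> = \<eta>"
proof
  fix m
  obtain j where "m \<le> M j" using cof by blast
  then show "\<xi> m = \<eta> m" using completionD(2)[OF assms(1), of m "M j"] completionD(2)[OF assms(2), of m "M j"] eq by simp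
qed

lemma act_act:
  assumes x: "x \<in> carrier hat" and y: "y \<in> carrier hat" and \<xi>: "\<xi> \<in> completion"
  shows "act (x \<otimes>\<^bsub>hat\<^esub> y) \<xi> = act x (act y \<xi>)"
proof
  fix m
  obtain s where s: "s \<in> A" "\<xi> m = orb m s" using levE[OF completionD(1)[OF \<xi>]] by blast
  obtain g where g: "g \<in> carrier G" "x (K m) = K m #> g" using hat_coset_ex[OF x, of "K m"] by auto
  obtain h where h: "h \<in> carrier G" "y (K m) = K m #> h" using hat_coset_ex[OF y, of "K m"] by auto
  have "act (x \<otimes>\<^bsub>hat\<^esub> y) \<xi> m = orb m (\<phi> (g \<otimes> h) s)"
    by (rule act_at) (use s g h hat_mult_coset[of "K m" g h x y] in auto)
  also have "\<dots> = act x (act y \<xi>) m"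
    using act_at[of "\<phi> h s" "act y \<xi>" m g x] act_at[of s \<xi> m h y] g h s act_closed by (simp add: act_mult)
  finally show "act (x \<otimes>\<^bsub>hat\<^esub> y) \<xi> m = act x (act y \<xi>) m" .
qed

lemma act_hat_one:
  assumes "\<xi> \<in> completion" shows "act \<one>\<^bsub>hat\<^esub> \<xi> = \<xi>"
proof
  fix m show "act \<one>\<^bsub>hat\<^esub> \<xi> m = \<xi> m"
    using completionD(2)[OF assms, of m m] by (simp add: completed_act_def hat_one)
qed

lemma act_inv_cancel [simp]:
  assumes "x \<in> carrier hat" "\<xi> \<in> completion"
  shows "act (inv\<^bsub>hat\<^esub> x) (act x \<xi>) = \<xi>" "act x (act (inv\<^bsub>hat\<^esub> x) \<xi>) = \<xi>"
  using assms act_act[of "inv\<^bsub>hat\<^esub> x" x \<xi>] act_act[of x "inv\<^bsub>hat\<^esub> x" \<xi>] act_hat_one by auto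

lemma bij_betw_act: "x \<in> carrier hat \<Longrightarrow> bij_betw (act x) completion completion"
  by (rule bij_betw_byWitness[where f' = "act (inv\<^bsub>hat\<^esub> x)"]) auto

text \<open>The completion acts freely because each finite quotient acts freely at its
  level.\<close>

lemma act_hat_cancel:
  assumes x: "x \<in> carrier hat" and y: "y \<in> carrier hat" and \<xi>: "\<xi> \<in> completion"
    and eq: "act x \<xi> = act y \<xi>"
  shows "x = y"
proof (rule hat_eqI[OF x y])
  fix m
  obtain s where s: "s \<in> A" "\<xi> m = orb m s" using levE[OF completionD(1)[OF \<xi>]] by blast
  obtain g where g: "g \<in> carrier G" "x (K m) = K m #> g" using hat_coset_ex[OF x, of "K m"] by auto
  obtain h where h: "h \<in> carrier G" "y (K m) = K m #> h" using hat_coset_ex[OF y, of "K m"] by auto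
  have "orb m (\<phi> g s) = orb m (\<phi> h s)"
    using act_at[of s \<xi> m g x] act_at[of s \<xi> m h y] fun_cong[OF eq, of m] s g h by metis
  then show "x (K m) = y (K m)" using orb_cancel[OF g(1) h(1) s(1)] g h by simp
qed

lemma act_embed_orig: "\<lbrakk>g \<in> carrier G; s \<in> A\<rbrakk> \<Longrightarrow> act (embed g) (orig s) = orig (\<phi> g s)"
  by (rule ext, subst act_at[of s _ _ g]) (auto simp: original_def)

text \<open>Over one orbit of the group, the completed points form one orbit of the completion. At
  each level some \<open>g m\<close> moves \<open>s\<close> to the coordinate of
  \<open>\<xi>\<close>; freeness makes its coset modulo \<open>K m\<close> unique, so the cosets
  form a thread and define \<open>x\<close>.\<close>

lemma completion_decompose:
  assumes \<xi>: "\<xi> \<in> completion" and s: "s \<in> A" and s0: "\<xi> 0 = orb 0 s"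
  shows "\<exists>x\<in>carrier hat. \<xi> = act x (orig s)"
proof -
  have "\<exists>g. g \<in> carrier G \<and> \<xi> m = orb m (\<phi> g s)" for m
  proof -
    obtain t where t: "t \<in> A" "\<And>n. n \<le> m \<Longrightarrow> \<xi> n = orb n t" using completion_below[OF \<xi>, of m] by blast
    then obtain g where "g \<in> carrier G" "t = \<phi> g s" using orb_0_mem[OF s t(1)] s0 by auto
    then show ?thesis using t by blast
  qed
  then obtain g where g: "\<And>m. g m \<in> carrier G" "\<And>m. \<xi> m = orb m (\<phi> (g m) s)" by metis
  have "\<exists>x\<in>carrier hat. \<forall>m. x (K m) = K m #> g m"
  proof (rule hat_of_thread)
    show "K m #> g m \<in> rcosets K m" for m using g K_sub_subset rcosetsI by blast
    fix m n :: nat assume mn: "m \<le> n"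
    have "orb m (\<phi> (g m) s) = orb m (\<phi> (g n) s)"
      using completionD(2)[OF \<xi> mn] g s mn act_closed by (simp add: translate_K_orb)
    then have "K m #> g m = K m #> g n" using orb_cancel g s by blast
    then show "K n #> g n \<subseteq> K m #> g m" using K_sub_antimono[OF mn] by (auto simp: r_coset_def)
  qed
  then obtain x where x: "x \<in> carrier hat" "\<And>m. x (K m) = K m #> g m" by blast
  have "act x (orig s) m = \<xi> m" for m
    using act_at[of s "orig s" m "g m" x] s g x by (simp add: original_def)
  then show ?thesis using x by (metis ext)
qed

text \<open>Level 0 shows that \<open>t\<close> lies in the orbit of \<open>s\<close>, and freeness
  identifies \<open>x\<close> with the group element found there. This criterion for an element of
  the completion to come from the group serves both for spreading originals and for constructing
  \<open>h\<close>.\<close>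

lemma act_orig_eq_orig:
  assumes x: "x \<in> carrier hat" and s: "s \<in> A" and t: "t \<in> A" and eq: "act x (orig s) = orig t"
  shows "\<exists>g\<in>carrier G. t = \<phi> g s \<and> x = embed g"
proof -
  obtain h where h: "h \<in> carrier G" "x (K 0) = K 0 #> h" using hat_coset_ex[OF x, of "K 0"] by auto
  have "orb 0 (\<phi> h s) = orb 0 t"
    using act_at[of s "orig s" 0 h x] s h fun_cong[OF eq, of 0] by (simp add: original_def)
  moreover have "orb 0 (\<phi> h s) = orb 0 s" using orb_act_K[of s h 0] h s by (simp add: K_sub_0)
  ultimately obtain g where g: "g \<in> carrier G" "t = \<phi> g s" using orb_0_mem s t by metis
  have "x = embed g"
    using act_hat_cancel[OF x embed_closed[OF g(1)] orig_completion[OF s]] act_embed_orig[OF g(1) s] eq g by simp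
  then show ?thesis using g by blast
qed

text \<open>Freeness reduces injectivity on points to injectivity of \<open>embed\<close>, which is
  residual finiteness.\<close>

lemma orig_inj:
  assumes rf: "residually_finite G" and s: "s \<in> A" and t: "t \<in> A" and eq: "orig s = orig t"
  shows "s = t"
proof -
  obtain g where g: "g \<in> carrier G" "t = \<phi> g s" "\<one>\<^bsub>hat\<^esub> = embed g"
    using act_orig_eq_orig[of "\<one>\<^bsub>hat\<^esub>" s t] s t eq by (auto simp: act_hat_one)
  have "embed \<one> = \<one>\<^bsub>hat\<^esub>" by (rule hat_eqI) (auto simp: hat_one K_sub_subset)
  with g(3) have "embed g = embed \<one>" by metis
  then have "g = \<one>" by (rule embed_inj[OF rf g(1) one_closed])
  then show ?thesis using g act_one s by simp
qed

text \<open>The coordinates between the levels \<open>M j\<close> are filled in by projecting from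
  any later one.\<close>

lemma completion_of_thread:
  assumes cof: "\<forall>n. \<exists>j. n \<le> M j" and \<eta>: "\<And>j::nat. \<eta> j \<in> lev (M j)"
    and comp: "\<And>j k. j \<le> k \<Longrightarrow> \<eta> j = translate \<phi> (K (M j)) (\<eta> k)" and M: "mono M"
  shows "\<exists>\<xi>\<in>completion. \<forall>j. \<xi> (M j) = \<eta> j"
proof -
  define J where "J m = (SOME j. m \<le> M j)" for m
  have J: "m \<le> M (J m)" for m unfolding J_def by (rule someI_ex) (use cof in blast)
  define \<xi> where "\<xi> m = translate \<phi> (K m) (\<eta> (J m))" for m
  have step: "translate \<phi> (K m) (\<eta> j) = translate \<phi> (K m) (\<eta> k)" if "m \<le> M j" "j \<le> k" for m j k
    using comp[OF \<open>j \<le> k\<close>] translate_translate[OF \<eta>[of k], of m "M j"] that monoD[OF M] by simp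
  have \<xi>_eq: "\<xi> m = translate \<phi> (K m) (\<eta> j)" if "m \<le> M j" for m j
  proof (cases "j \<le> J m")
    case True then show ?thesis using step[OF that True] by (simp add: \<xi>_def)
  next
    case False then show ?thesis using step[OF J[of m], of j] by (simp add: \<xi>_def)
  qed
  have "\<xi> \<in> completion"
    unfolding completion_def
  proof (intro CollectI conjI allI impI)
    show "\<xi> m \<in> lev m" for m unfolding \<xi>_def by (rule translate_lev[OF \<eta> J])
    fix m n :: nat assume mn: "m \<le> n"
    obtain j where j: "n \<le> M j" using cof by blast
    show "\<xi> m = translate \<phi> (K m) (\<xi> n)"
      using \<xi>_eq[of m j] \<xi>_eq[OF j] translate_translate[OF \<eta>[of j] mn j] mn j by simp
  qed
  moreover have "\<xi> (M j) = \<eta> j" for j using \<xi>_eq[of "M j" j] comp[of j j] by simp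
  ultimately show ?thesis by blast
qed

text \<open>An orbit at level 0 splits into at most as many orbits at level \<open>m\<close> as
  \<open>K m\<close> has cosets.\<close>

lemma finite_lev:
  assumes "finite (lev 0)"
  shows "finite (lev m)"
proof -
  have "\<exists>s. s \<in> A \<and> C = orb 0 s" if "C \<in> lev 0" for C using that by (auto elim: levE)
  then obtain r where r: "\<And>C. C \<in> lev 0 \<Longrightarrow> r C \<in> A \<and> C = orb 0 (r C)" by metis
  have "lev m \<subseteq> (\<lambda>(C, c). translate \<phi> c (orb m (r C))) ` (lev 0 \<times> rcosets K m)"
  proof
    fix B assume "B \<in> lev m"
    then obtain s where s: "s \<in> A" "B = orb m s" by (elim levE)
    have C: "orb 0 s \<in> lev 0" using s by blast
    then obtain g where g: "g \<in> carrier G" "s = \<phi> g (r (orb 0 s))"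
      using orb_0_mem[of "r (orb 0 s)" s] r s by blast
    have "B = translate \<phi> (K m #> g) (orb m (r (orb 0 s)))"
      using translate_orb[of g "r (orb 0 s)" m m] r[OF C] g s by simp
    moreover have "K m #> g \<in> rcosets K m" using g K_sub_subset rcosetsI by blast
    ultimately show "B \<in> (\<lambda>(C, c). translate \<phi> c (orb m (r C))) ` (lev 0 \<times> rcosets K m)"
      using C by (intro image_eqI[of _ _ "(orb 0 s, K m #> g)"]) auto
  qed
  then show ?thesis
    using assms finite_rcosets_K_sub finite_subset by blast
qed

end

section \<open>Equivariant maps between free actions\<close>

locale equivariant_map = S: free_action G \<phi> A + T: free_action G \<psi> B
  for G :: "'g monoid" and \<phi> :: "'g \<Rightarrow> 'x \<Rightarrow> 'x" and A and \<psi> :: "'g \<Rightarrow> 'y \<Rightarrow> 'y" and B +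
  fixes \<pi> :: "'x \<Rightarrow> 'y"
  assumes maps_to: "s \<in> A \<Longrightarrow> \<pi> s \<in> B"
    and equivariant: "\<lbrakk>g \<in> carrier G; s \<in> A\<rbrakk> \<Longrightarrow> \<pi> (\<phi> g s) = \<psi> g (\<pi> s)"
begin

lemma image_orb: "s \<in> A \<Longrightarrow> \<pi> ` S.orb m s = T.orb m (\<pi> s)"
proof -
  assume s: "s \<in> A"
  have "S.orb m s = (\<lambda>k. \<phi> k s) ` K_sub G m" "T.orb m (\<pi> s) = (\<lambda>k. \<psi> k (\<pi> s)) ` K_sub G m"
    by (auto simp: S.mem_orb T.mem_orb)
  then show ?thesis using equivariant[OF S.K_carrier s] by (simp add: image_image cong: image_cong)
qed

lemma image_lev: "C \<in> S.lev m \<Longrightarrow> \<pi> ` C \<in> T.lev m"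
  by (elim S.levE) (simp add: image_orb maps_to)

lemma image_translate:
  assumes "g \<in> carrier G" "C \<in> S.lev m"
  shows "\<pi> ` translate \<phi> (K_sub G m #>\<^bsub>G\<^esub> g) C = translate \<psi> (K_sub G m #>\<^bsub>G\<^esub> g) (\<pi> ` C)"
proof -
  obtain s where "s \<in> A" "C = S.orb m s" using assms(2) by (elim S.levE)
  then show ?thesis
    using assms(1) maps_to by (simp add: S.translate_orb T.translate_orb image_orb S.act_closed equivariant)
qed

lemma image_translate_K:
  assumes "C \<in> S.lev n" "m \<le> n"
  shows "\<pi> ` translate \<phi> (K_sub G m) C = translate \<psi> (K_sub G m) (\<pi> ` C)"
proof -
  obtain s where "s \<in> A" "C = S.orb n s" using assms(1) by (elim S.levE)
  then show ?thesis
    using assms(2) maps_to by (simp add: S.translate_K_orb T.translate_K_orb image_orb)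
qed

lemma image_completion:
  assumes "\<xi> \<in> S.completion" shows "(\<lambda>m. \<pi> ` \<xi> m) \<in> T.completion"
  unfolding T.completion_def
proof (intro CollectI conjI allI impI)
  show "\<pi> ` \<xi> m \<in> T.lev m" for m using image_lev S.completionD(1)[OF assms] by blast
  show "\<pi> ` \<xi> m = translate \<psi> (K_sub G m) (\<pi> ` \<xi> n)" if "m \<le> n" for m n
    using image_translate_K[OF S.completionD(1)[OF assms] that] S.completionD(2)[OF assms that] by simp
qed

lemma image_act:
  assumes "x \<in> carrier S.hat" "\<xi> \<in> S.completion"
  shows "(\<lambda>m. \<pi> ` S.act x \<xi> m) = T.act x (\<lambda>m. \<pi> ` \<xi> m)"
proof
  fix m
  obtain g where "g \<in> carrier G" "x (K_sub G m) = K_sub G m #>\<^bsub>G\<^esub> g"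
    using S.hat_coset_ex[OF assms(1), of "K_sub G m"] by auto
  then show "\<pi> ` S.act x \<xi> m = T.act x (\<lambda>m. \<pi> ` \<xi> m) m"
    using image_translate S.completionD(1)[OF assms(2)] by (simp add: completed_act_def)
qed

lemma image_orig: "s \<in> A \<Longrightarrow> (\<lambda>m. \<pi> ` S.orig s m) = T.orig (\<pi> s)"
  by (simp add: original_def image_orb)

text \<open>Write \<open>\<xi>\<close> as \<open>x\<close> applied to an original point
  \<open>s\<close>. Then \<open>x\<close> takes the original point \<open>\<pi> s\<close> to an
  original point, which forces \<open>x\<close> into the group, so \<open>\<xi>\<close> is original
  too. With \<open>\<pi>\<close> a projection of occurrences, originality passes from an end of an
  occurrence to the occurrence.\<close>

lemma orig_reflect:
  assumes \<xi>: "\<xi> \<in> S.completion" and t: "t \<in> B" and eq: "(\<lambda>m. \<pi> ` \<xi> m) = T.orig t"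
  shows "\<exists>s\<in>A. \<xi> = S.orig s \<and> \<pi> s = t"
proof -
  obtain s where s: "s \<in> A" "\<xi> 0 = S.orb 0 s" using S.levE[OF S.completionD(1)[OF \<xi>]] by blast
  obtain x where x: "x \<in> carrier S.hat" "\<xi> = S.act x (S.orig s)"
    using S.completion_decompose[OF \<xi> s] by blast
  have "T.act x (T.orig (\<pi> s)) = T.orig t"
    using image_act[OF x(1), of "S.orig s"] image_orig s x eq by simp
  then obtain g where g: "g \<in> carrier G" "t = \<psi> g (\<pi> s)" "x = S.embed g"
    using T.act_orig_eq_orig[OF x(1) maps_to[OF s(1)] t] by blast
  then have "\<xi> = S.orig (\<phi> g s)" using x S.act_embed_orig s by simp
  moreover have "\<phi> g s \<in> A" using g s S.act_closed by blast
  ultimately show ?thesis using equivariant g s by metis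
qed

end

section \<open>Equivariant maps between levels\<close>

locale action_pair = completion_iso G1 G2 \<Phi> + A1: free_action G1 \<phi>1 A1 + A2: free_action G2 \<phi>2 A2
  for G1 :: "'g monoid" and G2 :: "'h monoid"
    and \<Phi> :: "('g set \<Rightarrow> 'g set) \<Rightarrow> ('h set \<Rightarrow> 'h set)"
    and \<phi>1 :: "'g \<Rightarrow> 'x \<Rightarrow> 'x" and A1 and \<phi>2 :: "'h \<Rightarrow> 'y \<Rightarrow> 'y" and A2
begin

text \<open>Equivariance ranges over the completion instead of over cosets, which avoids the
  description in \<open>induced_level_map\<close>; \<open>equivariant_iff\<close> shows that the
  condition is the same.\<close>

definition lev_iso :: "nat \<Rightarrow> ('x set \<Rightarrow> 'y set) \<Rightarrow> bool" where
  "lev_iso m f \<longleftrightarrow> bij_betw f (A1.lev m) (A2.lev m) \<and>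
     (\<forall>x\<in>carrier G1.hat. \<forall>B\<in>A1.lev m.
        f (translate \<phi>1 (x (K_sub G1 m)) B) = translate \<phi>2 (\<Phi> x (K_sub G2 m)) (f B))"

definition descends :: "nat \<Rightarrow> ('x set \<Rightarrow> 'y set) \<Rightarrow> nat \<Rightarrow> ('x set \<Rightarrow> 'y set) \<Rightarrow> bool" where
  "descends n f m g \<longleftrightarrow>
     (\<forall>B\<in>A1.lev n. g (translate \<phi>1 (K_sub G1 m) B) = translate \<phi>2 (K_sub G2 m) (f B))"

text \<open>Evaluates \<open>f\<close> at the level-\<open>n\<close> orbit of an arbitrary
  representative; for equivariant \<open>f\<close> the choice does not matter, by
  \<open>descends_descent\<close>.\<close>

definition descent :: "nat \<Rightarrow> ('x set \<Rightarrow> 'y set) \<Rightarrow> nat \<Rightarrow> 'x set \<Rightarrow> 'y set" where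
  "descent n f m B = translate \<phi>2 (K_sub G2 m) (f (A1.orb n (SOME s. s \<in> B)))"

lemma lev_iso_lev: "\<lbrakk>lev_iso m f; B \<in> A1.lev m\<rbrakk> \<Longrightarrow> f B \<in> A2.lev m"
  by (auto simp: lev_iso_def dest: bij_betw_apply)

lemma lev_iso_equivariant:
  "\<lbrakk>lev_iso m f; x \<in> carrier G1.hat; B \<in> A1.lev m\<rbrakk> \<Longrightarrow>
     f (translate \<phi>1 (x (K_sub G1 m)) B) = translate \<phi>2 (\<Phi> x (K_sub G2 m)) (f B)"
  by (simp add: lev_iso_def)

text \<open>Two representatives of an orbit at level \<open>m\<close> differ by some
  \<open>k\<close> in \<open>K_sub G1 m\<close>. Equivariance turns this into a motion by the image
  of \<open>k\<close> under \<open>\<Phi>\<close>, which is trivial at level \<open>m\<close> of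
  \<open>G2\<close>, though in general not at level \<open>n\<close>.\<close>

lemma descends_descent:
  assumes f: "lev_iso n f" and mn: "m \<le> n"
  shows "descends n f m (descent n f m)"
  unfolding descends_def
proof
  fix B assume "B \<in> A1.lev n"
  then obtain s where s: "s \<in> A1" "B = A1.orb n s" by (elim A1.levE)
  define s' where "s' = (SOME t. t \<in> A1.orb m s)"
  have "s' \<in> A1.orb m s" unfolding s'_def by (rule someI) (rule A1.orb_self[OF s(1)])
  then obtain k where k: "k \<in> K_sub G1 m" "s' = \<phi>1 k s" by (auto simp: A1.mem_orb)
  have kc: "k \<in> carrier G1" using k A1.K_carrier by blast
  obtain t where t: "t \<in> A2" "f (A1.orb n s) = A2.orb n t"
    using A2.levE[OF lev_iso_lev[OF f A1.orb_lev[OF s(1)]]] by blast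
  obtain b where b: "b \<in> carrier G2" "\<Phi> (G1.embed k) (K_sub G2 n) = K_sub G2 n #>\<^bsub>G2\<^esub> b"
    using G2.hat_coset_ex[OF \<Phi>_closed[OF G1.embed_closed[OF kc]], of "K_sub G2 n"] by auto
  have "f (A1.orb n s') = A2.orb n (\<phi>2 b t)"
  proof -
    have "A1.orb n s' = translate \<phi>1 (G1.embed k (K_sub G1 n)) (A1.orb n s)"
      using A1.translate_orb[OF kc s(1), of n n] k by simp
    then have "f (A1.orb n s') = translate \<phi>2 (\<Phi> (G1.embed k) (K_sub G2 n)) (A2.orb n t)"
      using lev_iso_equivariant[OF f G1.embed_closed[OF kc], of "A1.orb n s"] s t by simp
    also have "\<dots> = A2.orb n (\<phi>2 b t)" using A2.translate_orb[OF b(1) t(1), of n n] b by simp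
    finally show ?thesis .
  qed
  then have 1: "descent n f m (A1.orb m s) = A2.orb m (\<phi>2 b t)"
    using b t mn A2.act_closed by (simp add: descent_def s'_def[symmetric] A2.translate_K_orb)
  have "\<Phi> (G1.embed k) (K_sub G2 m) = \<Phi> \<one>\<^bsub>G1.hat\<^esub> (K_sub G2 m)"
    by (rule \<Phi>_level) (use kc k G1.coset_join2[OF kc G1.subgroup_K_sub] in \<open>auto simp: G1.hat_one\<close>)
  also have "\<Phi> \<one>\<^bsub>G1.hat\<^esub> = \<one>\<^bsub>G2.hat\<^esub>"
    using \<Phi> hom_one[OF _ G1.hat.is_group G2.hat.is_group] by (auto simp: iso_def)
  also have "\<dots> (K_sub G2 m) = K_sub G2 m" by (simp add: G2.hat_one)
  finally have "K_sub G2 m #>\<^bsub>G2\<^esub> b = K_sub G2 m"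
    using G2.hat_coset_mono[OF \<Phi>_closed[OF G1.embed_closed[OF kc]] _ _ G2.K_sub_antimono[OF mn] b] by auto
  then have "b \<in> K_sub G2 m" using G2.coset_join1 b(1) G2.subgroup_K_sub by blast
  then have "A2.orb m (\<phi>2 b t) = A2.orb m t" using A2.orb_act_K t by blast
  then show "descent n f m (translate \<phi>1 (K_sub G1 m) B) = translate \<phi>2 (K_sub G2 m) (f B)"
    using 1 s t mn by (simp add: A1.translate_K_orb A2.translate_K_orb)
qed

lemma lev_lift:
  assumes "B \<in> A1.lev m" "m \<le> n"
  obtains C where "C \<in> A1.lev n" "B = translate \<phi>1 (K_sub G1 m) C"
proof -
  obtain s where "s \<in> A1" "B = A1.orb m s" using assms by (elim A1.levE)
  then show ?thesis using that[of "A1.orb n s"] assms by (simp add: A1.translate_K_orb)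
qed

text \<open>Every orbit at level \<open>m\<close> comes from level \<open>n\<close>, where both maps
  are given by \<open>f\<close>. The members of a selection are compatible for this reason: any two
  of them descend from a common higher level.\<close>

lemma descends_factor:
  assumes f: "lev_iso n f" and "descends n f m g" "descends n f l h" "l \<le> m" "m \<le> n"
  shows "descends m g l h"
  unfolding descends_def
proof
  fix B assume "B \<in> A1.lev m"
  then obtain C where C: "C \<in> A1.lev n" "B = translate \<phi>1 (K_sub G1 m) C" using lev_lift assms by blast
  have "h (translate \<phi>1 (K_sub G1 l) B) = translate \<phi>2 (K_sub G2 l) (f C)"
    using assms C A1.translate_translate[OF C(1), of l m] by (simp add: descends_def)
  also have "\<dots> = translate \<phi>2 (K_sub G2 l) (g B)"
    using assms C A2.translate_translate[OF lev_iso_lev[OF f C(1)], of l m] by (simp add: descends_def)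
  finally show "h (translate \<phi>1 (K_sub G1 l) B) = translate \<phi>2 (K_sub G2 l) (g B)" .
qed

text \<open>Surjectivity descends because lower levels are quotients. Injectivity comes from
  counting, hence the hypothesis on cardinalities, which an unrelated isomorphism at level
  \<open>m\<close> can supply.\<close>

lemma lev_iso_descends:
  assumes f: "lev_iso n f" and g: "descends n f m g" and mn: "m \<le> n"
    and fin: "finite (A1.lev m)" and card: "card (A1.lev m) = card (A2.lev m)"
  shows "lev_iso m g"
  unfolding lev_iso_def
proof (intro conjI ballI)
  have g_orb: "g (A1.orb m s) = translate \<phi>2 (K_sub G2 m) (f (A1.orb n s))" if "s \<in> A1" for s
    using g that mn A1.translate_K_orb[OF that mn] by (auto simp: descends_def dest: bspec[of _ _ "A1.orb n s"])
  have "g ` A1.lev m = A2.lev m"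
  proof
    show "g ` A1.lev m \<subseteq> A2.lev m"
    proof
      fix C assume "C \<in> g ` A1.lev m"
      then obtain s where s: "s \<in> A1" "C = g (A1.orb m s)" by (auto elim: A1.levE)
      then show "C \<in> A2.lev m"
        using g_orb A2.translate_lev[OF lev_iso_lev[OF f A1.orb_lev[OF s(1)]] mn] by simp
    qed
    show "A2.lev m \<subseteq> g ` A1.lev m"
    proof
      fix C assume "C \<in> A2.lev m"
      then obtain t where t: "t \<in> A2" "C = A2.orb m t" by (elim A2.levE)
      then have "A2.orb n t \<in> f ` A1.lev n" using f by (auto simp: lev_iso_def bij_betw_def)
      then obtain s where s: "s \<in> A1" "A2.orb n t = f (A1.orb n s)" by (auto elim: A1.levE)
      then have "C = g (A1.orb m s)" using g_orb t mn by (simp add: A2.translate_K_orb flip: s(2))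
      then show "C \<in> g ` A1.lev m" using s by blast
    qed
  qed
  then show "bij_betw g (A1.lev m) (A2.lev m)"
    using eq_card_imp_inj_on[OF fin, of g] card by (simp add: bij_betw_def)
next
  fix x B assume x: "x \<in> carrier G1.hat" and "B \<in> A1.lev m"
  then obtain C where C: "C \<in> A1.lev n" "B = translate \<phi>1 (K_sub G1 m) C" using lev_lift mn by blast
  obtain s where s: "s \<in> A1" "C = A1.orb n s" using C by (elim A1.levE)
  obtain t where t: "t \<in> A2" "f C = A2.orb n t" using A2.levE[OF lev_iso_lev[OF f C(1)]] by blast
  obtain a where a: "a \<in> carrier G1" "x (K_sub G1 n) = K_sub G1 n #>\<^bsub>G1\<^esub> a"
    using G1.hat_coset_ex[OF x, of "K_sub G1 n"] by auto
  obtain b where b: "b \<in> carrier G2" "\<Phi> x (K_sub G2 n) = K_sub G2 n #>\<^bsub>G2\<^esub> b"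
    using G2.hat_coset_ex[OF \<Phi>_closed[OF x], of "K_sub G2 n"] by auto
  have am: "x (K_sub G1 m) = K_sub G1 m #>\<^bsub>G1\<^esub> a"
    using G1.hat_coset_mono[OF x _ _ G1.K_sub_antimono[OF mn] a] by auto
  have bm: "\<Phi> x (K_sub G2 m) = K_sub G2 m #>\<^bsub>G2\<^esub> b"
    using G2.hat_coset_mono[OF \<Phi>_closed[OF x] _ _ G2.K_sub_antimono[OF mn] b] by auto
  have as: "\<phi>1 a s \<in> A1" and bt: "\<phi>2 b t \<in> A2" using a s b t A1.act_closed A2.act_closed by auto
  \<comment> \<open>The translate at level \<open>m\<close> is the projection of the translate at
    level \<open>n\<close>, where the equivariance of \<open>f\<close> is available.\<close>
  have "translate \<phi>1 (x (K_sub G1 m)) B = A1.orb m (\<phi>1 a s)"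
    using A1.translate_orb[OF a(1) s(1), of m m] C s mn by (simp add: am A1.translate_K_orb)
  also have "\<dots> = translate \<phi>1 (K_sub G1 m) (translate \<phi>1 (x (K_sub G1 n)) C)"
    using A1.translate_orb[OF a(1) s(1), of n n] s a mn as by (simp add: A1.translate_K_orb)
  finally have "g (translate \<phi>1 (x (K_sub G1 m)) B) =
      g (translate \<phi>1 (K_sub G1 m) (translate \<phi>1 (x (K_sub G1 n)) C))" by simp
  also have "\<dots> = translate \<phi>2 (K_sub G2 m) (f (translate \<phi>1 (x (K_sub G1 n)) C))"
    using g A1.translate_orb[OF a(1) s(1), of n n] s a as by (simp add: descends_def)
  also have "\<dots> = translate \<phi>2 (K_sub G2 m) (translate \<phi>2 (\<Phi> x (K_sub G2 n)) (f C))"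
    using lev_iso_equivariant[OF f x C(1)] by simp
  also have "\<dots> = A2.orb m (\<phi>2 b t)"
    using A2.translate_orb[OF b(1) t(1), of n n] t b mn bt by (simp add: A2.translate_K_orb)
  also have "\<dots> = translate \<phi>2 (\<Phi> x (K_sub G2 m)) (translate \<phi>2 (K_sub G2 m) (f C))"
    using A2.translate_orb[OF b(1) t(1), of m m] t mn by (simp add: bm A2.translate_K_orb)
  also have "translate \<phi>2 (K_sub G2 m) (f C) = g B" using g C by (simp add: descends_def)
  finally show "g (translate \<phi>1 (x (K_sub G1 m)) B) = translate \<phi>2 (\<Phi> x (K_sub G2 m)) (g B)" .
qed

text \<open>A completed point is mapped coordinatewise along the levels \<open>M j\<close>. For
  surjectivity, the preimages of the coordinates form a thread because each \<open>f j\<close> is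
  injective.\<close>

lemma limit_exists:
  assumes M: "mono M" "\<forall>n. \<exists>j. n \<le> M j" and f: "\<And>j::nat. lev_iso (M j) (f j)"
    and comp: "\<And>j k. j \<le> k \<Longrightarrow> descends (M k) (f k) (M j) (f j)"
  shows "\<exists>F. bij_betw F A1.completion A2.completion \<and>
           (\<forall>\<xi>\<in>A1.completion. \<forall>j. F \<xi> (M j) = f j (\<xi> (M j)))"
proof -
  have "\<exists>\<eta>. \<eta> \<in> A2.completion \<and> (\<forall>j. \<eta> (M j) = f j (\<xi> (M j)))" if \<xi>: "\<xi> \<in> A1.completion" for \<xi>
  proof -
    have "\<exists>\<eta>\<in>A2.completion. \<forall>j. \<eta> (M j) = f j (\<xi> (M j))"
    proof (rule A2.completion_of_thread[OF M(2) _ _ M(1)])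
      show "f j (\<xi> (M j)) \<in> A2.lev (M j)" for j using lev_iso_lev[OF f] A1.completionD(1)[OF \<xi>] by blast
      show "f j (\<xi> (M j)) = translate \<phi>2 (K_sub G2 (M j)) (f k (\<xi> (M k)))" if "j \<le> k" for j k
        using comp[OF that] A1.completionD[OF \<xi>] monoD[OF M(1) that] by (simp add: descends_def)
    qed
    then show ?thesis by blast
  qed
  then obtain F where F: "\<And>\<xi>. \<xi> \<in> A1.completion \<Longrightarrow> F \<xi> \<in> A2.completion"
    "\<And>\<xi> j. \<xi> \<in> A1.completion \<Longrightarrow> F \<xi> (M j) = f j (\<xi> (M j))" by metis
  have f_inj: "B = C" if "B \<in> A1.lev (M j)" "C \<in> A1.lev (M j)" "f j B = f j C" for j B C
    using f[of j] that by (auto simp: lev_iso_def bij_betw_def dest: inj_onD)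
  have "inj_on F A1.completion"
  proof (rule inj_onI)
    fix \<xi> \<eta> assume \<xi>: "\<xi> \<in> A1.completion" and \<eta>: "\<eta> \<in> A1.completion" and eq: "F \<xi> = F \<eta>"
    show "\<xi> = \<eta>"
      by (rule A1.completion_eqI[OF \<xi> \<eta> M(2)], rule f_inj)
        (use F(2)[OF \<xi>] F(2)[OF \<eta>] eq A1.completionD(1)[OF \<xi>] A1.completionD(1)[OF \<eta>] in auto)
  qed
  moreover have "A2.completion \<subseteq> F ` A1.completion"
  proof
    fix \<eta> assume \<eta>: "\<eta> \<in> A2.completion"
    have "\<exists>B. B \<in> A1.lev (M j) \<and> f j B = \<eta> (M j)" for j
    proof -
      have "\<eta> (M j) \<in> f j ` A1.lev (M j)"
        using f[of j] A2.completionD(1)[OF \<eta>, of "M j"] by (simp add: lev_iso_def bij_betw_def)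
      then show ?thesis by auto
    qed
    then obtain b where b: "\<And>j. b j \<in> A1.lev (M j)" "\<And>j. f j (b j) = \<eta> (M j)" by metis
    have "\<exists>\<xi>\<in>A1.completion. \<forall>j. \<xi> (M j) = b j"
    proof (rule A1.completion_of_thread[OF M(2) b(1) _ M(1)])
      fix j k :: nat assume jk: "j \<le> k"
      have "f j (translate \<phi>1 (K_sub G1 (M j)) (b k)) = translate \<phi>2 (K_sub G2 (M j)) (\<eta> (M k))"
        using comp[OF jk] b by (simp add: descends_def)
      also have "\<dots> = f j (b j)" using A2.completionD(2)[OF \<eta> monoD[OF M(1) jk]] b by simp
      finally show "b j = translate \<phi>1 (K_sub G1 (M j)) (b k)"
        using f_inj b A1.translate_lev[OF b(1) monoD[OF M(1) jk]] by metis
    qed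
    then obtain \<xi> where \<xi>: "\<xi> \<in> A1.completion" "\<And>j. \<xi> (M j) = b j" by blast
    have "F \<xi> = \<eta>"
      by (rule A2.completion_eqI[OF F(1)[OF \<xi>(1)] \<eta> M(2)]) (simp add: F(2)[OF \<xi>(1)] \<xi> b)
    then show "\<eta> \<in> F ` A1.completion" using \<xi> by blast
  qed
  ultimately have "bij_betw F A1.completion A2.completion"
    using F by (auto simp: bij_betw_def)
  then show ?thesis using F by blast
qed

lemma limit_equivariant:
  assumes M: "\<forall>n. \<exists>j. n \<le> M j" and f: "\<And>j::nat. lev_iso (M j) (f j)"
    and F: "\<And>\<xi>. \<xi> \<in> A1.completion \<Longrightarrow> F \<xi> \<in> A2.completion"
      "\<And>\<xi> j. \<xi> \<in> A1.completion \<Longrightarrow> F \<xi> (M j) = f j (\<xi> (M j))"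
    and x: "x \<in> carrier G1.hat" and \<xi>: "\<xi> \<in> A1.completion"
  shows "F (A1.act x \<xi>) = A2.act (\<Phi> x) (F \<xi>)"
proof (rule A2.completion_eqI[OF _ _ M])
  show "F (A1.act x \<xi>) \<in> A2.completion" using F x \<xi> by blast
  show "A2.act (\<Phi> x) (F \<xi>) \<in> A2.completion" using F x \<xi> by blast
  show "F (A1.act x \<xi>) (M j) = A2.act (\<Phi> x) (F \<xi>) (M j)" for j
    using F(2)[OF A1.act_completion[OF x \<xi>], of j] F(2)[OF \<xi>, of j]
      lev_iso_equivariant[OF f x A1.completionD(1)[OF \<xi>], of j]
    by (simp add: completed_act_def)
qed

end

section \<open>Compactness\<close>

text \<open>Koenig's lemma by successive refinement; \<open>\<psi> k j\<close> will be the descent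
  to level \<open>j\<close> of a map chosen at level \<open>k\<close>. All values of
  \<open>v\<close> up to \<open>j\<close> come from one \<open>k\<close>, and this is what later
  makes them compatible.\<close>

lemma infinitely_often_thread:
  fixes \<psi> :: "nat \<Rightarrow> nat \<Rightarrow> 'a"
  assumes fin: "\<And>j. finite (S j)" and mem: "\<And>j k. j \<le> k \<Longrightarrow> \<psi> k j \<in> S j"
  shows "\<exists>v. \<forall>j. \<exists>k\<ge>j. \<forall>i\<le>j. \<psi> k i = v i"
proof -
  \<comment> \<open>\<open>A\<close> collects indices from \<open>j\<close> on that agree on the
    value at \<open>j\<close>. The sets are nested, so an index in the j-th one agrees with all
    earlier values as well.\<close>
  let ?P = "\<lambda>j (v, A). infinite A \<and> (\<forall>k\<in>A. j \<le> k \<and> \<psi> k j = v)"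
  have pick: "\<exists>v A'. A' \<subseteq> A \<and> infinite A' \<and> (\<forall>k\<in>A'. j \<le> k \<and> \<psi> k j = v)"
    if A: "infinite A" for A j
  proof -
    have inf: "infinite (A - {..<j})" using A by simp
    have "(\<lambda>k. \<psi> k j) ` (A - {..<j}) \<subseteq> S j" by (rule image_subsetI, rule mem) auto
    then have "finite ((\<lambda>k. \<psi> k j) ` (A - {..<j}))" using fin finite_subset by blast
    then obtain a where "infinite {k \<in> A - {..<j}. \<psi> k j = \<psi> a j}"
      using pigeonhole_infinite[OF inf] by blast
    then show ?thesis by (intro exI[of _ "\<psi> a j"] exI[of _ "{k \<in> A - {..<j}. \<psi> k j = \<psi> a j}"]) auto
  qed
  have "\<exists>h. \<forall>j. ?P j (h j) \<and> snd (h (Suc j)) \<subseteq> snd (h j)"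
  proof (rule dependent_nat_choice)
    show "\<exists>x. ?P 0 x" using pick[of UNIV 0] by auto
    fix x j assume "?P j x"
    then have "infinite (snd x)" by (auto split: prod.splits)
    from pick[OF this, of "Suc j"] show "\<exists>y. ?P (Suc j) y \<and> snd y \<subseteq> snd x" by auto
  qed
  then obtain h where "\<forall>j. ?P j (h j) \<and> snd (h (Suc j)) \<subseteq> snd (h j)" ..
  then have h: "\<And>j. ?P j (h j)" "\<And>j. snd (h (Suc j)) \<subseteq> snd (h j)" by simp_all
  have anti: "snd (h j) \<subseteq> snd (h i)" if "i \<le> j" for i j
    using that by (rule lift_Suc_antimono_le[of "\<lambda>j. snd (h j)", rotated]) (rule h(2))
  have "\<exists>k\<ge>j. \<forall>i\<le>j. \<psi> k i = fst (h i)" for j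
  proof -
    have "infinite (snd (h j))" using h(1)[of j] by (auto split: prod.splits)
    then obtain k where k: "k \<in> snd (h j)" using infinite_imp_nonempty by blast
    have "i \<le> k \<and> \<psi> k i = fst (h i)" if "i \<le> j" for i
      using h(1)[of i] anti[OF that] k by (auto split: prod.splits)
    then show ?thesis by auto
  qed
  then show ?thesis by (intro exI[of _ "\<lambda>i. fst (h i)"]) blast
qed

section \<open>Realizations\<close>

abbreviation lookup where "lookup \<equiv> Poly_Mapping.lookup"
abbreviation keys where "keys \<equiv> Poly_Mapping.keys"
abbreviation vertex :: "'v \<Rightarrow> ('v \<Rightarrow>\<^sub>0 real)" where "vertex v \<equiv> Poly_Mapping.single v 1"

lemma lookup_scaleR [simp]: "lookup (r *\<^sub>R x) v = r *\<^sub>R lookup x v"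
proof -
  have "{v. r *\<^sub>R lookup x v \<noteq> 0} \<subseteq> keys x" by (auto simp: in_keys_iff)
  then have "finite {v. r *\<^sub>R lookup x v \<noteq> 0}" by (rule finite_subset) simp
  then show ?thesis by (simp add: scaleR_poly_mapping_def)
qed

lemma lookup_not_key: "v \<notin> keys x \<Longrightarrow> lookup x v = 0"
  by (simp add: in_keys_iff)

lemma norm_poly_mapping_eq:
  fixes x :: "'v \<Rightarrow>\<^sub>0 real"
  assumes "finite S" "keys x \<subseteq> S"
  shows "norm x = (\<Sum>v\<in>S. \<bar>lookup x v\<bar>)"
proof -
  have "norm x = (\<Sum>v\<in>keys x. \<bar>lookup x v\<bar>)"
    by (simp add: norm_poly_mapping_def dist_poly_mapping_def)
  also have "\<dots> = (\<Sum>v\<in>S. \<bar>lookup x v\<bar>)"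
    using assms by (intro sum.mono_neutral_left) (auto simp: in_keys_iff)
  finally show ?thesis .
qed

lemma abs_lookup_le_norm:
  fixes x :: "'v \<Rightarrow>\<^sub>0 real"
  shows "\<bar>lookup x v\<bar> \<le> norm x"
proof -
  have "\<bar>lookup x v\<bar> \<le> (\<Sum>w\<in>insert v (keys x). \<bar>lookup x w\<bar>)"
    by (rule member_le_sum) auto
  then show ?thesis using norm_poly_mapping_eq[of "insert v (keys x)" x, OF _ subset_insertI] by simp
qed

lemma realize_eq_sum:
  assumes "finite S" "keys x \<subseteq> S"
  shows "realize f x = (\<Sum>v\<in>S. Poly_Mapping.single (f v) (lookup x v))"
  unfolding realize_def
  using assms by (intro sum.mono_neutral_left) (auto simp: in_keys_iff)

lemma scaleR_single: "r *\<^sub>R Poly_Mapping.single v (a::real) = Poly_Mapping.single v (r * a)"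
  by (rule poly_mapping_eqI) (simp add: lookup_single when_def)

text \<open>The constant 1 suffices: in the l1 norm, adding up the coordinates of vertices with
  equal image cannot increase the norm.\<close>

lemma bounded_linear_realize:
  fixes f :: "'v \<Rightarrow> 'w"
  shows "bounded_linear (realize f)"
proof (rule bounded_linear_intro[where K = 1])
  fix x y :: "'v \<Rightarrow>\<^sub>0 real" and r :: real
  let ?S = "keys x \<union> keys y"
  have "keys (x + y) \<subseteq> ?S" by (rule keys_add)
  then show "realize f (x + y) = realize f x + realize f y"
    by (simp add: realize_eq_sum[of ?S] lookup_add single_add sum.distrib)
  have "keys (r *\<^sub>R x) \<subseteq> keys x" by (auto simp: in_keys_iff)
  then show "realize f (r *\<^sub>R x) = r *\<^sub>R realize f x"
    by (simp add: realize_eq_sum[of "keys x"] scaleR_right.sum scaleR_single)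
  have "norm (Poly_Mapping.single w a) = \<bar>a\<bar>" for w :: 'w and a :: real
    by (subst norm_poly_mapping_eq[of "{w}"]) auto
  moreover have "norm (realize f x) \<le> (\<Sum>v\<in>keys x. norm (Poly_Mapping.single (f v) (lookup x v)))"
    unfolding realize_def by (rule norm_sum)
  ultimately show "norm (realize f x) \<le> norm x * 1"
    by (simp add: norm_poly_mapping_eq[of "keys x"])
qed

lemma realize_add: "realize f (x + y) = realize f x + realize f y"
  and realize_scaleR: "realize f (r *\<^sub>R x) = r *\<^sub>R realize f (x :: 'v \<Rightarrow>\<^sub>0 real)"
  using bounded_linear_realize[of f, THEN bounded_linear.linear] by (simp_all add: linear_add linear_scale)

lemma continuous_on_realize [continuous_intros]: "continuous_on S (realize f)"
  using bounded_linear_realize linear_continuous_on by blast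

lemma realize_single [simp]: "realize f (Poly_Mapping.single v a) = Poly_Mapping.single (f v) a"
  by (subst realize_eq_sum[of "{v}"]) auto

lemma realize_cong: "(\<And>v. v \<in> keys x \<Longrightarrow> f v = g v) \<Longrightarrow> realize f x = realize g x"
  unfolding realize_def by (rule sum.cong) auto

lemma realize_sum:
  assumes "finite I"
  shows "realize f (\<Sum>i\<in>I. x i) = (\<Sum>i\<in>I. realize f (x i :: 'v \<Rightarrow>\<^sub>0 real))"
  using bounded_linear_realize[of f, THEN bounded_linear.linear] by (simp add: linear_sum)

lemma realize_realize: "realize f (realize g x) = realize (\<lambda>v. f (g v)) x"
  unfolding realize_def[of g] realize_def[of "\<lambda>v. f (g v)"] by (simp add: realize_sum)

lemma realize_ident:
  assumes "\<And>v. v \<in> keys x \<Longrightarrow> f v = v" shows "realize f x = x"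
proof -
  have "realize f x = realize (\<lambda>v. v) x" using assms by (rule realize_cong)
  also have "\<dots> = x"
  proof (rule poly_mapping_eqI)
    fix w
    have "lookup (realize (\<lambda>v. v) x) w = (\<Sum>v\<in>keys x. if v = w then lookup x v else 0)"
      by (simp add: realize_def lookup_sum lookup_single when_def)
    then show "lookup (realize (\<lambda>v. v) x) w = lookup x w" by (simp add: in_keys_iff)
  qed
  finally show ?thesis .
qed

lemma closed_simplex_iff:
  fixes s :: "'v set"
  assumes "finite s"
  shows "x \<in> closed_simplex s \<longleftrightarrow> keys x \<subseteq> s \<and> (\<forall>v. 0 \<le> lookup x v) \<and> (\<Sum>v\<in>s. lookup x v) = 1"
    (is "_ \<longleftrightarrow> ?R x")
proof
  have "convex {x. ?R x}"
  proof (rule convexI, clarify, intro conjI)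
    fix x y :: "'v \<Rightarrow>\<^sub>0 real" and a b :: real
    assume x: "keys x \<subseteq> s" "\<forall>v. 0 \<le> lookup x v" "(\<Sum>v\<in>s. lookup x v) = 1"
      and y: "keys y \<subseteq> s" "\<forall>v. 0 \<le> lookup y v" "(\<Sum>v\<in>s. lookup y v) = 1"
      and ab: "0 \<le> a" "0 \<le> b" "a + b = 1"
    show "keys (a *\<^sub>R x + b *\<^sub>R y) \<subseteq> s"
    proof
      fix v assume v: "v \<in> keys (a *\<^sub>R x + b *\<^sub>R y)"
      show "v \<in> s"
      proof (rule ccontr)
        assume "v \<notin> s"
        then have "v \<notin> keys x" "v \<notin> keys y" using x(1) y(1) by auto
        then have "lookup (a *\<^sub>R x + b *\<^sub>R y) v = 0" by (simp add: lookup_add lookup_not_key)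
        then show False using v by (simp add: in_keys_iff)
      qed
    qed
    show "\<forall>v. 0 \<le> lookup (a *\<^sub>R x + b *\<^sub>R y) v" using x y ab by (simp add: lookup_add)
    show "(\<Sum>v\<in>s. lookup (a *\<^sub>R x + b *\<^sub>R y) v) = 1"
      using x y ab by (simp add: lookup_add sum.distrib sum_distrib_left[symmetric])
  qed
  moreover have "vertex ` s \<subseteq> {x. ?R x}"
    using assms by (auto simp: lookup_single when_def)
  ultimately show "x \<in> closed_simplex s \<Longrightarrow> ?R x"
    unfolding closed_simplex_def using hull_minimal[of "vertex ` s" "{x. ?R x}" convex] by blast
next
  assume R: "?R x"
  have "x = realize (\<lambda>v. v) x" by (simp add: realize_ident)
  also have "\<dots> = (\<Sum>v\<in>s. Poly_Mapping.single v (lookup x v))"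
    by (rule realize_eq_sum) (use assms R in auto)
  also have "\<dots> = (\<Sum>v\<in>s. lookup x v *\<^sub>R vertex v)" by (simp add: scaleR_single)
  also have "\<dots> \<in> convex hull (vertex ` s)"
    by (rule convex_sum) (use assms R in \<open>auto intro: hull_inc\<close>)
  finally show "x \<in> closed_simplex s" by (simp add: closed_simplex_def)
qed

lemma convex_closed_simplex: "convex (closed_simplex s)"
  by (simp add: closed_simplex_def)

lemma closed_simplex_segment:
  assumes "x \<in> closed_simplex s" "y \<in> closed_simplex s" "0 \<le> t" "t \<le> (1::real)"
  shows "(1 - t) *\<^sub>R x + t *\<^sub>R y \<in> closed_simplex s"
  using convex_closed_simplex[of s] assms by (simp add: convex_alt)

lemma closed_simplex_keys:
  assumes "finite s" "x \<in> closed_simplex s" shows "x \<in> closed_simplex (keys x)"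
proof -
  have x: "keys x \<subseteq> s" "\<forall>v. 0 \<le> lookup x v" "(\<Sum>v\<in>s. lookup x v) = 1"
    using assms closed_simplex_iff by auto
  have "(\<Sum>v\<in>s. lookup x v) = (\<Sum>v\<in>keys x. lookup x v)"
    using x assms by (intro sum.mono_neutral_right) (auto simp: in_keys_iff)
  then show ?thesis using x by (simp add: closed_simplex_iff)
qed

lemma keys_nonempty: "x \<in> closed_simplex s \<Longrightarrow> finite s \<Longrightarrow> keys x \<noteq> {}"
  using closed_simplex_iff[of s x] lookup_not_key[of _ x] by (metis empty_iff sum.neutral zero_neq_one)

lemma closed_simplex_mono: "s \<subseteq> t \<Longrightarrow> closed_simplex s \<subseteq> closed_simplex t"
  unfolding closed_simplex_def by (intro hull_mono) auto

lemma vertex_closed_simplex: "v \<in> s \<Longrightarrow> vertex v \<in> closed_simplex s"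
  unfolding closed_simplex_def by (intro hull_inc) auto

lemma realize_closed_simplex: "realize f ` closed_simplex s = closed_simplex (f ` s)"
proof -
  have "realize f ` closed_simplex s = convex hull (realize f ` vertex ` s)"
    unfolding closed_simplex_def
    using bounded_linear_realize[of f, THEN bounded_linear.linear] by (rule convex_hull_linear_image)
  also have "realize f ` vertex ` s = vertex ` f ` s" by (simp add: image_image)
  finally show ?thesis by (simp add: closed_simplex_def)
qed

lemma realize_realization: "realize f ` realization X = realization ((\<lambda>s. f ` s) ` X)"
  unfolding realization_def image_UN by (simp add: realize_closed_simplex)

text \<open>Nonnegative coordinates cannot cancel when vertices are identified.\<close>

lemma keys_realize:
  assumes "\<And>v. 0 \<le> lookup x v"
  shows "keys (realize f x) = f ` keys (x :: 'v \<Rightarrow>\<^sub>0 real)"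
proof -
  have eq: "lookup (realize f x) w = (\<Sum>v\<in>keys x. if f v = w then lookup x v else 0)" for w
    by (simp add: realize_def lookup_sum lookup_single when_def)
  have "(\<Sum>v\<in>keys x. if f v = w then lookup x v else 0) = 0 \<longleftrightarrow> w \<notin> f ` keys x" for w
    by (subst sum_nonneg_eq_0_iff) (use assms in \<open>auto simp: in_keys_iff\<close>)
  then show ?thesis by (auto simp: in_keys_iff[of _ "realize f x"] eq)
qed

text \<open>A point with support exactly \<open>s\<close>, through which statements about points of
  the realization become statements about simplices.\<close>

definition barycenter :: "'v set \<Rightarrow> ('v \<Rightarrow>\<^sub>0 real)" where
  "barycenter s = (\<Sum>v\<in>s. Poly_Mapping.single v (1 / card s))"

lemma lookup_barycenter:
  "finite s \<Longrightarrow> lookup (barycenter s) v = (if v \<in> s then 1 / card s else 0)"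
  by (simp add: barycenter_def lookup_sum lookup_single when_def)

lemma keys_barycenter: "\<lbrakk>finite s; s \<noteq> {}\<rbrakk> \<Longrightarrow> keys (barycenter s) = s"
  by (auto simp: in_keys_iff lookup_barycenter split: if_splits)

lemma barycenter_closed_simplex: "\<lbrakk>finite s; s \<noteq> {}\<rbrakk> \<Longrightarrow> barycenter s \<in> closed_simplex s"
  by (simp add: closed_simplex_iff keys_barycenter) (simp add: lookup_barycenter)

lemma realize_barycenter:
  assumes "finite s" "inj_on f s" shows "realize f (barycenter s) = barycenter (f ` s)"
  using assms unfolding barycenter_def
  by (simp add: realize_sum sum.reindex card_image)

section \<open>Local structure of realizations, and connectedness through edges\<close>

locale complex =
  fixes X :: "'v set set"
  assumes complex: "abstract_complex X"
begin

lemma simplexD: assumes "s \<in> X" shows "finite s" "s \<noteq> {}"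
  using assms complex by (auto simp: abstract_complex_def)

lemma face: "\<lbrakk>s \<in> X; t \<subseteq> s; t \<noteq> {}\<rbrakk> \<Longrightarrow> t \<in> X"
  using complex unfolding abstract_complex_def by blast

lemma vertex_simplex: "v \<in> verts X \<Longrightarrow> {v} \<in> X"
  using face[of _ "{v}"] by blast

lemma realizationD:
  assumes "x \<in> realization X"
  shows "keys x \<in> X" "x \<in> closed_simplex (keys x)" "0 \<le> lookup x v"
proof -
  obtain s where s: "s \<in> X" "x \<in> closed_simplex s" using assms by (auto simp: realization_def)
  then have f: "finite s" using simplexD by blast
  then have "keys x \<subseteq> s" "keys x \<noteq> {}" "0 \<le> lookup x v"
    using s closed_simplex_iff[OF f, of x] keys_nonempty[of x s] by blast+
  then show "keys x \<in> X" "x \<in> closed_simplex (keys x)" "0 \<le> lookup x v"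
    using face[OF s(1), of "keys x"] closed_simplex_keys[OF f s(2)] by auto
qed

lemma realizationI: "\<lbrakk>s \<in> X; x \<in> closed_simplex s\<rbrakk> \<Longrightarrow> x \<in> realization X"
  by (auto simp: realization_def)

lemma vertex_realization: "v \<in> verts X \<Longrightarrow> vertex v \<in> realization X"
  using realizationI[OF vertex_simplex vertex_closed_simplex] by blast

text \<open>The norm bounds every coordinate, so within the least positive coordinate of
  \<open>x\<close> no vertex of its support can be lost.\<close>

lemma local_star:
  assumes "x \<in> realization X"
  obtains r where "r > 0" "\<And>y. dist x y < r \<Longrightarrow> keys x \<subseteq> keys y"
proof -
  have pos: "lookup x v > 0" if "v \<in> keys x" for v
    using realizationD(3)[OF assms, of v] that by (simp add: in_keys_iff)
  have ne: "keys x \<noteq> {}" using realizationD(1)[OF assms] simplexD by blast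
  define r where "r = Min (lookup x ` keys x)"
  have "r > 0" unfolding r_def using pos ne by (subst Min_gr_iff) auto
  moreover have "keys x \<subseteq> keys y" if "dist x y < r" for y
  proof
    fix v assume v: "v \<in> keys x"
    have "\<bar>lookup (x - y) v\<bar> < r" using abs_lookup_le_norm[of "x - y" v] that by (simp add: dist_norm)
    also have "r \<le> lookup x v" unfolding r_def using v by simp
    finally show "v \<in> keys y" by (auto simp: lookup_minus in_keys_iff)
  qed
  ultimately show ?thesis using that by blast
qed

lemma segment_realization:
  assumes "x \<in> realization X" "y \<in> realization X" "keys x \<subseteq> keys y"
  shows "closed_segment x y \<subseteq> realization X"
proof -
  have "x \<in> closed_simplex (keys y)"
    using realizationD(2)[OF assms(1)] closed_simplex_mono[OF assms(3)] by blast
  then have "closed_segment x y \<subseteq> closed_simplex (keys y)"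
    using realizationD(2)[OF assms(2)] convex_closed_simplex closed_segment_subset by blast
  then show ?thesis using realizationI realizationD(1)[OF assms(2)] by blast
qed

text \<open>Small balls are star-shaped about \<open>x\<close>, since nearby points have larger
  support and so share a simplex with \<open>x\<close>. The lifting criterion for coverings asks for
  this property.\<close>

lemma locally_path_connected_realization: "locally path_connected (realization X)"
proof (rule locallyI)
  fix W x assume W: "openin (top_of_set (realization X)) W" and xW: "x \<in> W"
  then have x: "x \<in> realization X" using openin_imp_subset by blast
  obtain e where e: "e > 0" "ball x e \<inter> realization X \<subseteq> W"
    using W xW openin_contains_ball[of "realization X" W] by auto
  obtain r where r: "r > 0" "\<And>y. dist x y < r \<Longrightarrow> keys x \<subseteq> keys y" using local_star[OF x] by blast
  let ?U = "ball x (min e r) \<inter> realization X"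
  have "starlike ?U"
    unfolding starlike_def
  proof (intro bexI ballI)
    fix y assume y: "y \<in> ?U"
    then have "closed_segment x y \<subseteq> realization X"
      using segment_realization[OF x] r by simp
    moreover have "closed_segment x y \<subseteq> ball x (min e r)"
      using y e r by (intro closed_segment_subset) auto
    ultimately show "closed_segment x y \<subseteq> ?U" by blast
  qed (use x e r in auto)
  then have "path_connected ?U"
    using starlike_imp_contractible contractible_imp_path_connected by blast
  moreover have "openin (top_of_set (realization X)) ?U" by (metis inf_commute open_ball openin_open_Int)
  moreover have "x \<in> ?U" "?U \<subseteq> W" using x e r by auto
  ultimately show "\<exists>U V. openin (top_of_set (realization X)) U \<and> path_connected V \<and> x \<in> U \<and> U \<subseteq> V \<and> V \<subseteq> W"
    by blast
qed

text \<open>Whether the support of a point lies in \<open>A\<close> is locally constant: nearby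
  supports contain that of \<open>x\<close>, and a simplex with one vertex in \<open>A\<close> has
  all of them there. The lemma takes the place of edge paths wherever connectedness is used.\<close>

lemma connected_vertices:
  assumes conn: "connected (realization X)" and AX: "v0 \<in> A" "v0 \<in> verts X"
    and closed: "\<And>v w. \<lbrakk>v \<in> A; {v, w} \<in> X\<rbrakk> \<Longrightarrow> w \<in> A"
  shows "verts X \<subseteq> A"
proof -
  have simplex: "s \<subseteq> A" if "s \<in> X" "v \<in> s" "v \<in> A" for s v
  proof
    fix w assume "w \<in> s"
    then have "{v, w} \<in> X" using face[of s "{v, w}"] that by auto
    then show "w \<in> A" using closed that by blast
  qed
  have "(\<lambda>x. keys x \<subseteq> A) constant_on realization X"
  proof (rule locally_constant_imp_constant[OF conn])
    fix x assume x: "x \<in> realization X"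
    obtain r where r: "r > 0" "\<And>y. dist x y < r \<Longrightarrow> keys x \<subseteq> keys y" using local_star[OF x] by blast
    let ?T = "realization X \<inter> ball x r"
    have "(keys y \<subseteq> A) = (keys x \<subseteq> A)" if "y \<in> ?T" for y
    proof -
      have sub: "keys x \<subseteq> keys y" using that r by simp
      obtain v where v: "v \<in> keys x" using simplexD(2) realizationD(1)[OF x] by blast
      show ?thesis
        using sub v simplex[of "keys y" v] realizationD(1)[of y] that by blast
    qed
    moreover have "openin (top_of_set (realization X)) ?T" by (simp add: openin_open_Int)
    moreover have "x \<in> ?T" using x r by simp
    ultimately show "\<exists>T. openin (top_of_set (realization X)) T \<and> x \<in> T \<and> (\<forall>y\<in>T. (keys y \<subseteq> A) = (keys x \<subseteq> A))"
      by blast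
  qed
  then obtain c where c: "\<And>x. x \<in> realization X \<Longrightarrow> (keys x \<subseteq> A) = c"
    by (auto simp: constant_on_def)
  show ?thesis
  proof
    fix v assume v: "v \<in> verts X"
    show "v \<in> A"
      using c[OF vertex_realization[OF v]] c[OF vertex_realization[OF AX(2)]] AX(1) by simp
  qed
qed

end

section \<open>Simplicial universal coverings\<close>

locale universal_cover = X: complex X + C: complex C
  for X :: "'v set set" and p :: "'v \<Rightarrow> 'w" and C :: "'w set set" +
  assumes simplicial: "simplicial_map X C p"
    and covering: "covering_space (realization X) (realize p) (realization C)"
    and simply_connected: "simply_connected (realization X)"
    and finite_base: "finite C" and nonempty_base: "C \<noteq> {}"
begin

abbreviation G where "G \<equiv> deck_group X p"

lemma p_simplex: "s \<in> X \<Longrightarrow> p ` s \<in> C"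
  using simplicial by (auto simp: simplicial_map_def)

lemma p_vertex: "v \<in> verts X \<Longrightarrow> p v \<in> verts C"
  using p_simplex by blast

lemma p_realization: "x \<in> realization X \<Longrightarrow> realize p x \<in> realization C"
  using covering_space_imp_surjective[OF covering] by blast

lemma keys_p: "x \<in> realization X \<Longrightarrow> keys (realize p x) = p ` keys x"
  by (rule keys_realize) (rule X.realizationD(3))

section \<open>The covering near a vertex\<close>

lemma segment_small:
  fixes x y :: "'a::real_normed_vector"
  assumes T: "openin (top_of_set S) T" and x: "x \<in> T"
    and seg: "\<And>t. \<lbrakk>0 < t; t < 1\<rbrakk> \<Longrightarrow> (1 - t) *\<^sub>R x + t *\<^sub>R y \<in> S"
  shows "\<exists>d>0. \<forall>t. 0 < t \<and> t < d \<longrightarrow> t < 1 \<and> (1 - t) *\<^sub>R x + t *\<^sub>R y \<in> T"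
proof -
  obtain e where e: "e > 0" "ball x e \<inter> S \<subseteq> T" using T x openin_contains_ball[of S T] by auto
  \<comment> \<open>The added 1 keeps the denominator positive when \<open>y = x\<close>.\<close>
  define d where "d = min 1 (e / (norm (y - x) + 1))"
  have "d > 0" using e by (simp add: d_def add_nonneg_pos)
  moreover have "t < 1 \<and> (1 - t) *\<^sub>R x + t *\<^sub>R y \<in> T" if "0 < t" "t < d" for t
  proof -
    have t1: "t < 1" using that by (simp add: d_def)
    have "t * (norm (y - x) + 1) < e"
      using that by (simp add: d_def pos_less_divide_eq add_nonneg_pos)
    then have "t * norm (y - x) < e" using that by (simp add: algebra_simps)
    moreover have "x - ((1 - t) *\<^sub>R x + t *\<^sub>R y) = - (t *\<^sub>R (y - x))" by (simp add: algebra_simps)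
    ultimately have "dist x ((1 - t) *\<^sub>R x + t *\<^sub>R y) < e"
      using that by (simp add: dist_norm)
    then show ?thesis using e seg[of t] that t1 by auto
  qed
  ultimately show ?thesis by blast
qed

lemma simplex_segment:
  assumes "s \<in> X" "v \<in> s" "y \<in> closed_simplex s" "0 < t" "t < 1"
  shows "(1 - t) *\<^sub>R vertex v + t *\<^sub>R y \<in> realization X"
  using closed_simplex_segment[OF vertex_closed_simplex[OF assms(2)] assms(3), of t] assms
  by (intro X.realizationI) auto

text \<open>If two vertices of a simplex had the same image, the segment joining them would be
  collapsed to a point, against local injectivity at \<open>v\<close>.\<close>

lemma p_inj: assumes s: "s \<in> X" shows "inj_on p s"
proof (rule inj_onI, rule ccontr)
  fix v w assume vw: "v \<in> s" "w \<in> s" "p v = p w" "v \<noteq> w"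
  have v: "vertex v \<in> realization X" using s vw X.vertex_realization by blast
  obtain T u q where T: "vertex v \<in> T" "openin (top_of_set (realization X)) T" "homeomorphism T u (realize p) q"
    by (rule covering_space_local_homeomorphism[OF covering v])
  obtain d where d: "d > 0" "\<And>t. \<lbrakk>0 < t; t < d\<rbrakk> \<Longrightarrow> (1 - t) *\<^sub>R vertex v + t *\<^sub>R vertex w \<in> T"
    using segment_small[OF T(2,1) simplex_segment[OF s vw(1) vertex_closed_simplex[OF vw(2)]]] by blast
  define z where "z = (1 - d/2) *\<^sub>R vertex v + (d/2) *\<^sub>R vertex w"
  have z: "z \<in> T" unfolding z_def using d by auto
  have "realize p z = (1 - d/2) *\<^sub>R vertex (p w) + (d/2) *\<^sub>R vertex (p w)"
    using vw by (simp add: z_def realize_add realize_scaleR)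
  also have "\<dots> = realize p (vertex v)" using vw by (simp add: scaleR_add_left[symmetric])
  finally have "z = vertex v" using T z by (metis homeomorphism_apply1)
  then have "lookup z w = 0" using vw by (simp add: lookup_single)
  then show False using d vw by (simp add: z_def lookup_add lookup_single)
qed

text \<open>The segments from \<open>v\<close> to the two barycenters have the same image. Near
  \<open>v\<close>, where the covering is injective, they therefore coincide, and then so do the
  barycenters.\<close>

lemma star_inj:
  assumes s: "s \<in> X" "v \<in> s" and s': "s' \<in> X" "v \<in> s'" and eq: "p ` s = p ` s'"
  shows "s = s'"
proof -
  note f = X.simplexD[OF s(1)] X.simplexD[OF s'(1)]
  have v: "vertex v \<in> realization X" using s X.vertex_realization by blast
  obtain T u q where T: "vertex v \<in> T" "openin (top_of_set (realization X)) T" "homeomorphism T u (realize p) q"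
    by (rule covering_space_local_homeomorphism[OF covering v])
  obtain d where d: "d > 0" "\<And>t. \<lbrakk>0 < t; t < d\<rbrakk> \<Longrightarrow> (1 - t) *\<^sub>R vertex v + t *\<^sub>R barycenter s \<in> T"
    using segment_small[OF T(2,1) simplex_segment[OF s barycenter_closed_simplex[OF f(1,2)]]] by blast
  obtain d' where d': "d' > 0" "\<And>t. \<lbrakk>0 < t; t < d'\<rbrakk> \<Longrightarrow> (1 - t) *\<^sub>R vertex v + t *\<^sub>R barycenter s' \<in> T"
    using segment_small[OF T(2,1) simplex_segment[OF s' barycenter_closed_simplex[OF f(3,4)]]] by blast
  define t where "t = min d d' / 2"
  have t: "0 < t" "t < d" "t < d'" using d d' by (auto simp: t_def)
  have "realize p (barycenter s) = realize p (barycenter s')"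
    using f p_inj s s' eq by (simp add: realize_barycenter)
  then have "realize p ((1 - t) *\<^sub>R vertex v + t *\<^sub>R barycenter s) = realize p ((1 - t) *\<^sub>R vertex v + t *\<^sub>R barycenter s')"
    by (simp add: realize_add realize_scaleR)
  then have "(1 - t) *\<^sub>R vertex v + t *\<^sub>R barycenter s = (1 - t) *\<^sub>R vertex v + t *\<^sub>R barycenter s'"
    using d(2)[OF t(1,2)] d'(2)[OF t(1,3)] T(3) by (metis homeomorphism_apply1)
  then have "barycenter s = barycenter s'" using t by simp
  then show ?thesis using keys_barycenter f by metis
qed

text \<open>The covering is open, so points in the interior of \<open>c\<close> close to
  \<open>p v\<close> lift to points close to \<open>v\<close>. Such a lift has \<open>v\<close> in
  its support, and its support maps onto \<open>c\<close>.\<close>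

lemma star_lift:
  assumes v: "v \<in> verts X" and c: "c \<in> C" "p v \<in> c"
  shows "\<exists>s\<in>X. v \<in> s \<and> p ` s = c"
proof -
  note f = C.simplexD[OF c(1)]
  have vX: "vertex v \<in> realization X" using v X.vertex_realization by blast
  obtain r where r: "r > 0" "\<And>y. dist (vertex v) y < r \<Longrightarrow> keys (vertex v) \<subseteq> keys y"
    using X.local_star[OF vX] by blast
  let ?W = "realization X \<inter> ball (vertex v) r"
  have "openin (top_of_set (realization X)) ?W" by (simp add: openin_open_Int)
  then have op: "openin (top_of_set (realization C)) (realize p ` ?W)"
    by (rule covering_space_open_map[OF covering])
  have "vertex v \<in> ?W" using vX r by simp
  then have pv: "vertex (p v) \<in> realize p ` ?W" by (metis imageI realize_single)
  have "\<exists>d>0. \<forall>t. 0 < t \<and> t < d \<longrightarrow> t < 1 \<and> (1 - t) *\<^sub>R vertex (p v) + t *\<^sub>R barycenter c \<in> realize p ` ?W"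
  proof (rule segment_small[OF op pv])
    show "(1 - t) *\<^sub>R vertex (p v) + t *\<^sub>R barycenter c \<in> realization C" if "0 < t" "t < 1" for t
      using closed_simplex_segment[OF vertex_closed_simplex[OF c(2)] barycenter_closed_simplex[OF f], of t] that c
      by (intro C.realizationI) auto
  qed
  then obtain d where d: "d > 0" "\<And>t. \<lbrakk>0 < t; t < d\<rbrakk> \<Longrightarrow> t < 1 \<and> (1 - t) *\<^sub>R vertex (p v) + t *\<^sub>R barycenter c \<in> realize p ` ?W"
    by blast
  define t where "t = d/2"
  have t: "0 < t" "t < 1" "(1 - t) *\<^sub>R vertex (p v) + t *\<^sub>R barycenter c \<in> realize p ` ?W"
    using d(1) d(2)[of t] by (auto simp: t_def)
  then obtain y where y: "y \<in> ?W" "realize p y = (1 - t) *\<^sub>R vertex (p v) + t *\<^sub>R barycenter c"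
    by (metis imageE)
  have "keys (realize p y) = c"
  proof -
    have "lookup (realize p y) w = (1 - t) * (if p v = w then 1 else 0) + t * (if w \<in> c then 1 / card c else 0)" for w
      using f by (simp add: y lookup_add lookup_single when_def lookup_barycenter)
    moreover have "card c > 0" using f by (simp add: card_gt_0_iff)
    ultimately show ?thesis using t c by (auto simp: in_keys_iff split: if_splits) (smt (verit) divide_pos_pos mult_pos_pos of_nat_0_less_iff)
  qed
  moreover have "keys (realize p y) = p ` keys y" using keys_p[of y] y(1) by blast
  ultimately have "p ` keys y = c" by simp
  moreover have "v \<in> keys y" using r(2)[of y] y by simp
  ultimately show ?thesis using X.realizationD(1) y by blast
qed

lemma simplex_lift: "c \<in> C \<Longrightarrow> \<exists>s\<in>X. p ` s = c"
proof -
  assume c: "c \<in> C"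
  note f = C.simplexD[OF c]
  have "barycenter c \<in> realization C" using C.realizationI[OF c barycenter_closed_simplex[OF f]] .
  then obtain y where y: "y \<in> realization X" "realize p y = barycenter c"
    using covering_space_imp_surjective[OF covering] by (metis imageE)
  then have "p ` keys y = c" using keys_p[OF y(1)] keys_barycenter[OF f] by simp
  then show ?thesis using X.realizationD(1) y by blast
qed

lemma image_verts: "p ` verts X = verts C"
proof
  show "p ` verts X \<subseteq> verts C" using p_vertex by blast
  show "verts C \<subseteq> p ` verts X"
  proof
    fix c assume "c \<in> verts C"
    then obtain s where "s \<in> X" "c \<in> p ` s" using simplex_lift by (metis UnionE)
    then show "c \<in> p ` verts X" by blast
  qed
qed

lemma connected_X: "connected (realization X)"
  using simply_connected simply_connected_imp_connected by blast

section \<open>Lifts of the covering map through itself\<close>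

lemma lift_unique:
  assumes "continuous_on (realization X) f" "f \<in> realization X \<rightarrow> realization X"
    and "continuous_on (realization X) g" "g \<in> realization X \<rightarrow> realization X"
    and "\<And>x. x \<in> realization X \<Longrightarrow> realize p (f x) = realize p x"
    and "\<And>x. x \<in> realization X \<Longrightarrow> realize p (g x) = realize p x"
    and "a \<in> realization X" "f a = g a" "x \<in> realization X"
  shows "f x = g x"
proof (rule covering_space_lift_unique[where p = "realize p" and c = "realization X" and ?g1.0 = f and ?g2.0 = g
      and f = "realize p" and T = "realization X" and a = a])
  show "realize p \<in> realization X \<rightarrow> realization C" using p_realization by blast
qed (fact covering assms continuous_on_realize connected_X assms(5,6)[symmetric])+

text \<open>A point over a vertex has its whole support over that vertex, and \<open>p\<close> is
  injective on simplices.\<close>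

lemma vertex_lift:
  assumes y: "y \<in> realization X" and "realize p y = vertex c"
  shows "\<exists>w\<in>verts X. y = vertex w \<and> p w = c"
proof -
  have k: "p ` keys y = {c}" using keys_p[OF y] assms by simp
  have kX: "keys y \<in> X" using X.realizationD(1)[OF y] .
  obtain w where w: "w \<in> keys y" using X.simplexD(2)[OF kX] by blast
  have pc: "p z = c" if "z \<in> keys y" for z using k that by blast
  have ky: "keys y = {w}" using p_inj[OF kX] pc w by (auto dest: inj_onD)
  have "(\<Sum>v\<in>keys y. lookup y v) = 1"
    using X.realizationD(2)[OF y] closed_simplex_iff[of "keys y" y] by simp
  then have "lookup y w = 1" using ky by simp
  then have "y = vertex w"
    using ky by (intro poly_mapping_eqI) (auto simp: lookup_single when_def in_keys_iff)
  then show ?thesis using pc w kX by blast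
qed

text \<open>On a simplex \<open>s\<close> the lift agrees at one vertex \<open>v\<close> with a
  simplicial lift through the star of \<open>g v\<close>. Simplices are connected, so uniqueness of
  lifts makes the two equal on all of \<open>s\<close>.\<close>

lemma lift_simplicial:
  assumes cont: "continuous_on (realization X) \<rho>" and into: "\<rho> \<in> realization X \<rightarrow> realization X"
    and over: "\<And>x. x \<in> realization X \<Longrightarrow> realize p (\<rho> x) = realize p x"
  shows "\<exists>g. (\<forall>x\<in>realization X. \<rho> x = realize g x) \<and> (\<forall>s\<in>X. g ` s \<in> X) \<and> (\<forall>v\<in>verts X. p (g v) = p v)"
proof -
  have "\<exists>w. w \<in> verts X \<and> \<rho> (vertex v) = vertex w \<and> p w = p v" if "v \<in> verts X" for v
  proof -
    have r: "\<rho> (vertex v) \<in> realization X" using into X.vertex_realization[OF that] by blast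
    have "realize p (\<rho> (vertex v)) = vertex (p v)" using over[OF X.vertex_realization[OF that]] by simp
    from vertex_lift[OF r this] show ?thesis by blast
  qed
  then obtain g where g: "\<And>v. v \<in> verts X \<Longrightarrow> g v \<in> verts X \<and> \<rho> (vertex v) = vertex (g v) \<and> p (g v) = p v"
    by metis
  have simp: "g ` s \<in> X \<and> (\<forall>x\<in>closed_simplex s. \<rho> x = realize g x)" if s: "s \<in> X" for s
  proof -
    obtain v where v: "v \<in> s" using X.simplexD(2)[OF s] by blast
    have vX: "v \<in> verts X" using v s by blast
    obtain s' where s': "s' \<in> X" "g v \<in> s'" "p ` s' = p ` s"
      using star_lift[of "g v" "p ` s"] g[OF vX] p_simplex[OF s] v by auto
    \<comment> \<open>The simplicial candidate: \<open>p\<close> down to the base, then back up by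
      the inverse of \<open>p\<close> on \<open>s'\<close>.\<close>
    define f where "f w = inv_into s' p (p w)" for w
    have f: "f w \<in> s'" "p (f w) = p w" if "w \<in> s" for w
      using that s'(3) inv_into_into[of "p w" p s'] f_inv_into_f[of "p w" p s'] by (auto simp: f_def)
    have fv: "f v = g v" using inv_into_f_f[OF p_inj[OF s'(1)] s'(2)] g[OF vX] by (simp add: f_def)
    have sub: "closed_simplex s \<subseteq> realization X" using X.realizationI[OF s] by blast
    have pf: "realize p (realize f x) = realize p x" if "x \<in> closed_simplex s" for x
      unfolding realize_realize
      using that f(2) closed_simplex_iff[OF X.simplexD(1)[OF s], of x] by (intro realize_cong) blast
    have fX: "realize f x \<in> realization X" if "x \<in> closed_simplex s" for x
    proof -
      have "realize f x \<in> closed_simplex (f ` s)" using that realize_closed_simplex by blast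
      then have "realize f x \<in> closed_simplex s'" using closed_simplex_mono[of "f ` s" s'] f(1) by blast
      then show ?thesis using X.realizationI s' by blast
    qed
    have eq: "\<rho> x = realize f x" if x: "x \<in> closed_simplex s" for x
    proof (rule covering_space_lift_unique[OF covering, where ?g1.0 = \<rho> and a = "vertex v" and ?g2.0 = "realize f"
          and T = "closed_simplex s" and f = "realize p"])
      show "\<rho> (vertex v) = realize f (vertex v)" using g[OF vX] fv by simp
      show "continuous_on (closed_simplex s) \<rho>" using cont sub continuous_on_subset by blast
      show "connected (closed_simplex s)" using convex_closed_simplex convex_connected by blast
      show "realize p \<in> closed_simplex s \<rightarrow> realization C" using p_realization sub by blast
      show "\<rho> \<in> closed_simplex s \<rightarrow> realization X" using into sub by blast
      show "realize f \<in> closed_simplex s \<rightarrow> realization X" using fX by blast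
      show "vertex v \<in> closed_simplex s" using vertex_closed_simplex[OF v] .
    qed (use over sub pf x in \<open>auto intro: continuous_on_realize\<close>)
    have fg: "f w = g w" if w: "w \<in> s" for w
    proof -
      have wX: "w \<in> verts X" using w s by blast
      have "vertex (g w) = vertex (f w)"
        using eq[OF vertex_closed_simplex[OF w]] g[OF wX] by simp
      then have "keys (vertex (g w)) = keys (vertex (f w))" by simp
      then show ?thesis by simp
    qed
    then have "g ` s = f ` s" by simp
    moreover have "f ` s \<in> X" using X.face[OF s'(1), of "f ` s"] f(1) v by blast
    moreover have "\<rho> x = realize g x" if x: "x \<in> closed_simplex s" for x
    proof -
      have "realize f x = realize g x"
        using fg closed_simplex_iff[OF X.simplexD(1)[OF s], of x] x by (intro realize_cong) blast
      then show ?thesis using eq[OF x] by simp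
    qed
    ultimately show ?thesis by simp
  qed
  show ?thesis
    by (rule exI[of _ g]) (use simp g in \<open>auto simp: realization_def\<close>)
qed

lemma lift_through:
  assumes "x \<in> realization X" "y \<in> realization X" "realize p x = realize p y"
  obtains \<rho> where "continuous_on (realization X) \<rho>" "\<rho> \<in> realization X \<rightarrow> realization X" "\<rho> x = y"
    "\<And>z. z \<in> realization X \<Longrightarrow> realize p (\<rho> z) = realize p z"
  using covering_space_lift_strong[OF covering assms(2,1) simply_connected
      X.locally_path_connected_realization continuous_on_realize _ assms(3)] p_realization that by blast

section \<open>The deck group is free, and transitive on fibres\<close>

lemma deck_carrier:
  "g \<in> carrier G \<longleftrightarrow> g \<in> Bij (verts X) \<and> simplicial_iso X X g \<and> (\<forall>v\<in>verts X. p (g v) = p v)"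
  by (simp add: deck_group_def)

lemma deckI:
  assumes g: "\<And>s. s \<in> X \<Longrightarrow> g ` s \<in> X" "\<And>v. v \<in> verts X \<Longrightarrow> p (g v) = p v"
    and h: "\<And>s. s \<in> X \<Longrightarrow> h ` s \<in> X"
    and gh: "\<And>v. v \<in> verts X \<Longrightarrow> g (h v) = v" "\<And>v. v \<in> verts X \<Longrightarrow> h (g v) = v"
  shows "restrict g (verts X) \<in> carrier G"
proof -
  have gv: "g v \<in> verts X" and hv: "h v \<in> verts X" if "v \<in> verts X" for v
    using g(1)[OF X.vertex_simplex[OF that]] h[OF X.vertex_simplex[OF that]] by auto
  have bij: "bij_betw g (verts X) (verts X)"
    by (rule bij_betw_byWitness[where f' = h]) (use gh gv hv in blast)+
  have img: "restrict g (verts X) ` s = g ` s" if "s \<subseteq> verts X" for s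
    using that by (intro image_cong) (simp_all add: subset_iff)
  have "g ` s \<in> X \<longleftrightarrow> s \<in> X" if s: "s \<subseteq> verts X" for s
  proof
    assume "g ` s \<in> X"
    then have "h ` g ` s \<in> X" by (rule h)
    moreover have "h (g v) = v" if "v \<in> s" for v using gh(2) s that by blast
    then have "h ` g ` s = s" by (simp add: image_image)
    ultimately show "s \<in> X" by simp
  qed (rule g(1))
  then have "simplicial_iso X X (restrict g (verts X))"
    using bij img by (simp add: simplicial_iso_def bij_betw_restrict_eq)
  moreover have "restrict g (verts X) \<in> Bij (verts X)"
    using bij by (simp add: Bij_def bij_betw_restrict_eq)
  ultimately show ?thesis using g(2) by (simp add: deck_carrier)
qed

lemma deck_apply:
  assumes "g \<in> carrier G"
  shows "v \<in> verts X \<Longrightarrow> g v \<in> verts X" "v \<in> verts X \<Longrightarrow> p (g v) = p v" "s \<in> X \<Longrightarrow> g ` s \<in> X"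
    "inj_on g (verts X)"
proof -
  have g: "bij_betw g (verts X) (verts X)" "simplicial_iso X X g" "\<forall>v\<in>verts X. p (g v) = p v"
    using assms by (auto simp: deck_carrier Bij_def)
  show "v \<in> verts X \<Longrightarrow> g v \<in> verts X" using bij_betw_apply[OF g(1)] .
  show "v \<in> verts X \<Longrightarrow> p (g v) = p v" using g(3) by blast
  show "s \<in> X \<Longrightarrow> g ` s \<in> X" using g(2) Sup_upper[of s X] by (auto simp: simplicial_iso_def)
  show "inj_on g (verts X)" using g(1) by (rule bij_betw_imp_inj_on)
qed

lemma deck_mult: "\<lbrakk>g \<in> carrier G; h \<in> carrier G; v \<in> verts X\<rbrakk> \<Longrightarrow> (g \<otimes>\<^bsub>G\<^esub> h) v = g (h v)"
  by (simp add: deck_carrier) (simp add: deck_group_def BijGroup_def compose_def)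

lemma deck_one: "v \<in> verts X \<Longrightarrow> \<one>\<^bsub>G\<^esub> v = v"
  by (simp add: deck_group_def BijGroup_def)

lemma deck_eqI:
  assumes "g \<in> carrier G" "h \<in> carrier G" "\<And>v. v \<in> verts X \<Longrightarrow> g v = h v" shows "g = h"
  using assms by (intro extensionalityI[of g "verts X" h]) (auto simp: deck_carrier Bij_def)

lemma subgroup_deck: "subgroup (carrier G) (BijGroup (verts X))"
proof -
  let ?B = "BijGroup (verts X)"
  interpret B: group ?B by (rule group_BijGroup)
  have id: "restrict (\<lambda>v. v) (verts X) \<in> carrier G" by (rule deckI[where h = "\<lambda>v. v"]) auto
  show ?thesis
  proof (rule B.subgroupI)
    show "carrier G \<subseteq> carrier ?B" by (auto simp: deck_carrier BijGroup_def)
    show "carrier G \<noteq> {}" using id by blast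
  next
    fix g assume g: "g \<in> carrier G"
    let ?h = "inv_into (verts X) g"
    have gB: "g \<in> Bij (verts X)" and iso: "simplicial_iso X X g" using g by (auto simp: deck_carrier)
    then have bij: "bij_betw g (verts X) (verts X)" by (simp add: Bij_def)
    have hg: "?h (g v) = v" "g (?h v) = v" "?h v \<in> verts X" if "v \<in> verts X" for v
      using bij_betw_inv_into_left[OF bij that] bij_betw_inv_into_right[OF bij that]
        bij_betw_apply[OF bij_betw_inv_into[OF bij] that] by auto
    have hX: "?h ` s \<in> X" if s: "s \<in> X" for s
    proof -
      have "?h ` s \<subseteq> verts X" using hg(3) s by blast
      moreover have "g (?h v) = v" if "v \<in> s" for v using hg(2) s that by blast
      then have "g ` ?h ` s = s" by (simp add: image_image)
      ultimately show ?thesis using iso s unfolding simplicial_iso_def by metis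
    qed
    have "restrict ?h (verts X) \<in> carrier G"
    proof (rule deckI[where h = g])
      show "p (?h v) = p v" if "v \<in> verts X" for v
        using deck_apply(2)[OF g hg(3)[OF that]] hg(2)[OF that] by simp
    qed (fact hX deck_apply(3)[OF g] hg(1,2))+
    moreover have "inv\<^bsub>?B\<^esub> g = restrict ?h (verts X)" using gB by (rule inv_BijGroup)
    ultimately show "inv\<^bsub>?B\<^esub> g \<in> carrier G" by simp
  next
    fix g h assume g: "g \<in> carrier G" and h: "h \<in> carrier G"
    have "g \<otimes>\<^bsub>?B\<^esub> h = compose (verts X) g h" using g h by (simp add: deck_carrier BijGroup_def)
    moreover have "compose (verts X) g h \<in> Bij (verts X)"
      using g h by (intro compose_Bij) (auto simp: deck_carrier)
    moreover have "simplicial_iso X X (compose (verts X) g h)"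
      unfolding simplicial_iso_def
    proof (intro conjI allI impI)
      show "bij_betw (compose (verts X) g h) (verts X) (verts X)"
        using \<open>compose (verts X) g h \<in> Bij (verts X)\<close> by (simp add: Bij_def)
      fix s assume s: "s \<subseteq> verts X"
      have "compose (verts X) g h ` s = g ` h ` s"
        unfolding image_image using s by (intro image_cong) (simp_all add: compose_def subset_iff)
      moreover have "h ` s \<subseteq> verts X" using s deck_apply(1)[OF h] by blast
      ultimately show "compose (verts X) g h ` s \<in> X \<longleftrightarrow> s \<in> X"
        using g h s by (simp add: deck_carrier simplicial_iso_def)
    qed
    ultimately show "g \<otimes>\<^bsub>?B\<^esub> h \<in> carrier G"
      using deck_apply(1,2)[OF h] deck_apply(2)[OF g] by (simp add: deck_carrier compose_def)
  qed
qed

lemma group_deck: "group G"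
  using group.subgroup_imp_group[OF group_BijGroup subgroup_deck] by (simp add: deck_group_def)

sublocale deck: group "deck_group X p" by (rule group_deck)

lemma realize_deck:
  assumes "g \<in> carrier G" "x \<in> realization X"
  shows "realize g x \<in> realization X" "realize p (realize g x) = realize p x"
proof -
  have k: "keys x \<in> X" using X.realizationD(1) assms by blast
  have "realize g x \<in> closed_simplex (g ` keys x)"
    using X.realizationD(2)[OF assms(2)] realize_closed_simplex by blast
  then show "realize g x \<in> realization X" using X.realizationI deck_apply(3)[OF assms(1) k] by blast
  have "p (g v) = p v" if "v \<in> keys x" for v
    using deck_apply(2)[OF assms(1)] that k by blast
  then show "realize p (realize g x) = realize p x" by (simp add: realize_realize cong: realize_cong)
qed

lemma realize_deck_mult:
  assumes "g \<in> carrier G" "h \<in> carrier G" "x \<in> realization X"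
  shows "realize (g \<otimes>\<^bsub>G\<^esub> h) x = realize g (realize h x)"
  unfolding realize_realize
  using deck_mult[OF assms(1,2)] X.realizationD(1)[OF assms(3)] by (intro realize_cong) blast

text \<open>A deck transformation and the identity are both lifts of the covering map; agreeing at
  \<open>x\<close>, they agree everywhere.\<close>

lemma deck_free:
  assumes g: "g \<in> carrier G" and x: "x \<in> realization X" "realize g x = x"
  shows "g = \<one>\<^bsub>G\<^esub>"
proof (rule deck_eqI[OF g deck.one_closed])
  fix v assume v: "v \<in> verts X"
  have "realize g (vertex v) = vertex v"
    by (rule lift_unique[of "realize g" "\<lambda>x. x" x])
      (use x realize_deck[OF g] X.vertex_realization[OF v] in \<open>auto intro: continuous_on_realize\<close>)
  then have "keys (vertex (g v)) = keys (vertex v)" by simp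
  then show "g v = \<one>\<^bsub>G\<^esub> v" using v by (simp add: deck_one)
qed

text \<open>Simple connectedness yields lifts taking \<open>x\<close> to \<open>y\<close> and
  \<open>y\<close> to \<open>x\<close>. Uniqueness makes them mutually inverse, and both are
  simplicial by \<open>lift_simplicial\<close>.\<close>

lemma deck_transitive:
  assumes x: "x \<in> realization X" and y: "y \<in> realization X" and eq: "realize p x = realize p y"
  shows "\<exists>g\<in>carrier G. realize g x = y"
proof -
  obtain \<rho> where \<rho>: "continuous_on (realization X) \<rho>" "\<rho> \<in> realization X \<rightarrow> realization X" "\<rho> x = y"
    "\<And>z. z \<in> realization X \<Longrightarrow> realize p (\<rho> z) = realize p z"
    by (rule lift_through[OF x y eq]) blast
  obtain \<rho>' where \<rho>': "continuous_on (realization X) \<rho>'" "\<rho>' \<in> realization X \<rightarrow> realization X" "\<rho>' y = x"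
    "\<And>z. z \<in> realization X \<Longrightarrow> realize p (\<rho>' z) = realize p z"
    by (rule lift_through[OF y x eq[symmetric]]) blast
  obtain g where "(\<forall>z\<in>realization X. \<rho> z = realize g z) \<and> (\<forall>s\<in>X. g ` s \<in> X) \<and> (\<forall>v\<in>verts X. p (g v) = p v)"
    using lift_simplicial[OF \<rho>(1,2,4)] ..
  then have g: "\<And>z. z \<in> realization X \<Longrightarrow> \<rho> z = realize g z" "\<And>s. s \<in> X \<Longrightarrow> g ` s \<in> X"
    "\<And>v. v \<in> verts X \<Longrightarrow> p (g v) = p v" by blast+
  obtain h where "(\<forall>z\<in>realization X. \<rho>' z = realize h z) \<and> (\<forall>s\<in>X. h ` s \<in> X) \<and> (\<forall>v\<in>verts X. p (h v) = p v)"
    using lift_simplicial[OF \<rho>'(1,2,4)] ..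
  then have h: "\<And>z. z \<in> realization X \<Longrightarrow> \<rho>' z = realize h z" "\<And>s. s \<in> X \<Longrightarrow> h ` s \<in> X"
    by blast+
  have into: "\<rho> z \<in> realization X" "\<rho>' z \<in> realization X" if "z \<in> realization X" for z
    using \<rho>(2) \<rho>'(2) that by auto
  have comp: "continuous_on (realization X) (\<lambda>z. \<rho>' (\<rho> z))" "continuous_on (realization X) (\<lambda>z. \<rho> (\<rho>' z))"
    using \<rho>(1,2) \<rho>'(1,2) by (auto intro: continuous_on_compose2)
  have 1: "\<rho>' (\<rho> z) = z" if "z \<in> realization X" for z
    by (rule lift_unique[of "\<lambda>z. \<rho>' (\<rho> z)" "\<lambda>z. z" x])
      (use comp into \<rho> \<rho>' x that in auto)
  have 2: "\<rho> (\<rho>' z) = z" if "z \<in> realization X" for z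
    by (rule lift_unique[of "\<lambda>z. \<rho> (\<rho>' z)" "\<lambda>z. z" y])
      (use comp into \<rho> \<rho>' y that in auto)
  have vert: "g v \<in> verts X" "h v \<in> verts X" if "v \<in> verts X" for v
    using g(2)[OF X.vertex_simplex[OF that]] h(2)[OF X.vertex_simplex[OF that]] by auto
  have single_inj: "v = w" if "vertex v = vertex w" for v w :: 'v
  proof -
    have "keys (vertex v) = keys (vertex w)" using that by simp
    then show ?thesis by simp
  qed
  \<comment> \<open>Members of \<open>Bij\<close> are extensional, so the vertex map is cut off
    outside the vertices.\<close>
  have "restrict g (verts X) \<in> carrier G"
  proof (rule deckI[OF g(2,3) h(2)])
    show "g (h v) = v" if v: "v \<in> verts X" for v
      using 2[OF X.vertex_realization[OF v]] g(1)[OF X.vertex_realization[OF vert(2)[OF v]]]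
        h(1)[OF X.vertex_realization[OF v]] by (intro single_inj) simp
    show "h (g v) = v" if v: "v \<in> verts X" for v
      using 1[OF X.vertex_realization[OF v]] h(1)[OF X.vertex_realization[OF vert(1)[OF v]]]
        g(1)[OF X.vertex_realization[OF v]] by (intro single_inj) simp
  qed
  moreover have "realize (restrict g (verts X)) x = realize g x"
    using X.realizationD(1)[OF x] by (intro realize_cong) auto
  then have "realize (restrict g (verts X)) x = y" using \<rho>(3) g(1)[OF x] by simp
  ultimately show ?thesis by blast
qed

lemma deck_transitive_vertex:
  assumes "v \<in> verts X" "w \<in> verts X" "p v = p w"
  shows "\<exists>g\<in>carrier G. g v = w"
proof -
  obtain g where g: "g \<in> carrier G" "realize g (vertex v) = vertex w"
    using deck_transitive[OF X.vertex_realization X.vertex_realization, of v w] assms by auto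
  then have "keys (vertex (g v)) = keys (vertex w)" by simp
  then show ?thesis using g by auto
qed

text \<open>Matching one vertex suffices: two simplices with a common vertex and the same image are
  equal.\<close>

lemma deck_transitive_simplex:
  assumes s: "s \<in> X" and s': "s' \<in> X" and eq: "p ` s = p ` s'"
  shows "\<exists>g\<in>carrier G. g ` s = s'"
proof -
  obtain v where v: "v \<in> s" using X.simplexD(2)[OF s] by blast
  then obtain v' where v': "v' \<in> s'" "p v' = p v" using eq by (metis imageE imageI)
  obtain g where g: "g \<in> carrier G" "g v = v'"
    using deck_transitive_vertex[of v v'] v v' s s' by auto
  have "p (g w) = p w" if "w \<in> s" for w using deck_apply(2)[OF g(1)] that s by blast
  then have "p ` g ` s = p ` s'" using eq by (simp add: image_image)
  then have "g ` s = s'" using star_inj[of "g ` s" v' s'] deck_apply(3)[OF g(1) s] s' v v' g(2) by blast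
  then show ?thesis using g by blast
qed

lemma deck_free_vertex: "\<lbrakk>g \<in> carrier G; v \<in> verts X; g v = v\<rbrakk> \<Longrightarrow> g = \<one>\<^bsub>G\<^esub>"
  using deck_free[OF _ X.vertex_realization] by simp

text \<open>A simplex mapped to itself is fixed vertex by vertex, because \<open>p\<close>
  distinguishes its vertices.\<close>

lemma deck_free_simplex:
  assumes g: "g \<in> carrier G" and s: "s \<in> X" "g ` s = s"
  shows "g = \<one>\<^bsub>G\<^esub>"
proof -
  obtain v where v: "v \<in> s" using X.simplexD(2)[OF s(1)] by blast
  then have "g v \<in> s" using s(2) by blast
  moreover have "p (g v) = p v" using deck_apply(2)[OF g] v s by blast
  ultimately have "g v = v" using p_inj[OF s(1)] v by (auto dest: inj_onD)
  then show ?thesis using deck_free_vertex[OF g] v s by blast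
qed

section \<open>Finite generation of the deck group\<close>

lemma edge_neighbours_finite:
  assumes v: "v \<in> verts X" shows "finite {w. {v, w} \<in> X}"
proof (rule inj_on_finite)
  show "inj_on p {w. {v, w} \<in> X}"
  proof (rule inj_onI)
    fix w w' assume w: "w \<in> {w. {v, w} \<in> X}" "w' \<in> {w. {v, w} \<in> X}" "p w = p w'"
    then have "{v, w} = {v, w'}" using star_inj[of "{v, w}" v "{v, w'}"] by auto
    then show "w = w'" by (metis doubleton_eq_iff)
  qed
  show "p ` {w. {v, w} \<in> X} \<subseteq> verts C"
  proof (rule image_subsetI)
    fix w assume "w \<in> {w. {v, w} \<in> X}"
    then have "w \<in> verts X" by blast
    then show "p w \<in> verts C" by (rule p_vertex)
  qed
  show "finite (verts C)" by (rule finite_Union[OF finite_base C.simplexD(1)])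
qed

text \<open>The classical argument with a finite set \<open>V\<close> of orbit representatives of
  vertices. The elements that move some member of \<open>V\<close> to a vertex equal or adjacent to
  a member of \<open>V\<close> generate: the translates of \<open>V\<close> under the subgroup they
  generate are closed under passing to neighbours, and the complex is connected.\<close>

lemma deck_finitely_generated: "\<exists>S. finite S \<and> S \<subseteq> carrier G \<and> generate G S = carrier G"
proof -
  define r where "r c = (SOME v. v \<in> verts X \<and> p v = c)" for c
  have r: "r c \<in> verts X \<and> p (r c) = c" if "c \<in> verts C" for c
    unfolding r_def by (rule someI_ex) (use image_verts that in \<open>metis imageE\<close>)
  define V where "V = r ` verts C"
  have V: "finite V" "V \<subseteq> verts X"
    unfolding V_def using finite_Union[OF finite_base C.simplexD(1)] r by blast+
  have V_inj: "v = w" if vw: "v \<in> V" "w \<in> V" "p v = p w" for v w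
  proof -
    obtain c d where "c \<in> verts C" "v = r c" "d \<in> verts C" "w = r d"
      using vw(1,2) unfolding V_def by blast
    then show ?thesis using r vw(3) by metis
  qed
  \<comment> \<open>Finite because every vertex has finitely many neighbours and, by freeness,
    \<open>g\<close> is known from \<open>g w\<close>.\<close>
  define S where "S = {g \<in> carrier G. \<exists>v\<in>V. \<exists>w\<in>V. {v, g w} \<in> X}"
  have "finite S"
  proof -
    have sub: "S \<subseteq> (\<Union>v\<in>V. \<Union>w\<in>V. \<Union>z\<in>{z. {v, z} \<in> X}. {g \<in> carrier G. g w = z})"
      by (auto simp: S_def)
    have single: "finite {g \<in> carrier G. g w = z}" if w: "w \<in> V" for w z
    proof -
      have eq: "g = h" if "g \<in> carrier G" "h \<in> carrier G" "g w = h w" for g h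
      proof -
        have wX: "w \<in> verts X" using w V by blast
        have "(inv\<^bsub>G\<^esub> h \<otimes>\<^bsub>G\<^esub> g) w = (inv\<^bsub>G\<^esub> h \<otimes>\<^bsub>G\<^esub> h) w"
          using that wX by (simp only: deck_mult deck.inv_closed)
        also have "\<dots> = w" using that(2) deck_one[OF wX] by simp
        finally have "inv\<^bsub>G\<^esub> h \<otimes>\<^bsub>G\<^esub> g = \<one>\<^bsub>G\<^esub>"
          using deck_free_vertex[OF _ wX] that by simp
        then show "g = h" using that by (metis deck.inv_closed deck.inv_equality deck.inv_inv)
      qed
      show ?thesis
      proof (cases "{g \<in> carrier G. g w = z} = {}")
        case False
        then obtain h where "h \<in> carrier G" "h w = z" by blast
        then have "{g \<in> carrier G. g w = z} \<subseteq> {h}" using eq by blast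
        then show ?thesis by (rule finite_subset) simp
      qed (simp only: finite.emptyI)
    qed
    moreover have "finite (\<Union>v\<in>V. \<Union>w\<in>V. \<Union>z\<in>{z. {v, z} \<in> X}. {g \<in> carrier G. g w = z})"
    proof (intro finite_UN_I V(1))
      fix v w z assume "v \<in> V" and w: "w \<in> V"
      then have "v \<in> verts X" using V(2) by blast
      then show "finite {z. {v, z} \<in> X}" by (rule edge_neighbours_finite)
      show "finite {g \<in> carrier G. g w = z}" by (rule single[OF w])
    qed
    ultimately show ?thesis using finite_subset[OF sub] by blast
  qed
  have SG: "S \<subseteq> carrier G" by (auto simp: S_def)
  let ?H = "generate G S"
  have HG: "?H \<subseteq> carrier G" using deck.generate_in_carrier[OF SG] by blast
  define A where "A = {h v |h v. h \<in> ?H \<and> v \<in> V}"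
  have V_orbit: "\<exists>g\<in>carrier G. \<exists>v\<in>V. w = g v" if w: "w \<in> verts X" for w
  proof -
    obtain g where "g \<in> carrier G" "g (r (p w)) = w"
      using deck_transitive_vertex[of "r (p w)" w] r[OF p_vertex[OF w]] w by blast
    moreover have "r (p w) \<in> V" unfolding V_def using p_vertex[OF w] by blast
    ultimately show ?thesis by metis
  qed
  have "verts C \<noteq> {}" using nonempty_base C.simplexD(2) by blast
  then obtain v0 where v0: "v0 \<in> V" unfolding V_def by blast
  have XA: "verts X \<subseteq> A"
  proof (rule X.connected_vertices[OF connected_X])
    have "\<one>\<^bsub>G\<^esub> v0 = v0" using deck_one v0 V by blast
    then show "v0 \<in> A" unfolding A_def
      using v0 generate.one[of G S] by (intro CollectI exI[of _ "\<one>\<^bsub>G\<^esub>"] exI[of _ v0]) simp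
    show "v0 \<in> verts X" using v0 V by blast
    fix a w assume "a \<in> A" and e: "{a, w} \<in> X"
    then obtain h v where h: "h \<in> ?H" "v \<in> V" "a = h v" by (auto simp: A_def)
    have hG: "h \<in> carrier G" using h HG by blast
    have w: "w \<in> verts X" using e by blast
    have vX: "v \<in> verts X" using h V by blast
    obtain g u where g: "g \<in> carrier G" "u \<in> V" "w = g u" using V_orbit[OF w] by blast
    have uX: "u \<in> verts X" using g V by blast
    \<comment> \<open>Moved by \<open>inv h\<close>, the edge starts in \<open>V\<close>; so
      \<open>?k\<close> is a generator, and \<open>g\<close> is \<open>h\<close> times
      \<open>?k\<close>.\<close>
    let ?k = "inv\<^bsub>G\<^esub> h \<otimes>\<^bsub>G\<^esub> g"
    have "(inv\<^bsub>G\<^esub> h) ` {a, w} \<in> X" using deck_apply(3)[OF deck.inv_closed[OF hG] e] .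
    moreover have "(inv\<^bsub>G\<^esub> h) a = v"
      using deck_mult[OF deck.inv_closed[OF hG] hG vX] h hG vX by (simp add: deck_one)
    moreover have "(inv\<^bsub>G\<^esub> h) w = ?k u"
      using deck_mult[OF deck.inv_closed[OF hG] g(1) uX] g by simp
    ultimately have "{v, ?k u} \<in> X" by simp
    then have kS: "?k \<in> S" unfolding S_def using h g hG by auto
    have "h \<otimes>\<^bsub>G\<^esub> ?k \<in> ?H" using generate.eng[OF h(1) generate.incl[OF kS]] .
    moreover have "h \<otimes>\<^bsub>G\<^esub> ?k = g" using hG g by (simp add: deck.m_assoc[symmetric])
    ultimately show "w \<in> A" using g by (auto simp: A_def)
  qed
  have "carrier G \<subseteq> ?H"
  proof
    fix g assume g: "g \<in> carrier G"
    have v0X: "v0 \<in> verts X" using v0 V by blast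
    have "g v0 \<in> A" using deck_apply(1)[OF g v0X] XA by blast
    then obtain h v where h: "h \<in> ?H" "v \<in> V" "g v0 = h v" by (auto simp: A_def)
    have hG: "h \<in> carrier G" and vX: "v \<in> verts X" using h HG V by auto
    \<comment> \<open>\<open>V\<close> meets each fibre of \<open>p\<close> once, so
      \<open>g\<close> and \<open>h\<close> agree at a vertex and are equal by freeness.\<close>
    have "v = v0"
      using V_inj[OF h(2) v0] deck_apply(2)[OF g v0X] deck_apply(2)[OF hG vX] h(3) by simp
    then have "(inv\<^bsub>G\<^esub> h \<otimes>\<^bsub>G\<^esub> g) v0 = v0"
      using deck_mult[OF deck.inv_closed[OF hG] g v0X] deck_mult[OF deck.inv_closed[OF hG] hG v0X] h(3) hG v0X
      by (simp add: deck_one)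
    then have "inv\<^bsub>G\<^esub> h \<otimes>\<^bsub>G\<^esub> g = \<one>\<^bsub>G\<^esub>"
      using deck_free_vertex[OF _ v0X] hG g by simp
    then have "g = h" using g hG by (metis deck.inv_closed deck.inv_equality deck.inv_inv)
    then show "g \<in> ?H" using h by simp
  qed
  then have "generate G S = carrier G" using HG by (rule subset_antisym[rotated])
  then show ?thesis using \<open>finite S\<close> SG by (intro exI[of _ S]) simp
qed

lemma finite_K_deck: "finite_K G"
  using deck_finitely_generated deck.finite_index_K_sub
  by (auto intro!: finite_K.intro simp: group_deck finite_K_axioms_def)

sublocale deck: finite_K "deck_group X p" by (rule finite_K_deck)

section \<open>Free actions on simplices and occurrences, with finitely many orbits\<close>

lemma free_action_simplices: "free_action G cell_act (simplices X k)"
proof (unfold_locales)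
  fix g h s assume g: "g \<in> carrier G" and s: "s \<in> simplices X k"
  then have sX: "s \<in> X" "s \<subseteq> verts X" by (auto simp: simplices_def)
  show "cell_act g s \<in> simplices X k"
    using deck_apply(3)[OF g sX(1)] card_image[OF inj_on_subset[OF deck_apply(4)[OF g] sX(2)]] s
    by (simp add: simplices_def cell_act_def)
  show "cell_act (g \<otimes>\<^bsub>G\<^esub> h) s = cell_act g (cell_act h s)" if h: "h \<in> carrier G"
    unfolding cell_act_def image_image using deck_mult[OF g h] sX by (intro image_cong) auto
  show "g = \<one>\<^bsub>G\<^esub>" if "cell_act g s = s"
    using deck_free_simplex[OF g sX(1)] that by (simp add: cell_act_def)
next
  fix s assume "s \<in> simplices X k"
  then have "s \<subseteq> verts X" by (auto simp: simplices_def)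
  then show "cell_act \<one>\<^bsub>G\<^esub> s = s" using deck_one by (force simp: cell_act_def)
qed

lemma free_action_occurrences: "free_action G occ_act (occurrences X k)"
proof -
  interpret F: free_action G cell_act "simplices X k" by (rule free_action_simplices)
  interpret F': free_action G cell_act "simplices X (Suc k)" by (rule free_action_simplices)
  have occ: "occ_act g e = (cell_act g (fst e), cell_act g (snd e))" for g :: "'v \<Rightarrow> 'v" and e
    by (simp add: occ_act_def cell_act_def)
  show ?thesis
  proof (unfold_locales)
    fix g h e assume g: "g \<in> carrier G" and e: "e \<in> occurrences X k"
    then have e': "fst e \<in> simplices X (Suc k)" "snd e \<in> simplices X k" "snd e \<subseteq> fst e"
      by (auto simp: occurrences_def)
    show "occ_act g e \<in> occurrences X k"
      using F.act_closed[OF g e'(2)] F'.act_closed[OF g e'(1)] e'(3)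
      by (auto simp: occurrences_def occ_act_def cell_act_def)
    show "occ_act (g \<otimes>\<^bsub>G\<^esub> h) e = occ_act g (occ_act h e)" if h: "h \<in> carrier G"
      using F.act_mult[OF g h e'(2)] F'.act_mult[OF g h e'(1)] by (simp add: occ)
    show "g = \<one>\<^bsub>G\<^esub>" if "occ_act g e = e"
      using F.act_free[OF g e'(2)] that by (metis occ snd_conv)
  next
    fix e assume "e \<in> occurrences X k"
    then show "occ_act \<one>\<^bsub>G\<^esub> e = e" using F.act_one F'.act_one by (auto simp: occ occurrences_def)
  qed
qed

text \<open>Up to deck transformations a simplex is determined by its image in the finite
  base.\<close>

lemma finite_level_0_simplices: "finite (orbits (K_group G 0) (simplices X k) cell_act)"
proof -
  interpret F: free_action G cell_act "simplices X k" by (rule free_action_simplices)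
  define r where "r c = (SOME s. s \<in> simplices X k \<and> p ` s = c)" for c
  have "F.lev 0 \<subseteq> (\<lambda>c. F.orb 0 (r c)) ` C"
  proof
    fix B assume "B \<in> F.lev 0"
    then obtain s where s: "s \<in> simplices X k" "B = F.orb 0 s" by (elim F.levE)
    have r: "r (p ` s) \<in> simplices X k \<and> p ` r (p ` s) = p ` s"
      unfolding r_def by (rule someI[of _ s]) (use s in simp)
    then obtain g where g: "g \<in> carrier G" "g ` r (p ` s) = s"
      using deck_transitive_simplex[of "r (p ` s)" s] s by (auto simp: simplices_def)
    have "F.orb 0 (cell_act g (r (p ` s))) = F.orb 0 (r (p ` s))"
      using F.orb_act_K[of "r (p ` s)" g 0] r g by (simp add: deck.K_sub_0)
    then have "B = F.orb 0 (r (p ` s))" using s g by (simp add: cell_act_def)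
    then show "B \<in> (\<lambda>c. F.orb 0 (r c)) ` C" using p_simplex s by (auto simp: simplices_def)
  qed
  then show ?thesis by (rule finite_subset) (simp add: finite_base)
qed

text \<open>A deck transformation matches the larger simplices; the faces then match as well, since
  \<open>p\<close> is injective on the larger simplex.\<close>

lemma finite_level_0_occurrences: "finite (orbits (K_group G 0) (occurrences X k) occ_act)"
proof -
  interpret F: free_action G occ_act "occurrences X k" by (rule free_action_occurrences)
  define r where "r c = (SOME e. e \<in> occurrences X k \<and> (p ` fst e, p ` snd e) = c)" for c
  have "F.lev 0 \<subseteq> (\<lambda>c. F.orb 0 (r c)) ` (C \<times> C)"
  proof
    fix B assume "B \<in> F.lev 0"
    then obtain e where e: "e \<in> occurrences X k" "B = F.orb 0 e" by (elim F.levE)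
    let ?c = "(p ` fst e, p ` snd e)"
    have r: "r ?c \<in> occurrences X k \<and> (p ` fst (r ?c), p ` snd (r ?c)) = ?c"
      unfolding r_def by (rule someI[of _ e]) (use e in simp)
    have eX: "fst e \<in> X" "snd e \<in> X" "snd e \<subseteq> fst e" "fst (r ?c) \<in> X" "snd (r ?c) \<subseteq> fst (r ?c)"
      using e r by (auto simp: occurrences_def simplices_def)
    obtain g where g: "g \<in> carrier G" "g ` fst (r ?c) = fst e"
      using deck_transitive_simplex[OF eX(4,1)] r by auto
    have "p (g v) = p v" if "v \<in> snd (r ?c)" for v
      using deck_apply(2)[OF g(1)] that eX by blast
    then have "p ` g ` snd (r ?c) = p ` snd e" using r by (auto simp: image_image)
    moreover have "g ` snd (r ?c) \<subseteq> fst e" using g eX by blast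
    ultimately have "g ` snd (r ?c) = snd e"
      using inj_on_image_eq_iff[OF p_inj[OF eX(1)] _ eX(3), of "g ` snd (r ?c)"] by simp
    then have "occ_act g (r ?c) = e" using g by (simp add: occ_act_def)
    then have "B = F.orb 0 (r ?c)"
      using F.orb_act_K[of "r ?c" g 0] r g e by (simp add: deck.K_sub_0)
    then show "B \<in> (\<lambda>c. F.orb 0 (r c)) ` (C \<times> C)" using p_simplex[OF eX(1)] p_simplex[OF eX(2)] by blast
  qed
  then show ?thesis by (rule finite_subset) (simp add: finite_base)
qed

end

section \<open>Simplicial isomorphisms\<close>

lemma simplicial_iso_inv:
  assumes f: "simplicial_iso C1 C2 f"
  shows "simplicial_iso C2 C1 (inv_into (verts C1) f)"
proof -
  let ?g = "inv_into (verts C1) f"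
  have bij: "bij_betw f (verts C1) (verts C2)" and iff: "\<And>s. s \<subseteq> verts C1 \<Longrightarrow> f ` s \<in> C2 \<longleftrightarrow> s \<in> C1"
    using f unfolding simplicial_iso_def by blast+
  have "?g ` t \<in> C1 \<longleftrightarrow> t \<in> C2" if t: "t \<subseteq> verts C2" for t
  proof -
    have "?g ` t \<subseteq> verts C1"
      by (intro image_subsetI bij_betw_apply[OF bij_betw_inv_into[OF bij]] subsetD[OF t])
    moreover have "f (?g w) = w" if "w \<in> t" for w
      by (rule bij_betw_inv_into_right[OF bij subsetD[OF t that]])
    then have "f ` ?g ` t = t" by (simp add: image_image)
    ultimately show ?thesis using iff[of "?g ` t"] by simp
  qed
  then show ?thesis using bij_betw_inv_into[OF bij] unfolding simplicial_iso_def by blast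
qed

lemma simplicial_iso_image:
  assumes f: "simplicial_iso C1 C2 f"
  shows "(\<lambda>s. f ` s) ` C1 = C2"
proof
  have bij: "bij_betw f (verts C1) (verts C2)" and iff: "\<And>s. s \<subseteq> verts C1 \<Longrightarrow> f ` s \<in> C2 \<longleftrightarrow> s \<in> C1"
    using f unfolding simplicial_iso_def by blast+
  show "(\<lambda>s. f ` s) ` C1 \<subseteq> C2" using iff by blast
  show "C2 \<subseteq> (\<lambda>s. f ` s) ` C1"
  proof
    fix t assume t: "t \<in> C2"
    let ?s = "inv_into (verts C1) f ` t"
    have t': "t \<subseteq> verts C2" using t by blast
    have "?s \<subseteq> verts C1"
      by (intro image_subsetI bij_betw_apply[OF bij_betw_inv_into[OF bij]] subsetD[OF t'])
    moreover have "f (inv_into (verts C1) f w) = w" if "w \<in> t" for w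
      by (rule bij_betw_inv_into_right[OF bij subsetD[OF t' that]])
    then have "f ` ?s = t" by (simp add: image_image)
    ultimately show "t \<in> (\<lambda>s. f ` s) ` C1" using iff[of ?s] t by (intro image_eqI[of _ _ ?s]) auto
  qed
qed

lemma piecewise_linear_realize:
  assumes C: "abstract_complex C" "finite C"
  shows "piecewise_linear_on (realization C) (realize f)"
  unfolding piecewise_linear_on_def
proof (intro conjI exI[of _ "closed_simplex ` C"] ballI)
  show "continuous_on (realization C) (realize f)" by (rule continuous_on_realize)
  show "finite (closed_simplex ` C)" using C by simp
  show "\<Union> (closed_simplex ` C) = realization C" by (simp add: realization_def)
  show "polytope T" if T: "T \<in> closed_simplex ` C" for T
  proof -
    obtain s where "s \<in> C" "T = closed_simplex s" using T by blast
    then show ?thesis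
      using complex.simplexD(1)[OF complex.intro[OF C(1)], of s]
      by (simp add: closed_simplex_def polytope_convex_hull)
  qed
qed (simp add: realize_add realize_scaleR)

lemma PL_homeomorphism_realize:
  assumes C1: "abstract_complex C1" "finite C1" and C2: "abstract_complex C2" "finite C2"
    and f: "simplicial_iso C1 C2 f"
  shows "PL_homeomorphism (realization C1) (realization C2) (realize f)"
  unfolding PL_homeomorphism_def
proof (intro exI conjI)
  let ?g = "inv_into (verts C1) f"
  interpret C1: complex C1 by (rule complex.intro[OF C1(1)])
  interpret C2: complex C2 by (rule complex.intro[OF C2(1)])
  have bij: "bij_betw f (verts C1) (verts C2)" using f unfolding simplicial_iso_def by blast
  show "homeomorphism (realization C1) (realization C2) (realize f) (realize ?g)"
  proof (rule homeomorphismI)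
    show "realize f ` realization C1 \<subseteq> realization C2"
      using simplicial_iso_image[OF f] by (simp add: realize_realization)
    show "realize ?g ` realization C2 \<subseteq> realization C1"
      using simplicial_iso_image[OF simplicial_iso_inv[OF f]] by (simp add: realize_realization)
    show "realize ?g (realize f x) = x" if x: "x \<in> realization C1" for x
      unfolding realize_realize
      using bij_betw_inv_into_left[OF bij] C1.realizationD(1)[OF x] by (intro realize_ident) blast
    show "realize f (realize ?g x) = x" if x: "x \<in> realization C2" for x
      unfolding realize_realize
      using bij_betw_inv_into_right[OF bij] C2.realizationD(1)[OF x] by (intro realize_ident) blast
  qed (rule continuous_on_realize)+
qed (use piecewise_linear_realize C1 C2 in blast)+

section \<open>Lifting loops\<close>

lemma joinpaths_project:
  assumes "\<And>t. t \<in> {0..1} \<Longrightarrow> P (l t) = a t" "\<And>t. t \<in> {0..1} \<Longrightarrow> P (l' t) = b t" "t \<in> {0..1}"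
  shows "P ((l +++ l') t) = (a +++ b) t"
  using assms by (simp add: joinpaths_def)

context universal_cover begin

lemma deck_realize_cancel:
  assumes g: "g \<in> carrier G" and h: "h \<in> carrier G" and x: "x \<in> realization X" and eq: "realize g x = realize h x"
  shows "g = h"
proof -
  have "realize (inv\<^bsub>G\<^esub> h \<otimes>\<^bsub>G\<^esub> g) x = realize (inv\<^bsub>G\<^esub> h \<otimes>\<^bsub>G\<^esub> h) x"
    using realize_deck_mult[OF deck.inv_closed[OF h] g x] realize_deck_mult[OF deck.inv_closed[OF h] h x] eq by simp
  also have "\<dots> = x"
    using X.realizationD(1)[OF x] deck_one h by (intro realize_ident) (metis UnionI deck.l_inv)
  finally have "inv\<^bsub>G\<^esub> h \<otimes>\<^bsub>G\<^esub> g = \<one>\<^bsub>G\<^esub>" using deck_free[OF _ x] g h by simp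
  then show ?thesis using g h by (metis deck.inv_closed deck.inv_equality deck.inv_inv)
qed

text \<open>The description in \<open>deck_of_loop\<close> is unique: by monodromy all loops of the
  class have lifts with the same end, and freeness recovers the deck transformation from that
  end.\<close>

lemma deck_of_loop_eqI:
  assumes x: "x \<in> realization X" and g: "g \<in> carrier G" and \<gamma>: "\<gamma> \<in> a"
    and hom: "\<And>\<gamma>'. \<gamma>' \<in> a \<Longrightarrow> homotopic_paths (realization C) \<gamma> \<gamma>'"
    and l: "path l" "path_image l \<subseteq> realization X" "\<And>t. t \<in> {0..1} \<Longrightarrow> realize p (l t) = \<gamma> t"
      "pathstart l = x" "pathfinish l = realize g x"
  shows "deck_of_loop X p x a = g"
  unfolding deck_of_loop_def
proof (rule the_equality)
  show "g \<in> carrier G \<and> (\<exists>\<gamma>\<in>a. \<exists>l. path l \<and> path_image l \<subseteq> realization X \<and>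
      (\<forall>t\<in>{0..1}. realize p (l t) = \<gamma> t) \<and> pathstart l = x \<and> pathfinish l = realize g x)"
    using g \<gamma> l by blast
next
  fix g' assume "g' \<in> carrier G \<and> (\<exists>\<gamma>\<in>a. \<exists>l. path l \<and> path_image l \<subseteq> realization X \<and>
      (\<forall>t\<in>{0..1}. realize p (l t) = \<gamma> t) \<and> pathstart l = x \<and> pathfinish l = realize g' x)"
  then obtain \<gamma>' l' where g': "g' \<in> carrier G" and \<gamma>': "\<gamma>' \<in> a"
    and l': "path l'" "path_image l' \<subseteq> realization X" "\<forall>t\<in>{0..1}. realize p (l' t) = \<gamma>' t"
      "pathstart l' = x" "pathfinish l' = realize g' x"
    by blast
  note h = hom[OF \<gamma>']
  have "pathfinish l = pathfinish l'"
    by (rule covering_space_monodromy[OF covering _ _ _ _ h])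
      (use l l' homotopic_paths_imp_path[OF h] homotopic_paths_imp_subset[OF h] in auto)
  then have "realize g' x = realize g x" using l l' by simp
  then show "g' = g" using deck_realize_cancel[OF g' g x] by blast
qed

lemma path_class_lift:
  assumes x: "x \<in> realization X"
    and \<gamma>: "path \<gamma>" "path_image \<gamma> \<subseteq> realization C" "pathstart \<gamma> = realize p x" "pathfinish \<gamma> = realize p x"
  shows "\<exists>l g. deck_of_loop X p x (path_class (realization C) \<gamma>) = g \<and> g \<in> carrier G \<and>
    path l \<and> path_image l \<subseteq> realization X \<and> (\<forall>t\<in>{0..1}. realize p (l t) = \<gamma> t) \<and>
    pathstart l = x \<and> pathfinish l = realize g x"
proof -
  obtain l where l: "path l" "path_image l \<subseteq> realization X" "pathstart l = x" "\<And>t. t \<in> {0..1} \<Longrightarrow> realize p (l t) = \<gamma> t"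
    using covering_space_lift_path_strong[OF covering x \<gamma>(1-3)] by blast
  have "realize p (pathfinish l) = realize p x" using l(4)[of 1] \<gamma>(4) by (simp add: pathfinish_def)
  moreover have "pathfinish l \<in> realization X" using l(2) pathfinish_in_path_image by blast
  ultimately obtain g where g: "g \<in> carrier G" "realize g x = pathfinish l"
    using deck_transitive[OF x] by metis
  have "deck_of_loop X p x (path_class (realization C) \<gamma>) = g"
    by (rule deck_of_loop_eqI[OF x g(1), of \<gamma> _ l]) (use \<gamma> l g in \<open>auto simp: path_class_def\<close>)
  then show ?thesis using l g by (intro exI[of _ l] exI[of _ g]) simp
qed

end

text \<open>The conjugating element comes from \<open>\<delta>\<close>: its lift \<open>d\<close>
  from \<open>x2\<close> ends at \<open>k\<close> applied to the image of \<open>x1\<close>. With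
  \<open>c\<close> the conjugate of \<open>h g\<close> by \<open>k\<close>, the loop in the second
  base lifts to \<open>d\<close>, followed by the \<open>k\<close>-translate of the image of
  \<open>l\<close>, followed by the \<open>c\<close>-translate of \<open>d\<close> reversed.\<close>

lemma induces_up_to_conjugacyI:
  assumes U1: "universal_cover X1 p1 C1" and U2: "universal_cover X2 p2 C2"
    and h: "h \<in> hom (deck_group X1 p1) (deck_group X2 p2)"
    and \<theta>: "simplicial_iso X1 X2 \<theta>" and equiv: "vertex_equivariant (deck_group X1 p1) X1 h \<theta>"
    and desc: "descends_to X1 p1 p2 \<theta> \<theta>'" and \<theta>': "simplicial_iso C1 C2 \<theta>'"
  shows "induces_up_to_conjugacy X1 p1 C1 X2 p2 C2 \<theta>' h"
proof -
  interpret U1: universal_cover X1 p1 C1 by (rule U1)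
  interpret U2: universal_cover X2 p2 C2 by (rule U2)
  have h_closed: "h g \<in> carrier U2.G" if "g \<in> carrier U1.G" for g using h that by (auto simp: hom_def)
  have \<theta>_into: "realize \<theta> x \<in> realization X2" if "x \<in> realization X1" for x
    using simplicial_iso_image[OF \<theta>] realize_realization[of \<theta> X1] that by blast
  have \<theta>'_into: "realize \<theta>' x \<in> realization C2" if "x \<in> realization C1" for x
    using simplicial_iso_image[OF \<theta>'] realize_realization[of \<theta>' C1] that by blast
  have \<theta>_proj: "realize p2 (realize \<theta> x) = realize \<theta>' (realize p1 x)" if x: "x \<in> realization X1" for x
    unfolding realize_realize
    using desc U1.X.realizationD(1)[OF x] by (intro realize_cong) (auto simp: descends_to_def)
  have \<theta>_equiv: "realize \<theta> (realize g x) = realize (h g) (realize \<theta> x)"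
    if g: "g \<in> carrier U1.G" and x: "x \<in> realization X1" for g x
    unfolding realize_realize
    using equiv g U1.X.realizationD(1)[OF x] by (intro realize_cong) (auto simp: vertex_equivariant_def)
  show ?thesis
    unfolding induces_up_to_conjugacy_def
  proof (intro ballI allI impI, elim conjE)
    fix x1 x2 \<delta>
    assume x1: "x1 \<in> realization X1" and x2: "x2 \<in> realization X2"
      and \<delta>: "path \<delta>" "path_image \<delta> \<subseteq> realization C2" "pathstart \<delta> = realize p2 x2"
        "pathfinish \<delta> = realize \<theta>' (realize p1 x1)"
    obtain d where d: "path d" "path_image d \<subseteq> realization X2" "pathstart d = x2" "\<And>t. t \<in> {0..1} \<Longrightarrow> realize p2 (d t) = \<delta> t"
      using covering_space_lift_path_strong[OF U2.covering x2 \<delta>(1-3)] by blast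
    have dX: "pathfinish d \<in> realization X2" using d(2) pathfinish_in_path_image by blast
    have "realize p2 (realize \<theta> x1) = realize p2 (pathfinish d)"
      using d(4)[of 1] \<delta>(4) \<theta>_proj[OF x1] by (simp add: pathfinish_def)
    then obtain k where k: "k \<in> carrier U2.G" "realize k (realize \<theta> x1) = pathfinish d"
      using U2.deck_transitive[OF \<theta>_into[OF x1] dX] by blast
    show "\<exists>k\<in>carrier U2.G. \<forall>a\<in>carrier (fundamental_group (realization C1) (realize p1 x1)).
        deck_of_loop X2 p2 x2 (change_basepoint (realization C2) \<delta> (pi1_map (realization C2) (realize \<theta>') a)) =
        k \<otimes>\<^bsub>U2.G\<^esub> h (deck_of_loop X1 p1 x1 a) \<otimes>\<^bsub>U2.G\<^esub> inv\<^bsub>U2.G\<^esub> k"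
    proof (intro bexI[OF _ k(1)] ballI)
      fix a assume "a \<in> carrier (fundamental_group (realization C1) (realize p1 x1))"
      then obtain \<gamma> where a: "a = path_class (realization C1) \<gamma>"
        and \<gamma>: "path \<gamma>" "path_image \<gamma> \<subseteq> realization C1" "pathstart \<gamma> = realize p1 x1" "pathfinish \<gamma> = realize p1 x1"
        by (auto simp: fundamental_group_def)
      obtain l g where loop: "deck_of_loop X1 p1 x1 a = g" and g: "g \<in> carrier U1.G"
        and l: "path l" "path_image l \<subseteq> realization X1" "\<And>t. t \<in> {0..1} \<Longrightarrow> realize p1 (l t) = \<gamma> t"
          "pathstart l = x1" "pathfinish l = realize g x1"
        unfolding a using U1.path_class_lift[OF x1 \<gamma>] by blast
      define b where "b = change_basepoint (realization C2) \<delta> (pi1_map (realization C2) (realize \<theta>') a)"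
      define \<beta> where "\<beta> = \<delta> +++ (realize \<theta>' \<circ> \<gamma>) +++ reversepath \<delta>"
      define c where "c = k \<otimes>\<^bsub>U2.G\<^esub> h g \<otimes>\<^bsub>U2.G\<^esub> inv\<^bsub>U2.G\<^esub> k"
      have hg: "h g \<in> carrier U2.G" using h_closed[OF g] .
      have c: "c \<in> carrier U2.G" unfolding c_def using k hg by simp
      have path\<theta>\<gamma>: "path (realize \<theta>' \<circ> \<gamma>)" "path_image (realize \<theta>' \<circ> \<gamma>) \<subseteq> realization C2"
        using \<gamma>(1,2) \<theta>'_into by (auto intro: path_continuous_image continuous_on_realize simp: path_image_compose)
      have ends: "pathstart (realize \<theta>' \<circ> \<gamma>) = pathfinish \<delta>" "pathfinish (realize \<theta>' \<circ> \<gamma>) = pathfinish \<delta>"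
        using \<gamma>(3,4) \<delta>(4) by (simp_all add: pathstart_compose pathfinish_compose)
      have refl: "homotopic_paths (realization C2) \<delta> \<delta>"
        "homotopic_paths (realization C2) (reversepath \<delta>) (reversepath \<delta>)"
        using \<delta> by simp_all
      have homs: "homotopic_paths (realization C2) \<beta> (\<delta> +++ \<gamma>2 +++ reversepath \<delta>)"
        if "homotopic_paths (realization C2) (realize \<theta>' \<circ> \<gamma>) \<gamma>2" for \<gamma>2
        unfolding \<beta>_def
        using that refl ends homotopic_paths_imp_pathstart[OF that] homotopic_paths_imp_pathfinish[OF that]
        by (intro homotopic_paths_join) simp_all
      \<comment> \<open>The image class is a union over all representatives of \<open>a\<close>;
        homotopic loops have homotopic images, so it is a single homotopy class.\<close>
      have pi1: "\<gamma>2 \<in> pi1_map (realization C2) (realize \<theta>') a \<longleftrightarrow> homotopic_paths (realization C2) (realize \<theta>' \<circ> \<gamma>) \<gamma>2" for \<gamma>2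
      proof
        assume "\<gamma>2 \<in> pi1_map (realization C2) (realize \<theta>') a"
        then obtain \<gamma>1 where "homotopic_paths (realization C1) \<gamma> \<gamma>1"
          "homotopic_paths (realization C2) (realize \<theta>' \<circ> \<gamma>1) \<gamma>2"
          by (auto simp: pi1_map_def a path_class_def)
        moreover from this(1) have "homotopic_paths (realization C2) (realize \<theta>' \<circ> \<gamma>) (realize \<theta>' \<circ> \<gamma>1)"
          by (rule homotopic_paths_continuous_image) (use \<theta>'_into in \<open>auto intro: continuous_on_realize\<close>)
        ultimately show "homotopic_paths (realization C2) (realize \<theta>' \<circ> \<gamma>) \<gamma>2"
          using homotopic_paths_trans by blast
      next
        assume "homotopic_paths (realization C2) (realize \<theta>' \<circ> \<gamma>) \<gamma>2"
        moreover have "homotopic_paths (realization C1) \<gamma> \<gamma>" using \<gamma> by simp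
        ultimately show "\<gamma>2 \<in> pi1_map (realization C2) (realize \<theta>') a"
          unfolding pi1_map_def a path_class_def by blast
      qed
      have b_iff: "\<beta>' \<in> b \<longleftrightarrow> (\<exists>\<gamma>2. homotopic_paths (realization C2) (realize \<theta>' \<circ> \<gamma>) \<gamma>2 \<and>
          homotopic_paths (realization C2) (\<delta> +++ \<gamma>2 +++ reversepath \<delta>) \<beta>')" for \<beta>'
        by (auto simp: b_def change_basepoint_def path_class_def pi1)
      have refl\<gamma>: "homotopic_paths (realization C2) (realize \<theta>' \<circ> \<gamma>) (realize \<theta>' \<circ> \<gamma>)" using path\<theta>\<gamma> by simp
      have \<beta>_mem: "\<beta> \<in> b" 
        using refl\<gamma> homs[OF refl\<gamma>] unfolding b_iff \<beta>_def by blast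
      have b_hom: "homotopic_paths (realization C2) \<beta> \<beta>'" if "\<beta>' \<in> b" for \<beta>'
        using that homs homotopic_paths_trans unfolding b_iff by blast
      \<comment> \<open>The choice of \<open>k\<close> makes \<open>m\<close> start where
        \<open>d\<close> ends, and \<open>n\<close> starts where \<open>m\<close> ends because
        \<open>c\<close> times \<open>k\<close> equals \<open>k\<close> times
        \<open>h g\<close>.\<close>
      define m where "m = realize k \<circ> realize \<theta> \<circ> l"
      define n where "n = realize c \<circ> reversepath d"
      have kX: "realize k z \<in> realization X2 \<and> realize p2 (realize k z) = realize p2 z" if "z \<in> realization X2" for z
        using U2.realize_deck[OF k(1) that] by blast
      have cX: "realize c z \<in> realization X2 \<and> realize p2 (realize c z) = realize p2 z" if "z \<in> realization X2" for z
        using U2.realize_deck[OF c that] by blast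
      have m: "path m" "path_image m \<subseteq> realization X2"
        unfolding m_def using l(1,2) kX \<theta>_into
        by (auto intro!: path_continuous_image continuous_on_realize continuous_on_compose simp: path_image_compose)
      have n: "path n" "path_image n \<subseteq> realization X2"
        unfolding n_def using d(1,2) cX
        by (auto intro!: path_continuous_image continuous_on_realize simp: path_image_compose)
      have l_in: "l t \<in> realization X1" if "t \<in> {0..1}" for t using l(2) that by (auto simp: path_image_def)
      have d_in: "d t \<in> realization X2" if "t \<in> {0..1}" for t using d(2) that by (auto simp: path_image_def)
      have m_start: "pathstart m = pathfinish d"
        using l(4) k(2) by (simp add: m_def pathstart_compose)
      have m_finish: "pathfinish m = realize k (realize (h g) (realize \<theta> x1))"
        using l(5) \<theta>_equiv[OF g x1] by (simp add: m_def pathfinish_compose)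
      have n_start: "pathstart n = realize c (pathfinish d)" by (simp add: n_def pathstart_compose)
      have n_finish: "pathfinish n = realize c x2" using d(3) by (simp add: n_def pathfinish_compose)
      have "realize c (pathfinish d) = realize (c \<otimes>\<^bsub>U2.G\<^esub> k) (realize \<theta> x1)"
        using U2.realize_deck_mult[OF c k(1) \<theta>_into[OF x1]] k(2) by simp
      also have "c \<otimes>\<^bsub>U2.G\<^esub> k = k \<otimes>\<^bsub>U2.G\<^esub> h g"
        unfolding c_def using k(1) hg by (simp add: U2.deck.m_assoc)
      also have "realize \<dots> (realize \<theta> x1) = pathfinish m"
        using U2.realize_deck_mult[OF k(1) hg \<theta>_into[OF x1]] m_finish by simp
      finally have mn: "pathfinish m = pathstart n" using n_start by simp
      have "deck_of_loop X2 p2 x2 b = c"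
      proof (rule U2.deck_of_loop_eqI[OF x2 c \<beta>_mem b_hom, of "d +++ m +++ n"])
        show "path (d +++ m +++ n)" using d(1) m(1) n(1) m_start mn by simp
        show "path_image (d +++ m +++ n) \<subseteq> realization X2"
          using d(2) m(2) n(2) by (intro subset_path_image_join) auto
        show "pathstart (d +++ m +++ n) = x2" using d(3) by simp
        show "pathfinish (d +++ m +++ n) = realize c x2" using n_finish by simp
        show "realize p2 ((d +++ m +++ n) t) = \<beta> t" if t: "t \<in> {0..1}" for t
        proof -
          have 1: "realize p2 (m t) = (realize \<theta>' \<circ> \<gamma>) t" if t: "t \<in> {0..1}" for t
            using kX[OF \<theta>_into[OF l_in[OF t]]] \<theta>_proj[OF l_in[OF t]] l(3)[OF t] by (simp add: m_def)
          have 2: "realize p2 (n t) = reversepath \<delta> t" if t: "t \<in> {0..1}" for t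
            using cX[OF d_in, of "1 - t"] d(4)[of "1 - t"] t by (simp add: n_def reversepath_def)
          have 3: "realize p2 ((m +++ n) t) = ((realize \<theta>' \<circ> \<gamma>) +++ reversepath \<delta>) t" if "t \<in> {0..1}" for t
            using joinpaths_project[of "realize p2" m "realize \<theta>' \<circ> \<gamma>" n "reversepath \<delta>" t] 1 2 that by blast
          show ?thesis
            unfolding \<beta>_def using joinpaths_project[of "realize p2" d \<delta> "m +++ n" _ t] d(4) 3 t by blast
        qed
      qed
      then show "deck_of_loop X2 p2 x2 (change_basepoint (realization C2) \<delta> (pi1_map (realization C2) (realize \<theta>') a)) =
          k \<otimes>\<^bsub>U2.G\<^esub> h (deck_of_loop X1 p1 x1 a) \<otimes>\<^bsub>U2.G\<^esub> inv\<^bsub>U2.G\<^esub> k"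
        by (simp add: b_def c_def loop)
    qed
  qed
qed

section \<open>Residual complexes of the quotients\<close>

lemma level_complex_simps [simp]:
  "cells (level_complex G X m) k = orbits (K_group G m) (simplices X k) cell_act"
  "occs (level_complex G X m) k = orbits (K_group G m) (occurrences X k) occ_act"
  "upper (level_complex G X m) k e = fst ` e"
  "lower (level_complex G X m) k e = snd ` e"
  by (simp_all add: level_complex_def residual_quotient_def full_complex_def)

lemma residual_iso_inv_into:
  assumes f: "residual_iso I J f"
    and up: "\<And>k e. e \<in> occs I k \<Longrightarrow> upper I k e \<in> cells I (Suc k)"
    and low: "\<And>k e. e \<in> occs I k \<Longrightarrow> lower I k e \<in> cells I k"
  shows "residual_iso J I \<lparr>cmap = \<lambda>k. inv_into (cells I k) (cmap f k), omap = \<lambda>k. inv_into (occs I k) (omap f k)\<rparr>"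
  unfolding residual_iso_def
proof (intro allI conjI ballI)
  fix k
  have c: "bij_betw (cmap f k) (cells I k) (cells J k)" for k using f by (simp add: residual_iso_def)
  have o: "bij_betw (omap f k) (occs I k) (occs J k)" using f by (simp add: residual_iso_def)
  let ?g = "\<lparr>cmap = \<lambda>k. inv_into (cells I k) (cmap f k), omap = \<lambda>k. inv_into (occs I k) (omap f k)\<rparr>"
  show "bij_betw (cmap ?g k) (cells J k) (cells I k)" using bij_betw_inv_into[OF c] by simp
  show "bij_betw (omap ?g k) (occs J k) (occs I k)" using bij_betw_inv_into[OF o] by simp
  fix e assume e: "e \<in> occs J k"
  define d where "d = inv_into (occs I k) (omap f k) e"
  have d: "d \<in> occs I k" "omap f k d = e"
    using bij_betw_apply[OF bij_betw_inv_into[OF o] e] bij_betw_inv_into_right[OF o e] by (simp_all add: d_def)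
  have "cmap f (Suc k) (upper I k d) = upper J k e" "cmap f k (lower I k d) = lower J k e"
    using f d by (auto simp: residual_iso_def)
  then show "cmap ?g (Suc k) (upper J k e) = upper I k (omap ?g k e)"
    "cmap ?g k (lower J k e) = lower I k (omap ?g k e)"
    using bij_betw_inv_into_left[OF c up[OF d(1)]] bij_betw_inv_into_left[OF c low[OF d(1)]]
    by (simp_all add: d_def)
qed

context universal_cover begin

lemma completed_simps:
  "cells (completed_complex G X) k = free_action.completion G cell_act (simplices X k)"
  "occs (completed_complex G X) k = free_action.completion G occ_act (occurrences X k)"
  "upper (completed_complex G X) k \<xi> = (\<lambda>m. fst ` \<xi> m)"
  "lower (completed_complex G X) k \<eta> = (\<lambda>m. snd ` \<eta> m)"
  by (simp_all add: completed_complex_def free_action.completion_def[OF free_action_simplices]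
      free_action.completion_def[OF free_action_occurrences])

lemma equivariant_upper: "equivariant_map G occ_act (occurrences X k) cell_act (simplices X (Suc k)) fst"
  by (intro equivariant_map.intro free_action_occurrences free_action_simplices equivariant_map_axioms.intro)
    (auto simp: occurrences_def occ_act_def cell_act_def)

lemma equivariant_lower: "equivariant_map G occ_act (occurrences X k) cell_act (simplices X k) snd"
  by (intro equivariant_map.intro free_action_occurrences free_action_simplices equivariant_map_axioms.intro)
    (auto simp: occurrences_def occ_act_def cell_act_def)

lemma completed_closed:
  assumes "e \<in> occs (completed_complex G X) k"
  shows "upper (completed_complex G X) k e \<in> cells (completed_complex G X) (Suc k)"
    "lower (completed_complex G X) k e \<in> cells (completed_complex G X) k"
  using assms equivariant_map.image_completion[OF equivariant_upper] equivariant_map.image_completion[OF equivariant_lower]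
  by (simp_all add: completed_simps)

lemma simplex_dim: "s \<in> X \<Longrightarrow> s \<in> simplices X (card s - 1)"
  using X.simplexD[of s] by (simp add: simplices_def card_gt_0_iff)

lemma vertex_dim: "v \<in> verts X \<Longrightarrow> {v} \<in> simplices X 0"
  using X.vertex_simplex by (simp add: simplices_def)

lemma simplices_0: "s \<in> simplices X 0 \<Longrightarrow> \<exists>v\<in>verts X. s = {v}"
  by (auto simp: simplices_def card_1_singleton_iff)

lemma facet_occurrence:
  assumes "s \<in> simplices X (Suc k)" "v \<in> s"
  shows "s - {v} \<in> simplices X k" "(s, s - {v}) \<in> occurrences X k"
proof -
  have s: "s \<in> X" "card s = Suc (Suc k)" "finite s" using assms X.simplexD by (auto simp: simplices_def)
  have c: "card (s - {v}) = Suc k" using s assms by simp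
  then have "s - {v} \<noteq> {}" by (metis card.empty nat.distinct(1))
  then have "s - {v} \<in> X" using X.face[OF s(1), of "s - {v}"] by blast
  then show "s - {v} \<in> simplices X k" using c by (simp add: simplices_def)
  then show "(s, s - {v}) \<in> occurrences X k" using assms by (auto simp: occurrences_def)
qed

text \<open>\<open>p\<close> preserves the number of vertices of a simplex, so the finite base
  bounds the dimension. This keeps the set of graded maps at one level finite.\<close>

lemma simplices_bounded: "\<exists>d. \<forall>k>d. simplices X k = {}"
proof (intro exI[of _ "Max (card ` C)"] allI impI)
  fix k assume k: "Max (card ` C) < k"
  have "card s \<noteq> Suc k" if s: "s \<in> X" for s
  proof -
    have "card s = card (p ` s)" using card_image[OF p_inj[OF s]] by simp
    also have "\<dots> \<le> Max (card ` C)" using p_simplex[OF s] finite_base by simp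
    finally show ?thesis using k by simp
  qed
  then show "simplices X k = {}" by (auto simp: simplices_def)
qed

end

section \<open>Isomorphisms carrying one original vertex to an original vertex\<close>

text \<open>Every step passes through an occurrence: its image is original once one end is, by
  \<open>orig_reflect\<close>, and then so is the other end. A vertex reaches its neighbour through
  the edge between them, and a simplex is reached from any of its facets.\<close>

lemma originals_spread:
  assumes U1: "universal_cover X1 p1 C1" and U2: "universal_cover X2 p2 C2"
    and E: "residual_iso (completed_complex (deck_group X1 p1) X1) (completed_complex (deck_group X2 p2) X2) E"
    and v0: "v0 \<in> verts X1" and w0: "w0 \<in> verts X2"
    and E0: "cmap E 0 (original (deck_group X1 p1) cell_act {v0}) = original (deck_group X2 p2) cell_act {w0}"
  shows "s \<in> simplices X1 k \<Longrightarrow> \<exists>t\<in>simplices X2 k.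
      cmap E k (original (deck_group X1 p1) cell_act s) = original (deck_group X2 p2) cell_act t"
    and "e \<in> occurrences X1 k \<Longrightarrow> \<exists>e'\<in>occurrences X2 k.
      omap E k (original (deck_group X1 p1) occ_act e) = original (deck_group X2 p2) occ_act e'"
proof -
  interpret U1: universal_cover X1 p1 C1 by (rule U1)
  interpret U2: universal_cover X2 p2 C2 by (rule U2)
  define P where "P k s \<longleftrightarrow> (\<exists>t\<in>simplices X2 k.
      cmap E k (original U1.G cell_act s) = original U2.G cell_act t)" for k s
  \<comment> \<open>Either end may be the known one: the lower end when climbing to a simplex, the
    upper end when passing from an edge to its second vertex.\<close>
  have low: "\<exists>e'\<in>occurrences X2 k. omap E k (original U1.G occ_act e) = original U2.G occ_act e'"
    and spread: "P (Suc k) (fst e)"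
    if e: "e \<in> occurrences X1 k" and Pe: "P k (snd e) \<or> P (Suc k) (fst e)" for k e
  proof -
    interpret u1: equivariant_map U1.G occ_act "occurrences X1 k" cell_act "simplices X1 (Suc k)" fst
      by (rule U1.equivariant_upper)
    interpret l1: equivariant_map U1.G occ_act "occurrences X1 k" cell_act "simplices X1 k" snd
      by (rule U1.equivariant_lower)
    interpret u2: equivariant_map U2.G occ_act "occurrences X2 k" cell_act "simplices X2 (Suc k)" fst
      by (rule U2.equivariant_upper)
    interpret l2: equivariant_map U2.G occ_act "occurrences X2 k" cell_act "simplices X2 k" snd
      by (rule U2.equivariant_lower)
    define \<eta> where "\<eta> = omap E k (original U1.G occ_act e)"
    have ec: "original U1.G occ_act e \<in> occs (completed_complex U1.G X1) k"
      using u1.S.orig_completion[OF e] by (simp add: U1.completed_simps)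
    have "\<eta> \<in> occs (completed_complex U2.G X2) k"
      unfolding \<eta>_def using E ec by (auto simp: residual_iso_def dest: bij_betw_apply)
    then have \<eta>: "\<eta> \<in> u2.S.completion" by (simp add: U2.completed_simps)
    have "cmap E (Suc k) (upper (completed_complex U1.G X1) k (original U1.G occ_act e)) = upper (completed_complex U2.G X2) k \<eta> \<and>
        cmap E k (lower (completed_complex U1.G X1) k (original U1.G occ_act e)) = lower (completed_complex U2.G X2) k \<eta>"
      using E ec unfolding residual_iso_def \<eta>_def by blast
    then have inc: "cmap E (Suc k) (original U1.G cell_act (fst e)) = (\<lambda>m. fst ` \<eta> m)"
      "cmap E k (original U1.G cell_act (snd e)) = (\<lambda>m. snd ` \<eta> m)"
      by (simp_all only: U1.completed_simps U2.completed_simps u1.image_orig[OF e] l1.image_orig[OF e])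
    have ex: "\<exists>e'\<in>occurrences X2 k. \<eta> = original U2.G occ_act e'"
      using Pe
    proof
      assume "P k (snd e)"
      then obtain t where "t \<in> simplices X2 k" "(\<lambda>m. snd ` \<eta> m) = original U2.G cell_act t"
        using inc(2) by (auto simp: P_def)
      then show ?thesis using l2.orig_reflect[OF \<eta>] by blast
    next
      assume "P (Suc k) (fst e)"
      then obtain t where "t \<in> simplices X2 (Suc k)" "(\<lambda>m. fst ` \<eta> m) = original U2.G cell_act t"
        using inc(1) by (auto simp: P_def)
      then show ?thesis using u2.orig_reflect[OF \<eta>] by blast
    qed
    then show "\<exists>e'\<in>occurrences X2 k. omap E k (original U1.G occ_act e) = original U2.G occ_act e'"
      by (simp add: \<eta>_def)
    obtain e' where e': "e' \<in> occurrences X2 k" "\<eta> = original U2.G occ_act e'" using ex by blast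
    show "P (Suc k) (fst e)"
      unfolding P_def inc(1) e'(2) using u2.image_orig[OF e'(1)] u2.maps_to[OF e'(1)] by blast
  qed
  have edge: "P 0 {w}" if v: "P 0 {v}" and vw: "{v, w} \<in> X1" for v w
  proof (cases "v = w")
    case False
    have vwX: "v \<in> verts X1" "w \<in> verts X1" using vw by blast+
    have s: "{v, w} \<in> simplices X1 (Suc 0)" using vw False by (simp add: simplices_def)
    have o: "({v, w}, {z}) \<in> occurrences X1 0" if "z \<in> {v, w}" for z
      using s that U1.vertex_dim vwX by (auto simp: occurrences_def)
    have "P (Suc 0) {v, w}" using spread[OF o[of v]] v by simp
    then have low_w: "\<exists>e'\<in>occurrences X2 0. omap E 0 (original U1.G occ_act ({v, w}, {w})) = original U2.G occ_act e'"
      using low[OF o[of w]] by simp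
    then obtain e' where e': "e' \<in> occurrences X2 0"
      "omap E 0 (original U1.G occ_act ({v, w}, {w})) = original U2.G occ_act e'" by blast
    interpret l1: equivariant_map U1.G occ_act "occurrences X1 0" cell_act "simplices X1 0" snd
      by (rule U1.equivariant_lower)
    interpret l2: equivariant_map U2.G occ_act "occurrences X2 0" cell_act "simplices X2 0" snd
      by (rule U2.equivariant_lower)
    have ow: "({v, w}, {w}) \<in> occurrences X1 0" using o[of w] by simp
    have "original U1.G occ_act ({v, w}, {w}) \<in> occs (completed_complex U1.G X1) 0"
      using l1.S.orig_completion[OF ow] by (simp add: U1.completed_simps)
    then have "cmap E 0 (lower (completed_complex U1.G X1) 0 (original U1.G occ_act ({v, w}, {w}))) =
        lower (completed_complex U2.G X2) 0 (original U2.G occ_act e')"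
      using E unfolding residual_iso_def e'(2)[symmetric] by blast
    then have "cmap E 0 (original U1.G cell_act {w}) = original U2.G cell_act (snd e')"
      by (simp only: U1.completed_simps U2.completed_simps l1.image_orig[OF ow] l2.image_orig[OF e'(1)] snd_conv)
    then show ?thesis unfolding P_def using l2.maps_to[OF e'(1)] by blast
  qed (use v in simp)
  have "P 0 {v0}" unfolding P_def using E0 U2.vertex_dim[OF w0] by blast
  then have vert: "verts X1 \<subseteq> {v. P 0 {v}}"
    by (intro U1.X.connected_vertices[OF U1.connected_X _ v0]) (use edge in blast)+
  have all: "P k s" if "s \<in> simplices X1 k" for k s
    using that
  proof (induction k arbitrary: s)
    case 0
    then show ?case using U1.simplices_0 vert by blast
  next
    case (Suc k)
    then obtain v where v: "v \<in> s" by (auto simp: simplices_def dest: U1.X.simplexD(2))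
    show ?case
      using spread[OF U1.facet_occurrence(2)[OF Suc.prems v]] Suc.IH[OF U1.facet_occurrence(1)[OF Suc.prems v]] by simp
  qed
  show "s \<in> simplices X1 k \<Longrightarrow> \<exists>t\<in>simplices X2 k.
      cmap E k (original U1.G cell_act s) = original U2.G cell_act t"
    using all by (simp add: P_def)
  show "e \<in> occurrences X1 k \<Longrightarrow> \<exists>e'\<in>occurrences X2 k.
      omap E k (original U1.G occ_act e) = original U2.G occ_act e'"
    using low all by (auto simp: occurrences_def)
qed

text \<open>\<open>originals_spread\<close>, applied to \<open>E\<close> and to its inverse, gives a
  bijection of simplices that respects occurrences in both directions. Since the facets of a simplex
  cover its vertices, induction on the dimension shows that the bijection is given by its values on
  vertices.\<close>

lemma originals_vertex_map:
  assumes U1: "universal_cover X1 p1 C1" and U2: "universal_cover X2 p2 C2"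
    and rf1: "residually_finite (deck_group X1 p1)" and rf2: "residually_finite (deck_group X2 p2)"
    and E: "residual_iso (completed_complex (deck_group X1 p1) X1) (completed_complex (deck_group X2 p2) X2) E"
    and v0: "v0 \<in> verts X1" and w0: "w0 \<in> verts X2"
    and E0: "cmap E 0 (original (deck_group X1 p1) cell_act {v0}) = original (deck_group X2 p2) cell_act {w0}"
  shows "maps_originals_onto (deck_group X1 p1) X1 (deck_group X2 p2) X2 E"
    and "\<exists>\<theta>. simplicial_iso X1 X2 \<theta> \<and> restricts_to (deck_group X1 p1) X1 (deck_group X2 p2) E \<theta>"
proof -
  interpret U1: universal_cover X1 p1 C1 by (rule U1)
  interpret U2: universal_cover X2 p2 C2 by (rule U2)
  let ?I = "completed_complex U1.G X1" and ?J = "completed_complex U2.G X2"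
  let ?\<iota>1 = "original U1.G cell_act" and ?\<iota>2 = "original U2.G cell_act"
  let ?\<kappa>1 = "original U1.G occ_act" and ?\<kappa>2 = "original U2.G occ_act"
  note orig1 = free_action.orig_completion[OF U1.free_action_simplices, folded U1.completed_simps]
  note orig1' = free_action.orig_completion[OF U1.free_action_occurrences, folded U1.completed_simps]
  note inj1 = free_action.orig_inj[OF U1.free_action_simplices rf1]
  note inj2 = free_action.orig_inj[OF U2.free_action_simplices rf2]
  have bij: "bij_betw (cmap E k) (cells ?I k) (cells ?J k)" "bij_betw (omap E k) (occs ?I k) (occs ?J k)" for k
    using E by (auto simp: residual_iso_def)
  define E' where "E' = \<lparr>cmap = \<lambda>k. inv_into (cells ?I k) (cmap E k), omap = \<lambda>k. inv_into (occs ?I k) (omap E k)\<rparr>"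
  have E': "residual_iso ?J ?I E'"
    unfolding E'_def by (rule residual_iso_inv_into[OF E U1.completed_closed])
  have cancel: "cmap E' k (cmap E k \<xi>) = \<xi>" if "\<xi> \<in> cells ?I k" for k \<xi>
    using bij_betw_inv_into_left[OF bij(1) that] by (simp add: E'_def)
  have cancel_right: "cmap E k (cmap E' k \<xi>) = \<xi>" if "\<xi> \<in> cells ?J k" for k \<xi>
    using bij_betw_inv_into_right[OF bij(1) that] by (simp add: E'_def)
  have cancel_right': "omap E k (omap E' k \<xi>) = \<xi>" if "\<xi> \<in> occs ?J k" for k \<xi>
    using bij_betw_inv_into_right[OF bij(2) that] by (simp add: E'_def)
  have E0': "cmap E' 0 (?\<iota>2 {w0}) = ?\<iota>1 {v0}"
    using cancel[OF orig1[OF U1.vertex_dim[OF v0]]] E0 by simp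
  note fwd = originals_spread[OF U1 U2 E v0 w0 E0]
  note bwd = originals_spread[OF U2 U1 E' w0 v0 E0']
  have bwd_cell: "\<exists>s\<in>simplices X1 k. cmap E k (?\<iota>1 s) = ?\<iota>2 t" if t: "t \<in> simplices X2 k" for t k
    using bwd(1)[OF t] cancel_right[OF free_action.orig_completion[OF U2.free_action_simplices t, folded U2.completed_simps]]
    by metis
  have bwd_occ: "\<exists>e\<in>occurrences X1 k. omap E k (?\<kappa>1 e) = ?\<kappa>2 e'" if e': "e' \<in> occurrences X2 k" for e' k
    using bwd(2)[OF e'] cancel_right'[OF free_action.orig_completion[OF U2.free_action_occurrences e', folded U2.completed_simps]]
    by metis
  show "maps_originals_onto U1.G X1 U2.G X2 E"
    unfolding maps_originals_onto_def
  proof (intro allI conjI subset_antisym subsetI)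
    fix k \<xi> assume "\<xi> \<in> cmap E k ` ?\<iota>1 ` simplices X1 k"
    then show "\<xi> \<in> ?\<iota>2 ` simplices X2 k" using fwd(1) by blast
  next
    fix k \<xi> assume "\<xi> \<in> ?\<iota>2 ` simplices X2 k"
    then obtain t where t: "t \<in> simplices X2 k" "\<xi> = ?\<iota>2 t" by blast
    then obtain s where "s \<in> simplices X1 k" "cmap E k (?\<iota>1 s) = \<xi>" using bwd_cell[OF t(1)] by blast
    then show "\<xi> \<in> cmap E k ` ?\<iota>1 ` simplices X1 k" by blast
  next
    fix k \<xi> assume "\<xi> \<in> omap E k ` ?\<kappa>1 ` occurrences X1 k"
    then show "\<xi> \<in> ?\<kappa>2 ` occurrences X2 k" using fwd(2) by blast
  next
    fix k \<xi> assume "\<xi> \<in> ?\<kappa>2 ` occurrences X2 k"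
    then obtain t where t: "t \<in> occurrences X2 k" "\<xi> = ?\<kappa>2 t" by blast
    then obtain s where "s \<in> occurrences X1 k" "omap E k (?\<kappa>1 s) = \<xi>" using bwd_occ[OF t(1)] by blast
    then show "\<xi> \<in> omap E k ` ?\<kappa>1 ` occurrences X1 k" by blast
  qed
  \<comment> \<open>Residual finiteness of the second deck group makes this choice unique; that of
    the first makes \<open>\<tau>\<close> injective.\<close>
  define \<tau> where "\<tau> k s = (SOME t. t \<in> simplices X2 k \<and> cmap E k (?\<iota>1 s) = ?\<iota>2 t)" for k s
  have \<tau>: "\<tau> k s \<in> simplices X2 k" "cmap E k (?\<iota>1 s) = ?\<iota>2 (\<tau> k s)" if "s \<in> simplices X1 k" for k s
  proof -
    have "\<tau> k s \<in> simplices X2 k \<and> cmap E k (?\<iota>1 s) = ?\<iota>2 (\<tau> k s)"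
      unfolding \<tau>_def by (rule someI_ex) (use fwd(1)[OF that] in blast)
    then show "\<tau> k s \<in> simplices X2 k" "cmap E k (?\<iota>1 s) = ?\<iota>2 (\<tau> k s)" by blast+
  qed
  have \<tau>_eqI: "\<tau> k s = t" if "s \<in> simplices X1 k" "t \<in> simplices X2 k" "cmap E k (?\<iota>1 s) = ?\<iota>2 t" for k s t
    using inj2[OF \<tau>(1)[OF that(1)] that(2)] \<tau>(2)[OF that(1)] that(3) by simp
  have \<tau>_inj: "s = s'" if "s \<in> simplices X1 k" "s' \<in> simplices X1 k" "\<tau> k s = \<tau> k s'" for k s s'
  proof -
    have "cmap E k (?\<iota>1 s) = cmap E k (?\<iota>1 s')" using \<tau>(2)[OF that(1)] \<tau>(2)[OF that(2)] that(3) by simp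
    then have "?\<iota>1 s = ?\<iota>1 s'"
      by (rule inj_onD[OF bij_betw_imp_inj_on[OF bij(1)] _ orig1[OF that(1)] orig1[OF that(2)]])
    then show ?thesis using inj1[OF that(1,2)] by blast
  qed
  have \<tau>_surj: "\<exists>s\<in>simplices X1 k. \<tau> k s = t" if "t \<in> simplices X2 k" for k t
    using bwd_cell[OF that] \<tau>_eqI[OF _ that] by blast
  \<comment> \<open>An occurrence is just the pair of its ends, and \<open>E\<close> commutes with
    both projections.\<close>
  have occ: "e' = (\<tau> (Suc k) (fst e), \<tau> k (snd e))"
    if e: "e \<in> occurrences X1 k" and e': "e' \<in> occurrences X2 k" and eq: "omap E k (?\<kappa>1 e) = ?\<kappa>2 e'" for k e e'
  proof -
    interpret u1: equivariant_map U1.G occ_act "occurrences X1 k" cell_act "simplices X1 (Suc k)" fst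
      by (rule U1.equivariant_upper)
    interpret l1: equivariant_map U1.G occ_act "occurrences X1 k" cell_act "simplices X1 k" snd
      by (rule U1.equivariant_lower)
    interpret u2: equivariant_map U2.G occ_act "occurrences X2 k" cell_act "simplices X2 (Suc k)" fst
      by (rule U2.equivariant_upper)
    interpret l2: equivariant_map U2.G occ_act "occurrences X2 k" cell_act "simplices X2 k" snd
      by (rule U2.equivariant_lower)
    have "cmap E (Suc k) (upper ?I k (?\<kappa>1 e)) = upper ?J k (?\<kappa>2 e') \<and> cmap E k (lower ?I k (?\<kappa>1 e)) = lower ?J k (?\<kappa>2 e')"
      using E orig1'[OF e] unfolding residual_iso_def eq[symmetric] by blast
    then have "cmap E (Suc k) (?\<iota>1 (fst e)) = ?\<iota>2 (fst e')" "cmap E k (?\<iota>1 (snd e)) = ?\<iota>2 (snd e')"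
      by (simp_all only: U1.completed_simps U2.completed_simps u1.image_orig[OF e] l1.image_orig[OF e]
          u2.image_orig[OF e'] l2.image_orig[OF e'])
    then have "\<tau> (Suc k) (fst e) = fst e'" "\<tau> k (snd e) = snd e'"
      using \<tau>_eqI u1.maps_to[OF e] l1.maps_to[OF e] u2.maps_to[OF e'] l2.maps_to[OF e'] by blast+
    then show ?thesis by simp
  qed
  have occ_fwd: "(\<tau> (Suc k) s, \<tau> k t) \<in> occurrences X2 k \<and> omap E k (?\<kappa>1 (s, t)) = ?\<kappa>2 (\<tau> (Suc k) s, \<tau> k t)"
    if "(s, t) \<in> occurrences X1 k" for k s t
    using fwd(2)[OF that] occ[OF that] by fastforce
  define \<theta> where "\<theta> v = the_elem (\<tau> 0 {v})" for v
  have \<tau>0: "\<tau> 0 {v} = {\<theta> v}" if v: "v \<in> verts X1" for v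
  proof -
    obtain w where "\<tau> 0 {v} = {w}" using U2.simplices_0[OF \<tau>(1)[OF U1.vertex_dim[OF v]]] by blast
    then show ?thesis by (simp add: \<theta>_def)
  qed
  have \<tau>_image: "\<tau> k s = \<theta> ` s" if "s \<in> simplices X1 k" for k s
    using that
  proof (induction k arbitrary: s)
    case 0
    obtain v where "v \<in> verts X1" "s = {v}" using U1.simplices_0[OF 0] by (elim bexE)
    then show ?case using \<tau>0 by simp
  next
    case (Suc k)
    have s: "card s = Suc (Suc k)" "finite s"
      using Suc.prems U1.X.simplexD(1)[of s] by (simp_all add: simplices_def)
    have t: "card (\<tau> (Suc k) s) = Suc (Suc k)" "finite (\<tau> (Suc k) s)"
      using \<tau>(1)[OF Suc.prems] U2.X.simplexD(1)[of "\<tau> (Suc k) s"] by (simp_all add: simplices_def)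
    show ?case
    proof
      \<comment> \<open>A vertex \<open>v\<close> is caught in the facet opposite to another vertex
        \<open>w\<close>, and the induction hypothesis applies to that facet.\<close>
      show "\<theta> ` s \<subseteq> \<tau> (Suc k) s"
      proof (rule image_subsetI)
        fix v assume v: "v \<in> s"
        have "card (s - {v}) > 0" using s v by simp
        then obtain w where w: "w \<in> s" "w \<noteq> v" by (metis Diff_iff card_gt_0_iff ex_in_conv insertI1)
        note f = U1.facet_occurrence[OF Suc.prems w(1)]
        have "\<tau> k (s - {w}) \<subseteq> \<tau> (Suc k) s" using occ_fwd[OF f(2)] by (auto simp: occurrences_def)
        then show "\<theta> v \<in> \<tau> (Suc k) s" using Suc.IH[OF f(1)] v w by blast
      qed
      \<comment> \<open>A facet of the image belongs to the image of some occurrence, and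
        injectivity of \<open>\<tau>\<close> identifies the larger simplex of that occurrence with
        \<open>s\<close>.\<close>
      show "\<tau> (Suc k) s \<subseteq> \<theta> ` s"
      proof
        fix v assume v: "v \<in> \<tau> (Suc k) s"
        have "card (\<tau> (Suc k) s - {v}) > 0" using t v by simp
        then obtain w where w: "w \<in> \<tau> (Suc k) s" "w \<noteq> v" by (metis Diff_iff card_gt_0_iff ex_in_conv insertI1)
        note f = U2.facet_occurrence[OF \<tau>(1)[OF Suc.prems] w(1)]
        obtain e where e: "e \<in> occurrences X1 k" "omap E k (?\<kappa>1 e) = ?\<kappa>2 (\<tau> (Suc k) s, \<tau> (Suc k) s - {w})"
          using bwd_occ[OF f(2)] by blast
        have eq: "\<tau> (Suc k) s = \<tau> (Suc k) (fst e)" "\<tau> (Suc k) s - {w} = \<tau> k (snd e)"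
          using occ[OF e(1) f(2) e(2)] unfolding prod.inject by blast+
        have e1: "fst e \<in> simplices X1 (Suc k)" "snd e \<in> simplices X1 k" "snd e \<subseteq> fst e"
          using e(1) by (auto simp: occurrences_def)
        have "fst e = s" using \<tau>_inj[OF e1(1) Suc.prems] eq(1) by simp
        then have "\<tau> k (snd e) \<subseteq> \<theta> ` s" using Suc.IH[OF e1(2)] e1(3) by blast
        then show "v \<in> \<theta> ` s" using eq(2) v w by blast
      qed
    qed
  qed
  have restr: "restricts_to U1.G X1 U2.G E \<theta>"
    unfolding restricts_to_def
  proof (intro allI conjI ballI)
    fix k s assume "s \<in> simplices X1 k"
    then show "cmap E k (?\<iota>1 s) = ?\<iota>2 (\<theta> ` s)" using \<tau>(2) \<tau>_image by simp
  next
    fix k e assume e: "e \<in> occurrences X1 k"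
    obtain s t where st: "e = (s, t)" by (cases e)
    have "s \<in> simplices X1 (Suc k)" "t \<in> simplices X1 k" using e st by (auto simp: occurrences_def)
    then show "case e of (s, t) \<Rightarrow> omap E k (?\<kappa>1 (s, t)) = ?\<kappa>2 (\<theta> ` s, \<theta> ` t)"
      using occ_fwd[of s t k] e st \<tau>_image by simp
  qed
  have \<theta>_inj: "inj_on \<theta> (verts X1)"
  proof (rule inj_onI)
    fix v w assume vw: "v \<in> verts X1" "w \<in> verts X1" "\<theta> v = \<theta> w"
    then have "{v} = {w}"
      using \<tau>_inj[OF U1.vertex_dim[OF vw(1)] U1.vertex_dim[OF vw(2)]] \<tau>0[OF vw(1)] \<tau>0[OF vw(2)] by simp
    then show "v = w" by simp
  qed
  have \<theta>_simplex: "\<theta> ` s \<in> X2" if "s \<in> X1" for s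
    using \<tau>(1)[OF U1.simplex_dim[OF that]] \<tau>_image[OF U1.simplex_dim[OF that]] by (simp add: simplices_def)
  have \<theta>_lift: "\<exists>s\<in>X1. t = \<theta> ` s" if t: "t \<in> X2" for t
  proof -
    obtain s where "s \<in> simplices X1 (card t - 1)" "\<tau> (card t - 1) s = t"
      using \<tau>_surj[OF U2.simplex_dim[OF t]] by blast
    then show ?thesis using \<tau>_image by (auto simp: simplices_def)
  qed
  have "simplicial_iso X1 X2 \<theta>"
    unfolding simplicial_iso_def bij_betw_def
  proof (intro conjI allI impI \<theta>_inj)
    show "\<theta> ` verts X1 = verts X2"
    proof
      show "\<theta> ` verts X1 \<subseteq> verts X2" using \<theta>_simplex by blast
      show "verts X2 \<subseteq> \<theta> ` verts X1"
      proof
        fix w assume "w \<in> verts X2"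
        then obtain t where t: "t \<in> X2" "w \<in> t" by blast
        then obtain s where "s \<in> X1" "t = \<theta> ` s" using \<theta>_lift[OF t(1)] by blast
        then show "w \<in> \<theta> ` verts X1" using t by blast
      qed
    qed
    fix s assume s: "s \<subseteq> verts X1"
    show "\<theta> ` s \<in> X2 \<longleftrightarrow> s \<in> X1"
    proof
      assume "\<theta> ` s \<in> X2"
      then obtain s' where s': "s' \<in> X1" "\<theta> ` s = \<theta> ` s'" using \<theta>_lift by blast
      have "s' \<subseteq> verts X1" using s' by blast
      then have "s = s'" using inj_on_image_eq_iff[OF \<theta>_inj s, of s'] s'(2) by simp
      then show "s \<in> X1" using s' by simp
    qed (rule \<theta>_simplex)
  qed
  then show "\<exists>\<theta>. simplicial_iso X1 X2 \<theta> \<and> restricts_to U1.G X1 U2.G E \<theta>" using restr by blast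
qed

text \<open>The fibres of the coverings are the orbits of the deck groups. Equivariance along
  \<open>h\<close> gives a map of orbits, and surjectivity of \<open>h\<close> makes it injective;
  simplices of the bases are compared through their lifts.\<close>

lemma simplicial_iso_descend:
  assumes U1: "universal_cover X1 p1 C1" and U2: "universal_cover X2 p2 C2"
    and \<theta>: "simplicial_iso X1 X2 \<theta>"
    and h: "h ` carrier (deck_group X1 p1) = carrier (deck_group X2 p2)"
    and equiv: "vertex_equivariant (deck_group X1 p1) X1 h \<theta>"
  shows "\<exists>\<theta>'. descends_to X1 p1 p2 \<theta> \<theta>' \<and> simplicial_iso C1 C2 \<theta>'"
proof -
  interpret U1: universal_cover X1 p1 C1 by (rule U1)
  interpret U2: universal_cover X2 p2 C2 by (rule U2)
  have bij: "bij_betw \<theta> (verts X1) (verts X2)" using \<theta> unfolding simplicial_iso_def by blast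
  have \<theta>v: "\<theta> v \<in> verts X2" if "v \<in> verts X1" for v using bij_betw_apply[OF bij that] .
  have fibre: "p1 v = p1 w \<longleftrightarrow> p2 (\<theta> v) = p2 (\<theta> w)" if v: "v \<in> verts X1" and w: "w \<in> verts X1" for v w
  proof
    assume "p1 v = p1 w"
    then obtain g where g: "g \<in> carrier U1.G" "g v = w" using U1.deck_transitive_vertex[OF v w] by blast
    have hg: "h g \<in> carrier U2.G" using h g(1) by blast
    have "\<theta> w = h g (\<theta> v)" using equiv g v unfolding vertex_equivariant_def by blast
    then show "p2 (\<theta> v) = p2 (\<theta> w)" using U2.deck_apply(2)[OF hg \<theta>v[OF v]] by simp
  next
    assume "p2 (\<theta> v) = p2 (\<theta> w)"
    then obtain k where k: "k \<in> carrier U2.G" "k (\<theta> v) = \<theta> w"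
      using U2.deck_transitive_vertex[OF \<theta>v[OF v] \<theta>v[OF w]] by blast
    obtain g where g: "g \<in> carrier U1.G" "k = h g" using k(1) unfolding h[symmetric] by blast
    have "\<theta> (g v) = h g (\<theta> v)" using equiv g(1) v unfolding vertex_equivariant_def by blast
    then have "\<theta> (g v) = \<theta> w" using k(2) g(2) by simp
    then have "g v = w" by (rule inj_onD[OF bij_betw_imp_inj_on[OF bij] _ U1.deck_apply(1)[OF g(1) v] w])
    then show "p1 v = p1 w" using U1.deck_apply(2)[OF g(1) v] by simp
  qed
  define r where "r a = (SOME v. v \<in> verts X1 \<and> p1 v = a)" for a
  have r: "r (p1 v) \<in> verts X1" "p1 (r (p1 v)) = p1 v" if "v \<in> verts X1" for v
  proof -
    have "r (p1 v) \<in> verts X1 \<and> p1 (r (p1 v)) = p1 v"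
      unfolding r_def by (rule someI[of _ v]) (use that in blast)
    then show "r (p1 v) \<in> verts X1" "p1 (r (p1 v)) = p1 v" by blast+
  qed
  define \<theta>' where "\<theta>' a = p2 (\<theta> (r a))" for a
  have desc: "\<theta>' (p1 v) = p2 (\<theta> v)" if "v \<in> verts X1" for v
    unfolding \<theta>'_def using fibre[OF r(1)[OF that] that] r(2)[OF that] by simp
  have desc_image: "\<theta>' ` p1 ` s = p2 ` \<theta> ` s" if "s \<subseteq> verts X1" for s
    unfolding image_image using desc subsetD[OF that] by (intro image_cong) auto
  have inj: "inj_on \<theta>' (verts C1)"
  proof (rule inj_onI)
    fix a b assume ab: "a \<in> verts C1" "b \<in> verts C1" "\<theta>' a = \<theta>' b"
    obtain v w where vw: "v \<in> verts X1" "a = p1 v" "w \<in> verts X1" "b = p1 w"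
      using ab(1,2) unfolding U1.image_verts[symmetric] by blast
    then show "a = b" using ab(3) fibre[OF vw(1,3)] desc by simp
  qed
  have "simplicial_iso C1 C2 \<theta>'"
    unfolding simplicial_iso_def bij_betw_def
  proof (intro conjI allI impI inj)
    have "\<theta>' ` p1 ` verts X1 = p2 ` \<theta> ` verts X1" by (rule desc_image) simp
    then show "\<theta>' ` verts C1 = verts C2"
      by (simp only: U1.image_verts U2.image_verts bij_betw_imp_surj_on[OF bij])
    fix s assume s: "s \<subseteq> verts C1"
    show "\<theta>' ` s \<in> C2 \<longleftrightarrow> s \<in> C1"
    proof
      assume "s \<in> C1"
      then obtain t where t: "t \<in> X1" "p1 ` t = s" using U1.simplex_lift by blast
      have "\<theta> ` t \<in> X2" using simplicial_iso_image[OF \<theta>] t by blast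
      moreover have "\<theta>' ` s = p2 ` \<theta> ` t" using desc_image[of t] t by blast
      ultimately show "\<theta>' ` s \<in> C2" using U2.p_simplex by simp
    next
      assume "\<theta>' ` s \<in> C2"
      then obtain t where t: "t \<in> X2" "p2 ` t = \<theta>' ` s" using U2.simplex_lift by blast
      obtain q where q: "q \<in> X1" "t = \<theta> ` q" using t(1) unfolding simplicial_iso_image[OF \<theta>, symmetric] by blast
      have "\<theta>' ` p1 ` q = \<theta>' ` s" using desc_image[of q] q t by blast
      moreover have "p1 ` q \<subseteq> verts C1" using U1.p_simplex[OF q(1)] by blast
      ultimately have "p1 ` q = s" using inj_on_image_eq_iff[OF inj _ s, of "p1 ` q"] by simp
      then show "s \<in> C1" using U1.p_simplex[OF q(1)] by simp
    qed
  qed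
  then show ?thesis using desc unfolding descends_to_def by blast
qed

section \<open>Compatible selections and their limits\<close>

lemma (in free_action) orbits_translate:
  assumes "B \<subseteq> A" "m \<le> n"
  shows "orbits (K_group G m) B \<phi> = translate \<phi> (K m) ` orbits (K_group G n) B \<phi>"
proof -
  have "orbits (K_group G l) B \<phi> = orb l ` B" for l by (auto simp: orbits_def)
  then show ?thesis using assms translate_K_orb by (simp add: image_image subset_iff cong: image_cong)
qed

context action_pair begin

text \<open>Every coset of \<open>K_sub G1 m\<close> is the coordinate of an embedded group element,
  so ranging over the completion covers all cosets.\<close>

lemma equivariant_iff:
  "(\<forall>c\<in>carrier (G1 Mod K_sub G1 m). \<forall>B\<in>A1.lev m.
      f (translate \<phi>1 c B) = translate \<phi>2 (induced_level_map G1 G2 \<Phi> m c) (f B)) \<longleftrightarrow>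
   (\<forall>x\<in>carrier G1.hat. \<forall>B\<in>A1.lev m.
      f (translate \<phi>1 (x (K_sub G1 m)) B) = translate \<phi>2 (\<Phi> x (K_sub G2 m)) (f B))"
proof -
  have "carrier (G1 Mod K_sub G1 m) = (\<lambda>x. x (K_sub G1 m)) ` carrier G1.hat"
  proof
    show "carrier (G1 Mod K_sub G1 m) \<subseteq> (\<lambda>x. x (K_sub G1 m)) ` carrier G1.hat"
    proof
      fix c assume "c \<in> carrier (G1 Mod K_sub G1 m)"
      then obtain g where "g \<in> carrier G1" "c = G1.embed g (K_sub G1 m)" by (auto simp: carrier_FactGroup)
      then show "c \<in> (\<lambda>x. x (K_sub G1 m)) ` carrier G1.hat" by blast
    qed
    show "(\<lambda>x. x (K_sub G1 m)) ` carrier G1.hat \<subseteq> carrier (G1 Mod K_sub G1 m)"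
    proof (rule image_subsetI)
      fix x assume "x \<in> carrier G1.hat"
      then obtain g where "g \<in> carrier G1" "x (K_sub G1 m) = K_sub G1 m #>\<^bsub>G1\<^esub> g"
        using G1.hat_coset_ex[OF _ G1.K_fi_normal] by metis
      then show "x (K_sub G1 m) \<in> carrier (G1 Mod K_sub G1 m)" by (auto simp: carrier_FactGroup)
    qed
  qed
  then show ?thesis by (simp add: induced_level_map_eq)
qed

lemma descends_image:
  assumes g: "descends n f m g" and mn: "m \<le> n" and B: "B1 \<subseteq> A1" "B2 \<subseteq> A2"
    and f: "f ` orbits (K_group G1 n) B1 \<phi>1 = orbits (K_group G2 n) B2 \<phi>2"
  shows "g ` orbits (K_group G1 m) B1 \<phi>1 = orbits (K_group G2 m) B2 \<phi>2"
proof -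
  have "orbits (K_group G1 n) B1 \<phi>1 \<subseteq> A1.lev n" using B by (auto simp: orbits_def)
  then have "g ` translate \<phi>1 (K_sub G1 m) ` orbits (K_group G1 n) B1 \<phi>1 =
      translate \<phi>2 (K_sub G2 m) ` f ` orbits (K_group G1 n) B1 \<phi>1"
    using g unfolding image_image descends_def by (intro image_cong) auto
  then show ?thesis
    using A1.orbits_translate[OF B(1) mn] A2.orbits_translate[OF B(2) mn] f by simp
qed

end

text \<open>Above dimension \<open>d\<close> there is only one extensional function on the empty
  set, so a family is known from its first \<open>d + 1\<close> members.\<close>

lemma finite_graded_maps:
  assumes A: "\<And>k. finite (A k)" "\<And>k. finite (B k)" "\<And>k. k > (d::nat) \<Longrightarrow> A k = {}"
  shows "finite {f. \<forall>k. f k \<in> A k \<rightarrow>\<^sub>E B k}"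
proof (rule inj_on_finite)
  show "inj_on (\<lambda>f. restrict f {..d}) {f. \<forall>k. f k \<in> A k \<rightarrow>\<^sub>E B k}"
  proof (rule inj_onI, rule ext)
    fix f g k assume f: "f \<in> {f. \<forall>k. f k \<in> A k \<rightarrow>\<^sub>E B k}" and g: "g \<in> {f. \<forall>k. f k \<in> A k \<rightarrow>\<^sub>E B k}"
      and eq: "restrict f {..d} = restrict g {..d}"
    show "f k = g k"
    proof (cases "k \<le> d")
      case True then show ?thesis using fun_cong[OF eq, of k] by simp
    next
      case False
      then have "A k = {}" using A(3)[of k] by simp
      moreover have "f k \<in> A k \<rightarrow>\<^sub>E B k" "g k \<in> A k \<rightarrow>\<^sub>E B k" using f g by blast+
      ultimately show ?thesis by simp
    qed
  qed
  show "(\<lambda>f. restrict f {..d}) ` {f. \<forall>k. f k \<in> A k \<rightarrow>\<^sub>E B k} \<subseteq> (\<Pi>\<^sub>E k\<in>{..d}. A k \<rightarrow>\<^sub>E B k)"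
    by (rule image_subsetI) (simp add: PiE_iff[of _ "{..d}"])
  show "finite (\<Pi>\<^sub>E k\<in>{..d}. A k \<rightarrow>\<^sub>E B k)"
    using A by (intro finite_PiE) auto
qed

locale cover_pair = U1: universal_cover X1 p1 C1 + U2: universal_cover X2 p2 C2 +
    completion_iso "deck_group X1 p1" "deck_group X2 p2" \<Phi>
  for X1 :: "'c set set" and p1 :: "'c \<Rightarrow> 'a" and C1 and X2 :: "'d set set" and p2 :: "'d \<Rightarrow> 'b" and C2 and \<Phi> +
  fixes M :: "nat \<Rightarrow> nat"
  assumes mono_M: "mono M" and unbounded_M: "\<forall>n. \<exists>j. n \<le> M j"
begin

abbreviation D1 where "D1 \<equiv> deck_group X1 p1"
abbreviation D2 where "D2 \<equiv> deck_group X2 p2"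

lemma action_pair_simplices: "action_pair D1 D2 \<Phi> cell_act (simplices X1 k) cell_act (simplices X2 k)"
  by (intro action_pair.intro completion_iso_axioms U1.free_action_simplices U2.free_action_simplices)

lemma action_pair_occurrences: "action_pair D1 D2 \<Phi> occ_act (occurrences X1 k) occ_act (occurrences X2 k)"
  by (intro action_pair.intro completion_iso_axioms U1.free_action_occurrences U2.free_action_occurrences)

abbreviation cell_iso where
  "cell_iso k \<equiv> action_pair.lev_iso D1 D2 \<Phi> cell_act (simplices X1 k) cell_act (simplices X2 k)"
abbreviation occ_iso where
  "occ_iso k \<equiv> action_pair.lev_iso D1 D2 \<Phi> occ_act (occurrences X1 k) occ_act (occurrences X2 k)"
abbreviation cell_descends where
  "cell_descends k \<equiv> action_pair.descends D1 D2 cell_act (simplices X1 k) cell_act"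
abbreviation occ_descends where
  "occ_descends k \<equiv> action_pair.descends D1 D2 occ_act (occurrences X1 k) occ_act"

lemma level_iso_iff:
  "level_iso D1 X1 D2 X2 \<Phi> m f \<longleftrightarrow> (\<forall>k. cell_iso k m (cmap f k) \<and> occ_iso k m (omap f k) \<and>
     (\<forall>e\<in>orbits (K_group D1 m) (occurrences X1 k) occ_act.
        cmap f (Suc k) (fst ` e) = fst ` omap f k e \<and> cmap f k (snd ` e) = snd ` omap f k e))"
proof -
  have c: "cell_iso k m (cmap f k) \<longleftrightarrow>
      bij_betw (cmap f k) (cells (level_complex D1 X1 m) k) (cells (level_complex D2 X2 m) k) \<and>
      (\<forall>c\<in>carrier (D1 Mod K_sub D1 m). \<forall>s\<in>cells (level_complex D1 X1 m) k.
         cmap f k (translate cell_act c s) = translate cell_act (induced_level_map D1 D2 \<Phi> m c) (cmap f k s))" for k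
    unfolding level_complex_simps action_pair.lev_iso_def[OF action_pair_simplices]
      action_pair.equivariant_iff[OF action_pair_simplices] ..
  have o: "occ_iso k m (omap f k) \<longleftrightarrow>
      bij_betw (omap f k) (occs (level_complex D1 X1 m) k) (occs (level_complex D2 X2 m) k) \<and>
      (\<forall>c\<in>carrier (D1 Mod K_sub D1 m). \<forall>e\<in>occs (level_complex D1 X1 m) k.
         omap f k (translate occ_act c e) = translate occ_act (induced_level_map D1 D2 \<Phi> m c) (omap f k e))" for k
    unfolding level_complex_simps action_pair.lev_iso_def[OF action_pair_occurrences]
      action_pair.equivariant_iff[OF action_pair_occurrences] ..
  have regroup: "(\<forall>k. P k \<and> Q k \<and> (\<forall>e\<in>Y k. R k e)) \<and> (\<forall>c\<in>S. \<forall>k. (\<forall>s\<in>C k. U c k s) \<and> (\<forall>e\<in>Y k. V c k e)) \<longleftrightarrow>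
      (\<forall>k. (P k \<and> (\<forall>c\<in>S. \<forall>s\<in>C k. U c k s)) \<and> (Q k \<and> (\<forall>c\<in>S. \<forall>e\<in>Y k. V c k e)) \<and> (\<forall>e\<in>Y k. R k e))"
    for P Q R S U V and C :: "nat \<Rightarrow> 'c set set set" and Y :: "nat \<Rightarrow> ('c set \<times> 'c set) set set"
    by blast
  show ?thesis
    unfolding level_iso_def residual_iso_def c o level_complex_simps by (rule regroup)
qed

lemma level_descends_iff:
  "level_descends D1 X1 D2 n f m g \<longleftrightarrow>
     (\<forall>k. cell_descends k n (cmap f k) m (cmap g k) \<and> occ_descends k n (omap f k) m (omap g k))"
  unfolding level_descends_def action_pair.descends_def[OF action_pair_simplices]
    action_pair.descends_def[OF action_pair_occurrences] level_complex_simps ..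

lemma finite_levels:
  "finite (orbits (K_group D1 m) (simplices X1 k) cell_act)" "finite (orbits (K_group D2 m) (simplices X2 k) cell_act)"
  "finite (orbits (K_group D1 m) (occurrences X1 k) occ_act)" "finite (orbits (K_group D2 m) (occurrences X2 k) occ_act)"
  using free_action.finite_lev[OF U1.free_action_simplices U1.finite_level_0_simplices]
    free_action.finite_lev[OF U2.free_action_simplices U2.finite_level_0_simplices]
    free_action.finite_lev[OF U1.free_action_occurrences U1.finite_level_0_occurrences]
    free_action.finite_lev[OF U2.free_action_occurrences U2.finite_level_0_occurrences] by blast+

text \<open>Maps are normalised outside their level, so that each level has only finitely many of
  them and pigeonholing applies.\<close>

definition level_maps where
  "level_maps m = {f. (\<forall>k. cmap f k \<in> orbits (K_group D1 m) (simplices X1 k) cell_act \<rightarrow>\<^sub>E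
        orbits (K_group D2 m) (simplices X2 k) cell_act) \<and>
      (\<forall>k. omap f k \<in> orbits (K_group D1 m) (occurrences X1 k) occ_act \<rightarrow>\<^sub>E
        orbits (K_group D2 m) (occurrences X2 k) occ_act)}"

lemma finite_level_maps: "finite (level_maps m :: ('c, 'd) level_map set)"
proof -
  obtain d where d: "\<And>k. k > d \<Longrightarrow> simplices X1 k = {}" using U1.simplices_bounded by blast
  have d': "occurrences X1 k = {}" if "k > d" for k using d[OF that] by (auto simp: occurrences_def)
  let ?A = "{f. \<forall>k. f k \<in> orbits (K_group D1 m) (simplices X1 k) cell_act \<rightarrow>\<^sub>E
        orbits (K_group D2 m) (simplices X2 k) cell_act}"
  let ?B = "{f. \<forall>k. f k \<in> orbits (K_group D1 m) (occurrences X1 k) occ_act \<rightarrow>\<^sub>E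
        orbits (K_group D2 m) (occurrences X2 k) occ_act}"
  have "finite ?A" by (rule finite_graded_maps[of _ _ d]) (use finite_levels d in \<open>auto simp: orbits_def\<close>)
  moreover have "finite ?B" by (rule finite_graded_maps[of _ _ d]) (use finite_levels d' in \<open>auto simp: orbits_def\<close>)
  ultimately have "finite ((\<lambda>(a, b). \<lparr>cmap = a, omap = b\<rparr>) ` (?A \<times> ?B) :: ('c, 'd) level_map set)" by blast
  moreover have "level_maps m \<subseteq> (\<lambda>(a, b). \<lparr>cmap = a, omap = b\<rparr>) ` (?A \<times> ?B)"
  proof
    fix f :: "('c, 'd) level_map" assume "f \<in> level_maps m"
    then show "f \<in> (\<lambda>(a, b). \<lparr>cmap = a, omap = b\<rparr>) ` (?A \<times> ?B)"
      by (intro image_eqI[of _ _ "(cmap f, omap f)"]) (simp_all add: level_maps_def)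
  qed
  ultimately show ?thesis by (rule finite_subset[rotated])
qed

text \<open>The isomorphism \<open>g0\<close>, unrelated to \<open>f\<close>, contributes the
  equality of cardinalities that turns the surjection descended from \<open>f\<close> into a
  bijection. Incidences descend because every occurrence at level \<open>m\<close> lifts to level
  \<open>n\<close>.\<close>

lemma level_descent:
  fixes f g0 :: "('c, 'd) level_map"
  assumes f: "level_iso D1 X1 D2 X2 \<Phi> n f" and g0: "level_iso D1 X1 D2 X2 \<Phi> m g0" and mn: "m \<le> n"
  shows "\<exists>g. g \<in> level_maps m \<and> level_iso D1 X1 D2 X2 \<Phi> m g \<and> level_descends D1 X1 D2 n f m g"
proof -
  define g :: "('c, 'd) level_map" where "g = \<lparr>
    cmap = \<lambda>k. restrict (action_pair.descent D1 D2 cell_act cell_act n (cmap f k) m)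
      (orbits (K_group D1 m) (simplices X1 k) cell_act),
    omap = \<lambda>k. restrict (action_pair.descent D1 D2 occ_act occ_act n (omap f k) m)
      (orbits (K_group D1 m) (occurrences X1 k) occ_act)\<rparr>"
  have cell: "cell_descends k n (cmap f k) m (cmap g k) \<and> cell_iso k m (cmap g k)" for k
  proof -
    interpret c: action_pair D1 D2 \<Phi> cell_act "simplices X1 k" cell_act "simplices X2 k"
      by (rule action_pair_simplices)
    have fk: "c.lev_iso n (cmap f k)" and gk: "c.lev_iso m (cmap g0 k)"
      using f g0 unfolding level_iso_iff by blast+
    have desc: "c.descends n (cmap f k) m (cmap g k)"
      using c.descends_descent[OF fk mn] c.A1.translate_lev mn by (simp add: c.descends_def g_def)
    moreover have "card (c.A1.lev m) = card (c.A2.lev m)"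
      using gk bij_betw_same_card by (auto simp: c.lev_iso_def)
    ultimately show ?thesis using c.lev_iso_descends[OF fk desc mn finite_levels(1)] by simp
  qed
  have occ: "occ_descends k n (omap f k) m (omap g k) \<and> occ_iso k m (omap g k)" for k
  proof -
    interpret o: action_pair D1 D2 \<Phi> occ_act "occurrences X1 k" occ_act "occurrences X2 k"
      by (rule action_pair_occurrences)
    have fk: "o.lev_iso n (omap f k)" and gk: "o.lev_iso m (omap g0 k)"
      using f g0 unfolding level_iso_iff by blast+
    have desc: "o.descends n (omap f k) m (omap g k)"
      using o.descends_descent[OF fk mn] o.A1.translate_lev mn by (simp add: o.descends_def g_def)
    moreover have "card (o.A1.lev m) = card (o.A2.lev m)"
      using gk bij_betw_same_card by (auto simp: o.lev_iso_def)
    ultimately show ?thesis using o.lev_iso_descends[OF fk desc mn finite_levels(3)] by simp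
  qed
  have commute: "cmap g (Suc k) (fst ` e) = fst ` omap g k e \<and> cmap g k (snd ` e) = snd ` omap g k e"
    if e: "e \<in> orbits (K_group D1 m) (occurrences X1 k) occ_act" for k e
  proof -
    interpret o: action_pair D1 D2 \<Phi> occ_act "occurrences X1 k" occ_act "occurrences X2 k"
      by (rule action_pair_occurrences)
    interpret u1: equivariant_map D1 occ_act "occurrences X1 k" cell_act "simplices X1 (Suc k)" fst
      by (rule U1.equivariant_upper)
    interpret l1: equivariant_map D1 occ_act "occurrences X1 k" cell_act "simplices X1 k" snd
      by (rule U1.equivariant_lower)
    interpret u2: equivariant_map D2 occ_act "occurrences X2 k" cell_act "simplices X2 (Suc k)" fst
      by (rule U2.equivariant_upper)
    interpret l2: equivariant_map D2 occ_act "occurrences X2 k" cell_act "simplices X2 k" snd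
      by (rule U2.equivariant_lower)
    obtain d where d: "d \<in> o.A1.lev n" "e = translate occ_act (K_sub D1 m) d" by (rule o.lev_lift[OF e mn])
    have fd: "omap f k d \<in> o.A2.lev n"
      using f d(1) unfolding level_iso_iff by (blast intro: o.lev_iso_lev)
    have com: "cmap f (Suc k) (fst ` d) = fst ` omap f k d" "cmap f k (snd ` d) = snd ` omap f k d"
      using f d(1) unfolding level_iso_iff by blast+
    have ge: "omap g k e = translate occ_act (K_sub D2 m) (omap f k d)"
      using occ[of k] d by (simp add: o.descends_def)
    have "cmap g (Suc k) (fst ` e) = translate cell_act (K_sub D2 m) (cmap f (Suc k) (fst ` d))"
      using cell[of "Suc k"] u1.image_lev[OF d(1)] u1.image_translate_K[OF d(1) mn] d(2)
      by (simp add: action_pair.descends_def[OF action_pair_simplices])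
    also have "\<dots> = fst ` omap g k e"
      unfolding ge com using u2.image_translate_K[OF fd mn] by simp
    finally have 1: "cmap g (Suc k) (fst ` e) = fst ` omap g k e" .
    have "cmap g k (snd ` e) = translate cell_act (K_sub D2 m) (cmap f k (snd ` d))"
      using cell[of k] l1.image_lev[OF d(1)] l1.image_translate_K[OF d(1) mn] d(2)
      by (simp add: action_pair.descends_def[OF action_pair_simplices])
    also have "\<dots> = snd ` omap g k e"
      unfolding ge com using l2.image_translate_K[OF fd mn] by simp
    finally show ?thesis using 1 by blast
  qed
  have "level_iso D1 X1 D2 X2 \<Phi> m g" unfolding level_iso_iff using cell occ commute by blast
  moreover have "level_descends D1 X1 D2 n f m g" unfolding level_descends_iff using cell occ by blast
  moreover have "g \<in> level_maps m"
  proof -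
    have "cmap g k \<in> orbits (K_group D1 m) (simplices X1 k) cell_act \<rightarrow>\<^sub>E orbits (K_group D2 m) (simplices X2 k) cell_act" for k
      using action_pair.lev_iso_lev[OF action_pair_simplices, of k m "cmap g k"] cell[of k]
      by (simp add: PiE_iff) (simp add: g_def)
    moreover have "omap g k \<in> orbits (K_group D1 m) (occurrences X1 k) occ_act \<rightarrow>\<^sub>E orbits (K_group D2 m) (occurrences X2 k) occ_act" for k
      using action_pair.lev_iso_lev[OF action_pair_occurrences, of k m "omap g k"] occ[of k]
      by (simp add: PiE_iff) (simp add: g_def)
    ultimately show ?thesis by (simp add: level_maps_def)
  qed
  ultimately show ?thesis by blast
qed

lemma level_descends_factor:
  assumes f: "level_iso D1 X1 D2 X2 \<Phi> n f" and "level_descends D1 X1 D2 n f m g" "level_descends D1 X1 D2 n f l h"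
    and "l \<le> m" "m \<le> n"
  shows "level_descends D1 X1 D2 m g l h"
  using assms action_pair.descends_factor[OF action_pair_simplices _ _ _ assms(4,5)]
    action_pair.descends_factor[OF action_pair_occurrences _ _ _ assms(4,5)]
  unfolding level_descends_iff level_iso_iff by metis

text \<open>\<open>Q\<close> stands for any property of level isomorphisms that passes to descents:
  equivariance alone, or equivariance together with preservation of the distinguished
  families.\<close>

lemma selection:
  fixes Q :: "nat \<Rightarrow> ('c, 'd) level_map \<Rightarrow> bool"
  assumes ex: "\<And>j. \<exists>f. Q j f" and iso: "\<And>j f. Q j f \<Longrightarrow> level_iso D1 X1 D2 X2 \<Phi> (M j) f"
    and desc: "\<And>j k f g. \<lbrakk>j \<le> k; Q k f; level_iso D1 X1 D2 X2 \<Phi> (M j) g;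
      level_descends D1 X1 D2 (M k) f (M j) g\<rbrakk> \<Longrightarrow> Q j g"
  shows "\<exists>f. compatible_selection D1 X1 D2 X2 \<Phi> M f \<and> (\<forall>j. Q j (f j))"
proof -
  obtain f where f: "\<And>k. Q k (f k)" using ex by metis
  define lifts where "lifts k j g \<longleftrightarrow> g \<in> level_maps (M j) \<and>
      level_iso D1 X1 D2 X2 \<Phi> (M j) g \<and> level_descends D1 X1 D2 (M k) (f k) (M j) g" for k j g
  define \<psi> where "\<psi> k j = (SOME g. lifts k j g)" for k j
  have \<psi>: "\<psi> k j \<in> level_maps (M j) \<and> level_iso D1 X1 D2 X2 \<Phi> (M j) (\<psi> k j) \<and>
      level_descends D1 X1 D2 (M k) (f k) (M j) (\<psi> k j)" if "j \<le> k" for j k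
  proof -
    have "\<exists>g. lifts k j g"
      unfolding lifts_def using level_descent[OF iso[OF f] iso[OF f] monoD[OF mono_M that]] .
    then have "lifts k j (\<psi> k j)" unfolding \<psi>_def by (rule someI_ex)
    then show ?thesis by (simp only: lifts_def)
  qed
  obtain v where v: "\<forall>j. \<exists>k\<ge>j. \<forall>i\<le>j. \<psi> k i = v i"
    using infinitely_often_thread[of "\<lambda>j. level_maps (M j)" \<psi>] finite_level_maps \<psi> by blast
  have vQ: "Q j (v j) \<and> level_iso D1 X1 D2 X2 \<Phi> (M j) (v j)" for j
  proof -
    obtain k where k: "j \<le> k" "\<forall>i\<le>j. \<psi> k i = v i" using v by blast
    then have "v j = \<psi> k j" by simp
    then show ?thesis using \<psi>[OF k(1)] desc[OF k(1) f, of "\<psi> k j"] by simp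
  qed
  have "level_descends D1 X1 D2 (M l) (v l) (M j) (v j)" if jl: "j \<le> l" for j l
  proof -
    obtain k where k: "l \<le> k" "\<forall>i\<le>l. \<psi> k i = v i" using v by blast
    \<comment> \<open>Both maps descend from the same \<open>f k\<close>, hence the higher one
      descends to the lower one.\<close>
    have "v l = \<psi> k l" "v j = \<psi> k j" using k jl by simp_all
    then show ?thesis
      using level_descends_factor[OF iso[OF f], of k "M l" "v l" "M j" "v j"] \<psi>[OF k(1)] \<psi>[OF order_trans[OF jl k(1)]]
        monoD[OF mono_M jl] monoD[OF mono_M k(1)] by simp
  qed
  then show ?thesis using vQ unfolding compatible_selection_def by blast
qed

lemma compatible_cells:
  assumes "compatible_selection D1 X1 D2 X2 \<Phi> M f"
  shows "cell_iso k (M j) (cmap (f j) k)" "occ_iso k (M j) (omap (f j) k)"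
    "i \<le> j \<Longrightarrow> cell_descends k (M j) (cmap (f j) k) (M i) (cmap (f i) k)"
    "i \<le> j \<Longrightarrow> occ_descends k (M j) (omap (f j) k) (M i) (omap (f i) k)"
    "e \<in> orbits (K_group D1 (M j)) (occurrences X1 k) occ_act \<Longrightarrow>
       cmap (f j) (Suc k) (fst ` e) = fst ` omap (f j) k e \<and> cmap (f j) k (snd ` e) = snd ` omap (f j) k e"
proof -
  have "level_iso D1 X1 D2 X2 \<Phi> (M j) (f j)" using assms unfolding compatible_selection_def by blast
  note iso = this[unfolded level_iso_iff, rule_format]
  show "cell_iso k (M j) (cmap (f j) k)" "occ_iso k (M j) (omap (f j) k)"
    using iso[of k] by (simp_all only:)
  show "cmap (f j) (Suc k) (fst ` e) = fst ` omap (f j) k e \<and> cmap (f j) k (snd ` e) = snd ` omap (f j) k e"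
    if "e \<in> orbits (K_group D1 (M j)) (occurrences X1 k) occ_act"
    using iso[of k] that by blast
next
  assume "i \<le> j"
  then have "level_descends D1 X1 D2 (M j) (f j) (M i) (f i)" using assms unfolding compatible_selection_def by blast
  note desc = this[unfolded level_descends_iff, rule_format]
  show "cell_descends k (M j) (cmap (f j) k) (M i) (cmap (f i) k)"
    "occ_descends k (M j) (omap (f j) k) (M i) (omap (f i) k)"
    using desc[of k] by (simp_all only:)
qed

section \<open>The inverse limit of a compatible selection, and its translates\<close>

lemma limit_iso_exists:
  assumes f: "compatible_selection D1 X1 D2 X2 \<Phi> M f"
  shows "\<exists>F. limit_iso D1 X1 D2 X2 M f F"
proof -
  note comp = compatible_cells[OF f]
  have "\<forall>k. \<exists>F. bij_betw F (cells (completed_complex D1 X1) k) (cells (completed_complex D2 X2) k) \<and>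
      (\<forall>\<xi>\<in>cells (completed_complex D1 X1) k. \<forall>j. F \<xi> (M j) = cmap (f j) k (\<xi> (M j)))"
    unfolding U1.completed_simps U2.completed_simps
    using action_pair.limit_exists[OF action_pair_simplices mono_M unbounded_M comp(1) comp(3)] by blast
  then obtain Fc where Fc: "\<And>k. bij_betw (Fc k) (cells (completed_complex D1 X1) k) (cells (completed_complex D2 X2) k)"
    "\<And>k \<xi> j. \<xi> \<in> cells (completed_complex D1 X1) k \<Longrightarrow> Fc k \<xi> (M j) = cmap (f j) k (\<xi> (M j))" by metis
  have "\<forall>k. \<exists>F. bij_betw F (occs (completed_complex D1 X1) k) (occs (completed_complex D2 X2) k) \<and>
      (\<forall>\<xi>\<in>occs (completed_complex D1 X1) k. \<forall>j. F \<xi> (M j) = omap (f j) k (\<xi> (M j)))"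
    unfolding U1.completed_simps U2.completed_simps
    using action_pair.limit_exists[OF action_pair_occurrences mono_M unbounded_M comp(2) comp(4)] by blast
  then obtain Fo where Fo: "\<And>k. bij_betw (Fo k) (occs (completed_complex D1 X1) k) (occs (completed_complex D2 X2) k)"
    "\<And>k \<xi> j. \<xi> \<in> occs (completed_complex D1 X1) k \<Longrightarrow> Fo k \<xi> (M j) = omap (f j) k (\<xi> (M j))" by metis
  let ?F = "\<lparr>cmap = Fc, omap = Fo\<rparr>"
  have commute: "Fc (Suc k) (upper (completed_complex D1 X1) k e) = upper (completed_complex D2 X2) k (Fo k e) \<and>
      Fc k (lower (completed_complex D1 X1) k e) = lower (completed_complex D2 X2) k (Fo k e)"
    if e: "e \<in> occs (completed_complex D1 X1) k" for k e
  proof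
    have Fe: "Fo k e \<in> occs (completed_complex D2 X2) k" using bij_betw_apply[OF Fo(1) e] .
    have lev: "e (M j) \<in> orbits (K_group D1 (M j)) (occurrences X1 k) occ_act" for j
      using free_action.completionD(1)[OF U1.free_action_occurrences] e by (simp add: U1.completed_simps)
    note up = U1.completed_closed[OF e] and up2 = U2.completed_closed[OF Fe]
    show "Fc (Suc k) (upper (completed_complex D1 X1) k e) = upper (completed_complex D2 X2) k (Fo k e)"
    proof (rule free_action.completion_eqI[OF U2.free_action_simplices _ _ unbounded_M])
      show "Fc (Suc k) (upper (completed_complex D1 X1) k e) \<in> free_action.completion D2 cell_act (simplices X2 (Suc k))"
        using bij_betw_apply[OF Fc(1) up(1)] by (simp only: U2.completed_simps)
      show "upper (completed_complex D2 X2) k (Fo k e) \<in> free_action.completion D2 cell_act (simplices X2 (Suc k))"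
        using up2(1) by (simp only: U2.completed_simps)
      show "Fc (Suc k) (upper (completed_complex D1 X1) k e) (M j) = upper (completed_complex D2 X2) k (Fo k e) (M j)" for j
        using Fc(2)[OF up(1), of j] Fo(2)[OF e, of j] comp(5)[OF lev[of j]]
        by (simp add: U1.completed_simps U2.completed_simps)
    qed
    show "Fc k (lower (completed_complex D1 X1) k e) = lower (completed_complex D2 X2) k (Fo k e)"
    proof (rule free_action.completion_eqI[OF U2.free_action_simplices _ _ unbounded_M])
      show "Fc k (lower (completed_complex D1 X1) k e) \<in> free_action.completion D2 cell_act (simplices X2 k)"
        using bij_betw_apply[OF Fc(1) up(2)] by (simp only: U2.completed_simps)
      show "lower (completed_complex D2 X2) k (Fo k e) \<in> free_action.completion D2 cell_act (simplices X2 k)"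
        using up2(2) by (simp only: U2.completed_simps)
      show "Fc k (lower (completed_complex D1 X1) k e) (M j) = lower (completed_complex D2 X2) k (Fo k e) (M j)" for j
        using Fc(2)[OF up(2), of j] Fo(2)[OF e, of j] comp(5)[OF lev[of j]]
        by (simp add: U1.completed_simps U2.completed_simps)
    qed
  qed
  have "limit_iso D1 X1 D2 X2 M f ?F"
    unfolding limit_iso_def residual_iso_def using Fc Fo commute by simp
  then show ?thesis by blast
qed

lemma limit_iso_equivariant:
  assumes f: "compatible_selection D1 X1 D2 X2 \<Phi> M f" and F: "limit_iso D1 X1 D2 X2 M f F"
    and x: "x \<in> carrier (profinite_completion D1)" and \<xi>: "\<xi> \<in> cells (completed_complex D1 X1) k"
  shows "cmap F k (completed_act D1 cell_act x \<xi>) = completed_act D2 cell_act (\<Phi> x) (cmap F k \<xi>)"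
proof (rule action_pair.limit_equivariant[OF action_pair_simplices unbounded_M compatible_cells(1)[OF f] _ _ x])
  have bij: "bij_betw (cmap F k) (cells (completed_complex D1 X1) k) (cells (completed_complex D2 X2) k)"
    using F by (simp add: limit_iso_def residual_iso_def)
  show "cmap F k \<eta> \<in> free_action.completion D2 cell_act (simplices X2 k)"
    if "\<eta> \<in> free_action.completion D1 cell_act (simplices X1 k)" for \<eta>
    using bij_betw_apply[OF bij] that by (simp add: U1.completed_simps U2.completed_simps)
  show "cmap F k \<eta> (M j) = cmap (f j) k (\<eta> (M j))"
    if "\<eta> \<in> free_action.completion D1 cell_act (simplices X1 k)" for \<eta> j
    using F that by (simp add: limit_iso_def U1.completed_simps)
  show "\<xi> \<in> free_action.completion D1 cell_act (simplices X1 k)" using \<xi> by (simp add: U1.completed_simps)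
qed

lemma residual_iso_twisted:
  assumes F: "residual_iso (completed_complex D1 X1) (completed_complex D2 X2) F" and u: "u \<in> carrier (profinite_completion D2)"
  shows "residual_iso (completed_complex D1 X1) (completed_complex D2 X2) (twisted_map D2 u F)"
  unfolding residual_iso_def
proof (intro allI conjI ballI)
  fix k
  let ?y = "inv\<^bsub>profinite_completion D2\<^esub> u"
  have y: "?y \<in> carrier (profinite_completion D2)" using u by simp
  have bij: "bij_betw (cmap F k) (cells (completed_complex D1 X1) k) (cells (completed_complex D2 X2) k)"
    "bij_betw (omap F k) (occs (completed_complex D1 X1) k) (occs (completed_complex D2 X2) k)"
    using F by (simp_all add: residual_iso_def)
  have "bij_betw (completed_act D2 cell_act ?y) (cells (completed_complex D2 X2) k) (cells (completed_complex D2 X2) k)"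
    using free_action.bij_betw_act[OF U2.free_action_simplices y] by (simp only: U2.completed_simps)
  from bij_betw_trans[OF bij(1) this]
  show "bij_betw (cmap (twisted_map D2 u F) k) (cells (completed_complex D1 X1) k) (cells (completed_complex D2 X2) k)"
    by (simp add: twisted_map_def comp_def)
  have "bij_betw (completed_act D2 occ_act ?y) (occs (completed_complex D2 X2) k) (occs (completed_complex D2 X2) k)"
    using free_action.bij_betw_act[OF U2.free_action_occurrences y] by (simp only: U2.completed_simps)
  from bij_betw_trans[OF bij(2) this]
  show "bij_betw (omap (twisted_map D2 u F) k) (occs (completed_complex D1 X1) k) (occs (completed_complex D2 X2) k)"
    by (simp add: twisted_map_def comp_def)
  fix e assume e: "e \<in> occs (completed_complex D1 X1) k"
  have Fe: "omap F k e \<in> free_action.completion D2 occ_act (occurrences X2 k)"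
    using bij_betw_apply[OF bij(2) e] by (simp only: U2.completed_simps)
  have com: "cmap F (Suc k) (upper (completed_complex D1 X1) k e) = upper (completed_complex D2 X2) k (omap F k e)"
    "cmap F k (lower (completed_complex D1 X1) k e) = lower (completed_complex D2 X2) k (omap F k e)"
    using F e unfolding residual_iso_def by blast+
  show "cmap (twisted_map D2 u F) (Suc k) (upper (completed_complex D1 X1) k e) =
      upper (completed_complex D2 X2) k (omap (twisted_map D2 u F) k e)"
    using com(1) equivariant_map.image_act[OF U2.equivariant_upper y Fe]
    by (simp add: twisted_map_def U2.completed_simps)
  show "cmap (twisted_map D2 u F) k (lower (completed_complex D1 X1) k e) =
      lower (completed_complex D2 X2) k (omap (twisted_map D2 u F) k e)"
    using com(2) equivariant_map.image_act[OF U2.equivariant_lower y Fe]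
    by (simp add: twisted_map_def U2.completed_simps)
qed

end

section \<open>Recovering the isomorphism of groups\<close>

text \<open>A map of completions that is determined level by level is known from its values on the
  image of \<open>G1\<close>. With \<open>n\<close> the index of \<open>N\<close>, both
  \<open>N\<close> and its preimage under \<open>h\<close> contain the respective
  \<open>K_sub\<close> at \<open>n\<close>, so one embedded \<open>g\<close> computes both sides at
  \<open>N\<close>.\<close>

lemma (in completion_iso) completion_map_eq:
  assumes h: "h \<in> hom G1 G2"
    and \<Psi>: "\<And>x. x \<in> carrier G1.hat \<Longrightarrow> \<Psi> x \<in> carrier G2.hat"
    and level: "\<And>x y m. \<lbrakk>x \<in> carrier G1.hat; y \<in> carrier G1.hat; x (K_sub G1 m) = y (K_sub G1 m)\<rbrakk> \<Longrightarrow>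
      \<Psi> x (K_sub G2 m) = \<Psi> y (K_sub G2 m)"
    and embed: "\<And>g. g \<in> carrier G1 \<Longrightarrow> \<Psi> (G1.embed g) = G2.embed (h g)"
    and x: "x \<in> carrier G1.hat"
  shows "completion_map G1 G2 h x = \<Psi> x"
proof
  fix N
  interpret h: group_hom G1 G2 h using h by unfold_locales
  show "completion_map G1 G2 h x N = \<Psi> x N"
  proof (cases "N \<in> fi_normal G2")
    case False
    then show ?thesis using \<Psi>[OF x] by (simp add: completion_map_def G2.hat_iff extensional_def)
  next
    case N: True
    note ND = G2.fi_normalD[OF N]
    let ?N' = "{g \<in> carrier G1. h g \<in> N}"
    define n where "n = card (rcosets\<^bsub>G2\<^esub> N)"
    note pre = G1.index_le_vimage[OF G2.is_group h ND(2,3)]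
    have normal: "?N' \<lhd> G1"
    proof (rule G1.normal_invI[OF pre(1)])
      fix g k assume g: "g \<in> carrier G1" and k: "k \<in> ?N'"
      have "h g \<otimes>\<^bsub>G2\<^esub> h k \<otimes>\<^bsub>G2\<^esub> inv\<^bsub>G2\<^esub> h g \<in> N"
        using normal.inv_op_closed2[OF ND(1)] g k by simp
      then show "g \<otimes>\<^bsub>G1\<^esub> k \<otimes>\<^bsub>G1\<^esub> inv\<^bsub>G1\<^esub> g \<in> ?N'" using g k by simp
    qed
    have N': "?N' \<in> fi_normal G1" using normal pre(2) by (simp add: fi_normal_def)
    have K1: "K_sub G1 n \<subseteq> ?N'" using G1.K_sub_subset_finite_index[OF pre(1,2)] pre(3) by (simp add: n_def)
    have K2: "K_sub G2 n \<subseteq> N" using G2.K_sub_subset_finite_index[OF ND(2,3)] by (simp add: n_def)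
    obtain g where g: "g \<in> carrier G1" "x (K_sub G1 n) = K_sub G1 n #>\<^bsub>G1\<^esub> g"
      using G1.hat_coset_ex[OF x G1.K_fi_normal] by blast
    have xN: "x ?N' = ?N' #>\<^bsub>G1\<^esub> g" by (rule G1.hat_coset_mono[OF x G1.K_fi_normal N' K1 g])
    have "N <#>\<^bsub>G2\<^esub> (h ` (?N' #>\<^bsub>G1\<^esub> g)) = N #>\<^bsub>G2\<^esub> h g"
    proof
      show "N <#>\<^bsub>G2\<^esub> (h ` (?N' #>\<^bsub>G1\<^esub> g)) \<subseteq> N #>\<^bsub>G2\<^esub> h g"
      proof
        fix z assume "z \<in> N <#>\<^bsub>G2\<^esub> (h ` (?N' #>\<^bsub>G1\<^esub> g))"
        then obtain a k where a: "a \<in> N" and k: "k \<in> carrier G1" "h k \<in> N" and z: "z = a \<otimes>\<^bsub>G2\<^esub> h (k \<otimes>\<^bsub>G1\<^esub> g)"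
          by (auto simp: set_mult_def r_coset_def)
        have "a \<in> carrier G2" using a ND(4) by blast
        then have "z = (a \<otimes>\<^bsub>G2\<^esub> h k) \<otimes>\<^bsub>G2\<^esub> h g" using z k g by (simp add: G2.m_assoc)
        moreover have "a \<otimes>\<^bsub>G2\<^esub> h k \<in> N" using a k ND(2) by (simp add: subgroup.m_closed)
        ultimately show "z \<in> N #>\<^bsub>G2\<^esub> h g" by (auto simp: r_coset_def)
      qed
      show "N #>\<^bsub>G2\<^esub> h g \<subseteq> N <#>\<^bsub>G2\<^esub> (h ` (?N' #>\<^bsub>G1\<^esub> g))"
      proof -
        have "g \<in> ?N' #>\<^bsub>G1\<^esub> g" by (rule G1.rcos_self[OF g(1) pre(1)])
        then have "h g \<in> h ` (?N' #>\<^bsub>G1\<^esub> g)" by blast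
        then show ?thesis unfolding set_mult_def r_coset_def[of G2] by blast
      qed
    qed
    then have 1: "completion_map G1 G2 h x N = N #>\<^bsub>G2\<^esub> h g" using N xN by (simp add: completion_map_def)
    have "\<Psi> x (K_sub G2 n) = \<Psi> (G1.embed g) (K_sub G2 n)" by (rule level) (use x g in simp_all)
    then have "\<Psi> x (K_sub G2 n) = K_sub G2 n #>\<^bsub>G2\<^esub> h g" using embed[OF g(1)] by simp
    then have "\<Psi> x N = N #>\<^bsub>G2\<^esub> h g"
      using G2.hat_coset_mono[OF \<Psi>[OF x] G2.K_fi_normal N K2] g by simp
    then show ?thesis using 1 by simp
  qed
qed

context cover_pair begin

text \<open>Translation by \<open>inv u\<close> makes one vertex go to an original one, as
  \<open>originals_vertex_map\<close> requires, and replaces \<open>\<Phi>\<close> by its conjugate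
  \<open>\<Psi>\<close>. For \<open>g\<close> in the first deck group, \<open>\<Psi>\<close> of the
  embedded \<open>g\<close> takes the original vertex \<open>w0\<close> to an original vertex, so it
  comes from an element \<open>h g\<close> of the second.\<close>

lemma limit_realized:
  assumes rf1: "residually_finite D1" and rf2: "residually_finite D2"
    and f: "compatible_selection D1 X1 D2 X2 \<Phi> M f" and F: "limit_iso D1 X1 D2 X2 M f F"
  shows "\<exists>u\<in>carrier (profinite_completion D2). \<exists>h\<in>iso D1 D2.
      (\<forall>x\<in>carrier (profinite_completion D1).
         \<Phi> x = Inn (profinite_completion D2) u (completion_map D1 D2 h x)) \<and>
      maps_originals_onto D1 X1 D2 X2 (twisted_map D2 u F) \<and>
      (\<exists>\<theta> \<theta>'. restricts_to D1 X1 D2 (twisted_map D2 u F) \<theta> \<and>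
         simplicial_iso X1 X2 \<theta> \<and> vertex_equivariant D1 X1 h \<theta> \<and>
         descends_to X1 p1 p2 \<theta> \<theta>' \<and>
         simplicial_iso C1 C2 \<theta>' \<and>
         PL_homeomorphism (realization C1) (realization C2) (realize \<theta>') \<and>
         induces_up_to_conjugacy X1 p1 C1 X2 p2 C2 \<theta>' h)"
proof -
  interpret A1: free_action D1 cell_act "simplices X1 0" by (rule U1.free_action_simplices)
  interpret A2: free_action D2 cell_act "simplices X2 0" by (rule U2.free_action_simplices)
  let ?H1 = "profinite_completion D1" and ?H2 = "profinite_completion D2"
  have Fiso: "residual_iso (completed_complex D1 X1) (completed_complex D2 X2) F"
    using F by (simp add: limit_iso_def)
  obtain v0 where v0: "v0 \<in> verts X1"
  proof -
    obtain c where "c \<in> C1" using U1.nonempty_base by blast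
    then obtain s where "s \<in> X1" using U1.simplex_lift by blast
    then show ?thesis using that U1.X.simplexD(2) by blast
  qed
  have \<iota>v: "A1.orig {v} \<in> A1.completion" if "v \<in> verts X1" for v
    using A1.orig_completion[OF U1.vertex_dim[OF that]] .
  have bij0: "bij_betw (cmap f 0) A1.completion A2.completion"
    if "residual_iso (completed_complex D1 X1) (completed_complex D2 X2) f" for f
    using that by (simp add: residual_iso_def U1.completed_simps U2.completed_simps)
  have F0: "cmap F 0 (A1.orig {v0}) \<in> A2.completion"
    by (rule bij_betw_apply[OF bij0[OF Fiso] \<iota>v[OF v0]])
  \<comment> \<open>The coordinate at level 0 names a vertex \<open>w0\<close> in the right orbit;
    what remains is an element \<open>u\<close> of the completion.\<close>
  obtain s where s: "s \<in> simplices X2 0" "cmap F 0 (A1.orig {v0}) 0 = A2.orb 0 s"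
    using A2.levE[OF A2.completionD(1)[OF F0]] by blast
  obtain w0 where w0: "w0 \<in> verts X2" "s = {w0}" using U2.simplices_0[OF s(1)] by blast
  obtain u where u: "u \<in> carrier ?H2" "cmap F 0 (A1.orig {v0}) = A2.act u (A2.orig {w0})"
    using A2.completion_decompose[OF F0 s] w0 by blast
  let ?E = "twisted_map D2 u F"
  have E: "residual_iso (completed_complex D1 X1) (completed_complex D2 X2) ?E"
    by (rule residual_iso_twisted[OF Fiso u(1)])
  have \<iota>w0: "A2.orig {w0} \<in> A2.completion" using s(1) w0 by blast
  have E0: "cmap ?E 0 (A1.orig {v0}) = A2.orig {w0}"
    using u A2.act_inv_cancel(1)[OF u(1) \<iota>w0] by (simp add: twisted_map_def)
  note onto = originals_vertex_map(1)[OF U1.universal_cover_axioms U2.universal_cover_axioms rf1 rf2 E v0 w0(1) E0]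
  obtain \<theta> where \<theta>: "simplicial_iso X1 X2 \<theta>" and restr: "restricts_to D1 X1 D2 ?E \<theta>"
    using originals_vertex_map(2)[OF U1.universal_cover_axioms U2.universal_cover_axioms rf1 rf2 E v0 w0(1) E0] by blast
  have \<theta>bij: "bij_betw \<theta> (verts X1) (verts X2)" using \<theta> unfolding simplicial_iso_def by blast
  have E_vertex: "cmap ?E 0 (A1.orig {v}) = A2.orig {\<theta> v}" if "v \<in> verts X1" for v
  proof -
    have "cmap ?E 0 (A1.orig {v}) = A2.orig (\<theta> ` {v})"
      using restr U1.vertex_dim[OF that] unfolding restricts_to_def by blast
    then show ?thesis by simp
  qed
  have \<theta>v: "\<theta> v \<in> verts X2" if "v \<in> verts X1" for v using bij_betw_apply[OF \<theta>bij that] .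
  \<comment> \<open>\<open>?E\<close> is \<open>F\<close> followed by \<open>inv u\<close>, hence it
    is equivariant along this conjugate of \<open>\<Phi>\<close>.\<close>
  define \<Psi> where "\<Psi> x = inv\<^bsub>?H2\<^esub> u \<otimes>\<^bsub>?H2\<^esub> \<Phi> x \<otimes>\<^bsub>?H2\<^esub> u" for x
  have iu: "inv\<^bsub>?H2\<^esub> u \<in> carrier ?H2" using U2.deck.hat.inv_closed[OF u(1)] .
  have \<Psi>_closed: "\<Psi> x \<in> carrier ?H2" if "x \<in> carrier ?H1" for x
    unfolding \<Psi>_def using u(1) iu \<Phi>_closed[OF that] by (intro U2.deck.hat.m_closed)
  have \<Psi>_inj: "x = y" if "x \<in> carrier ?H1" "y \<in> carrier ?H1" "\<Psi> x = \<Psi> y" for x y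
  proof -
    have "\<Phi> x = \<Phi> y"
      using that(3) u(1) iu \<Phi>_closed[OF that(1)] \<Phi>_closed[OF that(2)] unfolding \<Psi>_def
      by (simp add: U2.deck.hat.m_assoc)
    then show ?thesis using \<Phi> that(1,2) by (auto simp: iso_def bij_betw_def dest: inj_onD)
  qed
  have \<Phi>_eq: "\<Phi> x = u \<otimes>\<^bsub>?H2\<^esub> \<Psi> x \<otimes>\<^bsub>?H2\<^esub> inv\<^bsub>?H2\<^esub> u" if "x \<in> carrier ?H1" for x
  proof -
    have "u \<otimes>\<^bsub>?H2\<^esub> \<Psi> x \<otimes>\<^bsub>?H2\<^esub> inv\<^bsub>?H2\<^esub> u = u \<otimes>\<^bsub>?H2\<^esub> inv\<^bsub>?H2\<^esub> u \<otimes>\<^bsub>?H2\<^esub> \<Phi> x \<otimes>\<^bsub>?H2\<^esub> (u \<otimes>\<^bsub>?H2\<^esub> inv\<^bsub>?H2\<^esub> u)"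
      unfolding \<Psi>_def using u(1) iu \<Phi>_closed[OF that] by (simp only: U2.deck.hat.m_assoc U2.deck.hat.m_closed)
    then show ?thesis using u(1) \<Phi>_closed[OF that] by simp
  qed
  have \<Psi>_mult: "\<Psi> (x \<otimes>\<^bsub>?H1\<^esub> y) = \<Psi> x \<otimes>\<^bsub>?H2\<^esub> \<Psi> y" if x: "x \<in> carrier ?H1" and y: "y \<in> carrier ?H1" for x y
  proof -
    have "u \<otimes>\<^bsub>?H2\<^esub> (inv\<^bsub>?H2\<^esub> u \<otimes>\<^bsub>?H2\<^esub> z) = z" if "z \<in> carrier ?H2" for z
      using u(1) iu that by (simp add: U2.deck.hat.m_assoc[symmetric])
    then show ?thesis
      unfolding \<Psi>_def \<Phi>_mult[OF x y] using u(1) iu \<Phi>_closed[OF x] \<Phi>_closed[OF y]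
      by (simp add: U2.deck.hat.m_assoc)
  qed
  have \<Psi>_surj: "\<exists>x\<in>carrier ?H1. \<Psi> x = y" if y: "y \<in> carrier ?H2" for y
  proof -
    have yc: "u \<otimes>\<^bsub>?H2\<^esub> y \<otimes>\<^bsub>?H2\<^esub> inv\<^bsub>?H2\<^esub> u \<in> carrier ?H2" using u(1) iu y by simp
    then obtain x where x: "x \<in> carrier ?H1" "\<Phi> x = u \<otimes>\<^bsub>?H2\<^esub> y \<otimes>\<^bsub>?H2\<^esub> inv\<^bsub>?H2\<^esub> u"
      using \<Phi> unfolding iso_def bij_betw_def by (smt (verit) imageE mem_Collect_eq)
    have "inv\<^bsub>?H2\<^esub> u \<otimes>\<^bsub>?H2\<^esub> (u \<otimes>\<^bsub>?H2\<^esub> z) = z" if "z \<in> carrier ?H2" for z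
      using u(1) iu that by (simp add: U2.deck.hat.m_assoc[symmetric])
    then have "\<Psi> x = y" unfolding \<Psi>_def x(2) using u(1) iu y by (simp add: U2.deck.hat.m_assoc)
    then show ?thesis using x(1) by blast
  qed
  \<comment> \<open>Inherited from \<open>\<Phi>\<close> because products are formed at each level
    separately. It allows \<open>\<Psi>\<close> to be recognised as the completion of
    \<open>h\<close>.\<close>
  have \<Psi>_level: "\<Psi> x (K_sub D2 n) = \<Psi> y (K_sub D2 n)"
    if "x \<in> carrier ?H1" "y \<in> carrier ?H1" "x (K_sub D1 n) = y (K_sub D1 n)" for x y n
    unfolding \<Psi>_def using \<Phi>_level[OF that] by (simp add: U2.deck.hat_mult)
  have E_act: "cmap ?E 0 (A1.act x \<xi>) = A2.act (\<Psi> x) (cmap ?E 0 \<xi>)"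
    if x: "x \<in> carrier ?H1" and \<xi>: "\<xi> \<in> A1.completion" for x \<xi>
  proof -
    have F\<xi>: "cmap F 0 \<xi> \<in> A2.completion"
      by (rule bij_betw_apply[OF bij0[OF Fiso] \<xi>])
    have "cmap ?E 0 (A1.act x \<xi>) = A2.act (inv\<^bsub>?H2\<^esub> u) (A2.act (\<Phi> x) (cmap F 0 \<xi>))"
      using limit_iso_equivariant[OF f F x, of \<xi> 0] \<xi> by (simp add: twisted_map_def U1.completed_simps)
    also have "\<dots> = A2.act (inv\<^bsub>?H2\<^esub> u) (A2.act (\<Phi> x) (A2.act u (A2.act (inv\<^bsub>?H2\<^esub> u) (cmap F 0 \<xi>))))"
      using A2.act_inv_cancel(2)[OF u(1) F\<xi>] by simp
    also have "\<dots> = A2.act (\<Psi> x) (A2.act (inv\<^bsub>?H2\<^esub> u) (cmap F 0 \<xi>))"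
      unfolding \<Psi>_def using u(1) iu \<Phi>_closed[OF x] A2.act_completion[OF iu F\<xi>]
      by (simp add: A2.act_act)
    finally show ?thesis by (simp add: twisted_map_def)
  qed
  have E_inj: "\<xi> = \<eta>" if "\<xi> \<in> A1.completion" "\<eta> \<in> A1.completion" "cmap ?E 0 \<xi> = cmap ?E 0 \<eta>" for \<xi> \<eta>
    by (rule inj_onD[OF bij_betw_imp_inj_on[OF bij0[OF E]] that(3,1,2)])
  have \<iota>act1: "A1.act (U1.deck.embed g) (A1.orig {v}) = A1.orig {g v}" if "g \<in> carrier D1" "v \<in> verts X1" for g v
    using A1.act_embed_orig[OF that(1) U1.vertex_dim[OF that(2)]] by (simp add: cell_act_def)
  have \<iota>act2: "A2.act (U2.deck.embed g) (A2.orig {v}) = A2.orig {g v}" if "g \<in> carrier D2" "v \<in> verts X2" for g v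
    using A2.act_embed_orig[OF that(1) U2.vertex_dim[OF that(2)]] by (simp add: cell_act_def)
  have \<theta>v0: "\<theta> v0 = w0"
    using A2.orig_inj[OF rf2 U2.vertex_dim[OF \<theta>v[OF v0]] U2.vertex_dim[OF w0(1)]] E_vertex[OF v0] E0 by simp
  have "\<exists>k. k \<in> carrier D2 \<and> \<Psi> (U1.deck.embed g) = U2.deck.embed k" if g: "g \<in> carrier D1" for g
  proof -
    have gv: "g v0 \<in> verts X1" using U1.deck_apply(1)[OF g v0] .
    have "A2.act (\<Psi> (U1.deck.embed g)) (A2.orig {w0}) = A2.orig {\<theta> (g v0)}"
      using E_act[OF U1.deck.embed_closed[OF g] \<iota>v[OF v0]] \<iota>act1[OF g v0] E_vertex[OF gv] E0 by simp
    from A2.act_orig_eq_orig[OF \<Psi>_closed[OF U1.deck.embed_closed[OF g]] U2.vertex_dim[OF w0(1)] U2.vertex_dim[OF \<theta>v[OF gv]] this]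
    show ?thesis by blast
  qed
  then obtain h where h: "\<And>g. g \<in> carrier D1 \<Longrightarrow> h g \<in> carrier D2" "\<And>g. g \<in> carrier D1 \<Longrightarrow> \<Psi> (U1.deck.embed g) = U2.deck.embed (h g)"
    by metis
  have h_hom: "h \<in> hom D1 D2"
  proof (rule homI[OF h(1)])
    fix a b assume a: "a \<in> carrier D1" and b: "b \<in> carrier D1"
    have "U2.deck.embed (h (a \<otimes>\<^bsub>D1\<^esub> b)) = U2.deck.embed (h a \<otimes>\<^bsub>D2\<^esub> h b)"
      using a b h(1)[OF a] h(1)[OF b] by (simp add: h(2)[symmetric] U1.deck.embed_mult U2.deck.embed_mult \<Psi>_mult)
    then show "h (a \<otimes>\<^bsub>D1\<^esub> b) = h a \<otimes>\<^bsub>D2\<^esub> h b"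
      using U2.deck.embed_inj[OF rf2] h(1) a b by simp
  qed
  have h_inj: "inj_on h (carrier D1)"
  proof (rule inj_onI)
    fix a b assume a: "a \<in> carrier D1" and b: "b \<in> carrier D1" and eq: "h a = h b"
    have "\<Psi> (U1.deck.embed a) = \<Psi> (U1.deck.embed b)" using h(2)[OF a] h(2)[OF b] eq by simp
    then have "U1.deck.embed a = U1.deck.embed b" using \<Psi>_inj a b by blast
    then show "a = b" using U1.deck.embed_inj[OF rf1 a b] by blast
  qed
  \<comment> \<open>The construction of \<open>h\<close> run backwards: the \<open>x\<close> with
    \<open>\<Psi> x\<close> equal to the embedded \<open>k\<close> moves \<open>v0\<close> to the
    original vertex \<open>v\<close> with \<open>\<theta> v = k w0\<close>, so \<open>x\<close>
    comes from the first group.\<close>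
  have h_onto: "h ` carrier D1 = carrier D2"
  proof
    show "h ` carrier D1 \<subseteq> carrier D2" using h(1) by blast
    show "carrier D2 \<subseteq> h ` carrier D1"
    proof
      fix k assume k: "k \<in> carrier D2"
      obtain x where x: "x \<in> carrier ?H1" "\<Psi> x = U2.deck.embed k" using \<Psi>_surj[OF U2.deck.embed_closed[OF k]] by blast
      have kw: "k w0 \<in> verts X2" using U2.deck_apply(1)[OF k w0(1)] .
      obtain v where v: "v \<in> verts X1" "\<theta> v = k w0"
        using kw unfolding bij_betw_imp_surj_on[OF \<theta>bij, symmetric] by (elim imageE) simp
      have "cmap ?E 0 (A1.act x (A1.orig {v0})) = cmap ?E 0 (A1.orig {v})"
        using E_act[OF x(1) \<iota>v[OF v0]] x(2) E0 \<iota>act2[OF k w0(1)] E_vertex[OF v(1)] v(2) by simp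
      then have "A1.act x (A1.orig {v0}) = A1.orig {v}"
        using E_inj A1.act_completion[OF x(1) \<iota>v[OF v0]] \<iota>v[OF v(1)] by blast
      then obtain g where g: "g \<in> carrier D1" "x = U1.deck.embed g"
        using A1.act_orig_eq_orig[OF x(1) U1.vertex_dim[OF v0] U1.vertex_dim[OF v(1)]] by blast
      have "U2.deck.embed (h g) = U2.deck.embed k" using h(2)[OF g(1)] g(2) x(2) by simp
      then have "h g = k" by (rule U2.deck.embed_inj[OF rf2 h(1)[OF g(1)] k])
      then show "k \<in> h ` carrier D1" using g(1) by blast
    qed
  qed
  have h_iso: "h \<in> iso D1 D2" using h_hom h_inj h_onto by (simp add: iso_def bij_betw_def)
  have completion: "completion_map D1 D2 h x = \<Psi> x" if "x \<in> carrier ?H1" for x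
    by (rule completion_map_eq[OF h_hom \<Psi>_closed \<Psi>_level h(2) that])
  have equiv: "vertex_equivariant D1 X1 h \<theta>"
    unfolding vertex_equivariant_def
  proof (intro ballI)
    fix g v assume g: "g \<in> carrier D1" and v: "v \<in> verts X1"
    have gv: "g v \<in> verts X1" using U1.deck_apply(1)[OF g v] .
    have hv: "h g (\<theta> v) \<in> verts X2" using U2.deck_apply(1)[OF h(1)[OF g] \<theta>v[OF v]] .
    have "A2.orig {\<theta> (g v)} = A2.orig {h g (\<theta> v)}"
      using E_act[OF U1.deck.embed_closed[OF g] \<iota>v[OF v]] \<iota>act1[OF g v] E_vertex[OF gv] E_vertex[OF v]
        h(2)[OF g] \<iota>act2[OF h(1)[OF g] \<theta>v[OF v]] by simp
    then show "\<theta> (g v) = h g (\<theta> v)"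
      using A2.orig_inj[OF rf2 U2.vertex_dim[OF \<theta>v[OF gv]] U2.vertex_dim[OF hv]] by simp
  qed
  obtain \<theta>' where \<theta>': "descends_to X1 p1 p2 \<theta> \<theta>'" "simplicial_iso C1 C2 \<theta>'"
    using simplicial_iso_descend[OF U1.universal_cover_axioms U2.universal_cover_axioms \<theta> h_onto equiv] by blast
  have PL: "PL_homeomorphism (realization C1) (realization C2) (realize \<theta>')"
    by (rule PL_homeomorphism_realize[OF U1.C.complex U1.finite_base U2.C.complex U2.finite_base \<theta>'(2)])
  have ind: "induces_up_to_conjugacy X1 p1 C1 X2 p2 C2 \<theta>' h"
    by (rule induces_up_to_conjugacyI[OF U1.universal_cover_axioms U2.universal_cover_axioms h_hom \<theta> equiv \<theta>'])
  have inn: "\<forall>x\<in>carrier ?H1. \<Phi> x = Inn ?H2 u (completion_map D1 D2 h x)"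
    using \<Phi>_eq completion by (simp add: Inn_def)
  show ?thesis
    by (intro bexI[OF _ u(1)] bexI[OF _ h_iso] conjI inn onto exI[of _ \<theta>] exI[of _ \<theta>'] restr \<theta> equiv \<theta>' PL ind)
qed

section \<open>Distinguished subcomplexes\<close>

lemma preserves_descends:
  assumes Z: "\<And>l. l \<in> \<Lambda> \<Longrightarrow> Z1 l \<subseteq> X1" "\<And>l. l \<in> \<Lambda> \<Longrightarrow> Z2 l \<subseteq> X2" and \<sigma>: "\<And>l. l \<in> \<Lambda> \<Longrightarrow> \<sigma> l \<in> \<Lambda>"
    and desc: "level_descends D1 X1 D2 n f m g" and mn: "m \<le> n"
    and pres: "preserves_families D1 D2 n \<Lambda> Z1 Z2 \<sigma> f"
  shows "preserves_families D1 D2 m \<Lambda> Z1 Z2 \<sigma> g"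
  unfolding preserves_families_def level_complex_simps
proof (intro ballI allI conjI)
  fix l k assume l: "l \<in> \<Lambda>"
  have sub: "simplices (Z1 l) k \<subseteq> simplices X1 k" "simplices (Z2 (\<sigma> l)) k \<subseteq> simplices X2 k" for k
    using Z(1)[OF l] Z(2)[OF \<sigma>[OF l]] by (auto simp: simplices_def)
  then have sub': "occurrences (Z1 l) k \<subseteq> occurrences X1 k" "occurrences (Z2 (\<sigma> l)) k \<subseteq> occurrences X2 k"
    unfolding occurrences_def by blast+
  have cd: "cell_descends k n (cmap f k) m (cmap g k)" and od: "occ_descends k n (omap f k) m (omap g k)"
    using desc unfolding level_descends_iff by blast+
  have cf: "cmap f k ` orbits (K_group D1 n) (simplices (Z1 l) k) cell_act = orbits (K_group D2 n) (simplices (Z2 (\<sigma> l)) k) cell_act"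
    and of: "omap f k ` orbits (K_group D1 n) (occurrences (Z1 l) k) occ_act = orbits (K_group D2 n) (occurrences (Z2 (\<sigma> l)) k) occ_act"
    using pres l unfolding preserves_families_def level_complex_simps by blast+
  show "cmap g k ` orbits (K_group D1 m) (simplices (Z1 l) k) cell_act = orbits (K_group D2 m) (simplices (Z2 (\<sigma> l)) k) cell_act"
    by (rule action_pair.descends_image[OF action_pair_simplices cd mn sub cf])
  show "omap g k ` orbits (K_group D1 m) (occurrences (Z1 l) k) occ_act = orbits (K_group D2 m) (occurrences (Z2 (\<sigma> l)) k) occ_act"
    by (rule action_pair.descends_image[OF action_pair_occurrences od mn sub' of])
qed

text \<open>An invariant subcomplex is a union of orbits, so a single level decides membership. The
  twist by \<open>u\<close> is harmless for the same reason: at level \<open>M j\<close> its inverse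
  acts as some \<open>b\<close> in the deck group.\<close>

lemma limit_preserves:
  assumes f: "compatible_selection D1 X1 D2 X2 \<Phi> M f" and F: "limit_iso D1 X1 D2 X2 M f F"
    and u: "u \<in> carrier (profinite_completion D2)"
    and restr: "restricts_to D1 X1 D2 (twisted_map D2 u F) \<theta>" and \<theta>: "simplicial_iso X1 X2 \<theta>"
    and Y1: "invariant_subcomplex D1 X1 Y1" and Y2: "invariant_subcomplex D2 X2 Y2"
    and pres: "\<And>k. cmap (f j) k ` orbits (K_group D1 (M j)) (simplices Y1 k) cell_act =
        orbits (K_group D2 (M j)) (simplices Y2 k) cell_act"
  shows "(\<lambda>s. \<theta> ` s) ` Y1 = Y2"
proof -
  have Y1X: "Y1 \<subseteq> X1" and Y2X: "Y2 \<subseteq> X2"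
    and inv1: "\<And>g s. \<lbrakk>g \<in> carrier D1; s \<in> Y1\<rbrakk> \<Longrightarrow> g ` s \<in> Y1"
    and inv2: "\<And>g s. \<lbrakk>g \<in> carrier D2; s \<in> Y2\<rbrakk> \<Longrightarrow> g ` s \<in> Y2"
    using Y1 Y2 unfolding invariant_subcomplex_def by blast+
  have iff: "\<theta> ` s \<in> Y2 \<longleftrightarrow> s \<in> Y1" if s: "s \<in> X1" for s
  proof -
    define k where "k = card s - 1"
    interpret A1: free_action D1 cell_act "simplices X1 k" by (rule U1.free_action_simplices)
    interpret A2: free_action D2 cell_act "simplices X2 k" by (rule U2.free_action_simplices)
    have sk: "s \<in> simplices X1 k" unfolding k_def by (rule U1.simplex_dim[OF s])
    have "\<theta> ` s \<in> X2" unfolding simplicial_iso_image[OF \<theta>, symmetric] using s by blast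
    moreover have "inj_on \<theta> s"
      using \<theta> s unfolding simplicial_iso_def bij_betw_def by (meson Sup_upper inj_on_subset)
    ultimately have tk: "\<theta> ` s \<in> simplices X2 k" using sk card_image[of \<theta> s] by (simp add: simplices_def)
    have cell: "action_pair.lev_iso D1 D2 \<Phi> cell_act (simplices X1 k) cell_act (simplices X2 k) (M j) (cmap (f j) k)"
      by (rule compatible_cells(1)[OF f])
    have bij: "bij_betw (cmap (f j) k) (A1.lev (M j)) (A2.lev (M j))"
      using cell by (simp add: action_pair.lev_iso_def[OF action_pair_simplices])
    obtain r where r: "r \<in> simplices X2 k" "cmap (f j) k (A1.orb (M j) s) = A2.orb (M j) r"
      using A2.levE[OF bij_betw_apply[OF bij A1.orb_lev[OF sk]]] by blast
    obtain b where b: "b \<in> carrier D2" "(inv\<^bsub>profinite_completion D2\<^esub> u) (K_sub D2 (M j)) = K_sub D2 (M j) #>\<^bsub>D2\<^esub> b"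
      using U2.deck.hat_coset_ex[OF U2.deck.hat.inv_closed[OF u] U2.deck.K_fi_normal] by blast
    have "cmap (twisted_map D2 u F) k (A1.orig s) (M j) = A2.orb (M j) (\<theta> ` s)"
      using restr sk unfolding restricts_to_def by (simp add: original_def)
    moreover have "cmap F k (A1.orig s) (M j) = A2.orb (M j) r"
      using F A1.orig_completion[OF sk] r(2) by (simp add: limit_iso_def U1.completed_simps original_def)
    then have "cmap (twisted_map D2 u F) k (A1.orig s) (M j) = A2.orb (M j) (cell_act b r)"
      using A2.act_at[of r "cmap F k (A1.orig s)" "M j" b "inv\<^bsub>profinite_completion D2\<^esub> u"] r(1) b
      by (simp add: twisted_map_def)
    ultimately have orb: "A2.orb (M j) (\<theta> ` s) = A2.orb (M j) (cell_act b r)" by simp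
    have Y2_orb: "t \<in> Y2" if t: "A2.orb (M j) t = A2.orb (M j) t'" "t' \<in> Y2" "t \<in> simplices X2 k" for t t'
    proof -
      have "t \<in> A2.orb (M j) t'" using A2.orb_self[OF t(3), of "M j"] t(1) by simp
      then obtain g where "g \<in> K_sub D2 (M j)" "t = cell_act g t'" unfolding A2.mem_orb by blast
      then show ?thesis using inv2[OF A2.K_carrier t(2)] by (simp add: cell_act_def)
    qed
    have Y1_orb: "t \<in> Y1" if t: "A1.orb (M j) t = A1.orb (M j) t'" "t' \<in> Y1" "t \<in> simplices X1 k" for t t'
    proof -
      have "t \<in> A1.orb (M j) t'" using A1.orb_self[OF t(3), of "M j"] t(1) by simp
      then obtain g where "g \<in> K_sub D1 (M j)" "t = cell_act g t'" unfolding A1.mem_orb by blast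
      then show ?thesis using inv1[OF A1.K_carrier t(2)] by (simp add: cell_act_def)
    qed
    have br: "cell_act b r \<in> simplices X2 k" using A2.act_closed[OF b(1) r(1)] .
    have r_iff: "\<theta> ` s \<in> Y2 \<longleftrightarrow> r \<in> Y2"
    proof
      assume "\<theta> ` s \<in> Y2"
      then have "cell_act b r \<in> Y2" by (rule Y2_orb[OF orb[symmetric] _ br])
      then have "cell_act (inv\<^bsub>D2\<^esub> b) (cell_act b r) \<in> Y2"
        using inv2[OF U2.deck.inv_closed[OF b(1)]] by (simp add: cell_act_def)
      moreover have "cell_act (inv\<^bsub>D2\<^esub> b) (cell_act b r) = r"
        using A2.act_mult[OF U2.deck.inv_closed[OF b(1)] b(1) r(1)] A2.act_one[OF r(1)] b(1) by simp
      ultimately show "r \<in> Y2" by simp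
    next
      assume "r \<in> Y2"
      then have "cell_act b r \<in> Y2" using inv2[OF b(1)] by (simp add: cell_act_def)
      then show "\<theta> ` s \<in> Y2" by (rule Y2_orb[OF orb _ tk])
    qed
    have "r \<in> Y2 \<longleftrightarrow> s \<in> Y1"
    proof
      assume "r \<in> Y2"
      then have "r \<in> simplices Y2 k" using r(1) by (simp add: simplices_def)
      then have "A2.orb (M j) r \<in> orbits (K_group D2 (M j)) (simplices Y2 k) cell_act"
        unfolding orbits_def by blast
      then have "A2.orb (M j) r \<in> cmap (f j) k ` orbits (K_group D1 (M j)) (simplices Y1 k) cell_act"
        unfolding pres .
      then obtain z where z: "z \<in> simplices Y1 k" "A2.orb (M j) r = cmap (f j) k (A1.orb (M j) z)"
        unfolding orbits_def by blast
      have zX: "z \<in> simplices X1 k" and zY: "z \<in> Y1" using z(1) Y1X by (auto simp: simplices_def)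
      have "A1.orb (M j) s = A1.orb (M j) z"
        by (rule inj_onD[OF bij_betw_imp_inj_on[OF bij] _ A1.orb_lev[OF sk] A1.orb_lev[OF zX]]) (use r(2) z(2) in simp)
      then show "s \<in> Y1" by (rule Y1_orb[OF _ zY sk])
    next
      assume "s \<in> Y1"
      then have "s \<in> simplices Y1 k" using sk by (simp add: simplices_def)
      then have "A1.orb (M j) s \<in> orbits (K_group D1 (M j)) (simplices Y1 k) cell_act"
        unfolding orbits_def by blast
      then have "A2.orb (M j) r \<in> orbits (K_group D2 (M j)) (simplices Y2 k) cell_act"
        unfolding pres[symmetric] r(2)[symmetric] by (rule imageI)
      then obtain z where z: "z \<in> simplices Y2 k" "A2.orb (M j) r = A2.orb (M j) z" unfolding orbits_def by blast
      have "z \<in> Y2" using z(1) by (simp add: simplices_def)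
      then show "r \<in> Y2" by (rule Y2_orb[OF z(2) _ r(1)])
    qed
    then show ?thesis using r_iff by simp
  qed
  show ?thesis
  proof
    show "(\<lambda>s. \<theta> ` s) ` Y1 \<subseteq> Y2" using iff Y1X by blast
    show "Y2 \<subseteq> (\<lambda>s. \<theta> ` s) ` Y1"
    proof
      fix t assume t: "t \<in> Y2"
      then have "t \<in> (\<lambda>s. \<theta> ` s) ` X1" using Y2X simplicial_iso_image[OF \<theta>] by blast
      then obtain s where "s \<in> X1" "t = \<theta> ` s" by blast
      then show "t \<in> (\<lambda>s. \<theta> ` s) ` Y1" using iff t by blast
    qed
  qed
qed

lemma realization_descends:
  assumes \<theta>': "descends_to X1 p1 p2 \<theta> \<theta>'" and Y1: "Y1 \<subseteq> X1" and Y: "(\<lambda>s. \<theta> ` s) ` Y1 = Y2"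
  shows "realize \<theta>' ` realization ((\<lambda>s. p1 ` s) ` Y1) = realization ((\<lambda>s. p2 ` s) ` Y2)"
proof -
  have eq: "\<theta>' ` p1 ` s = p2 ` \<theta> ` s" if s: "s \<in> Y1" for s
  proof -
    have "\<theta>' (p1 v) = p2 (\<theta> v)" if "v \<in> s" for v
      using \<theta>' s that Y1 unfolding descends_to_def by blast
    then show ?thesis unfolding image_image by (rule image_cong[OF refl])
  qed
  have "(\<lambda>s. \<theta>' ` s) ` (\<lambda>s. p1 ` s) ` Y1 = (\<lambda>s. p2 ` s) ` (\<lambda>s. \<theta> ` s) ` Y1"
    unfolding image_image[of "\<lambda>s. \<theta>' ` s"] image_image[of "\<lambda>s. p2 ` s"] using eq by (rule image_cong[OF refl])
  then show ?thesis unfolding realize_realization Y by simp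
qed

text \<open>Some permutation occurs at infinitely many levels, and preservation descends from these
  to all levels below. A map may preserve the families by several permutations at once, when labels
  share a subcomplex, so a common one has to be selected.\<close>

lemma permutation_constant:
  assumes f: "compatible_selection D1 X1 D2 X2 \<Phi> M f"
    and fin: "finite P" and P: "\<And>\<sigma> l. \<lbrakk>\<sigma> \<in> P; l \<in> \<Lambda>\<rbrakk> \<Longrightarrow> \<sigma> l \<in> \<Lambda>"
    and Z: "\<And>l. l \<in> \<Lambda> \<Longrightarrow> Z1 l \<subseteq> X1" "\<And>l. l \<in> \<Lambda> \<Longrightarrow> Z2 l \<subseteq> X2"
    and pres: "\<And>j. \<exists>\<sigma>\<in>P. preserves_families D1 D2 (M j) \<Lambda> Z1 Z2 \<sigma> (f j)"
  shows "\<exists>\<sigma>\<in>P. \<forall>j. preserves_families D1 D2 (M j) \<Lambda> Z1 Z2 \<sigma> (f j)"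
proof -
  obtain s where s: "\<And>j. s j \<in> P" "\<And>j. preserves_families D1 D2 (M j) \<Lambda> Z1 Z2 (s j) (f j)"
    using pres by metis
  have "finite (range s)" using s(1) by (intro finite_subset[OF _ fin]) blast
  then obtain i where i: "infinite {j \<in> UNIV. s j = s i}" using pigeonhole_infinite[of UNIV s] by auto
  have "preserves_families D1 D2 (M j) \<Lambda> Z1 Z2 (s i) (f j)" for j
  proof -
    obtain k where k: "j \<le> k" "s k = s i" using i unfolding infinite_nat_iff_unbounded_le by blast
    have "level_descends D1 X1 D2 (M k) (f k) (M j) (f j)"
      using f k(1) unfolding compatible_selection_def by blast
    from preserves_descends[OF Z P[OF s(1)] this monoD[OF mono_M k(1)] s(2)[of k, unfolded k(2)]]
    show ?thesis .
  qed
  then show ?thesis using s(1) by blast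
qed

end

lemma universal_coverI:
  assumes "universal_covering X p C" "connected_finite_complex C"
  shows "universal_cover X p C"
  using assms unfolding universal_covering_def connected_finite_complex_def
  by (intro universal_cover.intro complex.intro universal_cover_axioms.intro) simp_all

theorem theorem2p5:
  fixes C1 :: "'a set set" and X1 :: "'c set set" and p1 :: "'c \<Rightarrow> 'a" and G1 :: "('c \<Rightarrow> 'c) monoid"
    and C2 :: "'b set set" and X2 :: "'d set set" and p2 :: "'d \<Rightarrow> 'b" and G2 :: "('d \<Rightarrow> 'd) monoid"
    and \<Phi> :: "(('c \<Rightarrow> 'c) set \<Rightarrow> ('c \<Rightarrow> 'c) set) \<Rightarrow> (('d \<Rightarrow> 'd) set \<Rightarrow> ('d \<Rightarrow> 'd) set)"
    and m :: "nat \<Rightarrow> nat"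
    and \<Lambda> :: "'l set" and Z1 :: "'l \<Rightarrow> 'c set set" and Z2 :: "'l \<Rightarrow> 'd set set" and P :: "('l \<Rightarrow> 'l) set"
  assumes "connected_finite_complex C1" and "connected_finite_complex C2"
    and "universal_covering X1 p1 C1" and "universal_covering X2 p2 C2"
    and "G1 = deck_group X1 p1" and "G2 = deck_group X2 p2"
    and "residually_finite G1" and "residually_finite G2"
    and "\<Phi> \<in> iso (profinite_completion G1) (profinite_completion G2)"
    and "continuous_map (profinite_topology G1) (profinite_topology G2) \<Phi>"
    and "mono m" and "\<forall>n. \<exists>j. n \<le> m j"
    and "\<forall>j. \<exists>f. level_iso G1 X1 G2 X2 \<Phi> (m j) f"
  shows
    "(\<exists>f. compatible_selection G1 X1 G2 X2 \<Phi> m f) \<and>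
     (\<forall>f. compatible_selection G1 X1 G2 X2 \<Phi> m f \<longrightarrow>
        (\<exists>F. limit_iso G1 X1 G2 X2 m f F) \<and>
        (\<forall>F. limit_iso G1 X1 G2 X2 m f F \<longrightarrow>
           (\<exists>u\<in>carrier (profinite_completion G2). \<exists>h\<in>iso G1 G2.
              (\<forall>x\<in>carrier (profinite_completion G1).
                 \<Phi> x = Inn (profinite_completion G2) u (completion_map G1 G2 h x)) \<and>
              maps_originals_onto G1 X1 G2 X2 (twisted_map G2 u F) \<and>
              (\<exists>\<theta> \<theta>'. restricts_to G1 X1 G2 (twisted_map G2 u F) \<theta> \<and>
                 simplicial_iso X1 X2 \<theta> \<and> vertex_equivariant G1 X1 h \<theta> \<and>
                 descends_to X1 p1 p2 \<theta> \<theta>' \<and>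
                 simplicial_iso C1 C2 \<theta>' \<and>
                 PL_homeomorphism (realization C1) (realization C2) (realize \<theta>') \<and>
                 induces_up_to_conjugacy X1 p1 C1 X2 p2 C2 \<theta>' h)))) \<and>
     (finite \<Lambda> \<and> subgroup P (BijGroup \<Lambda>) \<and>
      (\<forall>l\<in>\<Lambda>. invariant_subcomplex G1 X1 (Z1 l) \<and> invariant_subcomplex G2 X2 (Z2 l)) \<and>
      (\<forall>j. \<exists>f. level_iso G1 X1 G2 X2 \<Phi> (m j) f \<and>
                (\<exists>\<sigma>\<in>P. preserves_families G1 G2 (m j) \<Lambda> Z1 Z2 \<sigma> f)) \<longrightarrow>
        (\<exists>f. compatible_selection G1 X1 G2 X2 \<Phi> m f \<and>
             (\<forall>j. \<exists>\<sigma>\<in>P. preserves_families G1 G2 (m j) \<Lambda> Z1 Z2 \<sigma> (f j))) \<and>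
        (\<forall>f. compatible_selection G1 X1 G2 X2 \<Phi> m f \<and>
             (\<forall>j. \<exists>\<sigma>\<in>P. preserves_families G1 G2 (m j) \<Lambda> Z1 Z2 \<sigma> (f j)) \<longrightarrow>
           (\<exists>\<sigma>\<in>P.
              (\<forall>j. preserves_families G1 G2 (m j) \<Lambda> Z1 Z2 \<sigma> (f j)) \<and>
              (\<forall>F. limit_iso G1 X1 G2 X2 m f F \<longrightarrow>
                 (\<forall>u\<in>carrier (profinite_completion G2). \<forall>\<theta> \<theta>'.
                    restricts_to G1 X1 G2 (twisted_map G2 u F) \<theta> \<and>
                    simplicial_iso X1 X2 \<theta> \<and> descends_to X1 p1 p2 \<theta> \<theta>' \<longrightarrow>
                    (\<forall>l\<in>\<Lambda>.
                       (\<lambda>s. \<theta> ` s) ` Z1 l = Z2 (\<sigma> l) \<and>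
                       realize \<theta>' ` realization ((\<lambda>s. p1 ` s) ` Z1 l) =
                         realization ((\<lambda>s. p2 ` s) ` Z2 (\<sigma> l))))))))"
proof -
  have U1: "universal_cover X1 p1 C1" and U2: "universal_cover X2 p2 C2"
    using assms(1-4) by (auto intro: universal_coverI)
  have iso: "completion_iso (deck_group X1 p1) (deck_group X2 p2) \<Phi>"
    using completion_isoI[OF universal_cover.finite_K_deck[OF U1] universal_cover.finite_K_deck[OF U2]] assms(9,10)
    unfolding assms(5,6) .
  interpret cover_pair X1 p1 C1 X2 p2 C2 \<Phi> m
    using U1 U2 iso assms(11,12) by (intro cover_pair.intro cover_pair_axioms.intro)
  note rf = assms(7,8)[unfolded assms(5,6)]
  show ?thesis
    unfolding assms(5,6)
  proof (intro conjI allI impI)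
    show "\<exists>f. compatible_selection D1 X1 D2 X2 \<Phi> m f"
      using selection[of "\<lambda>j. level_iso D1 X1 D2 X2 \<Phi> (m j)"] assms(13)[unfolded assms(5,6)] by blast
  next
    fix f assume "compatible_selection D1 X1 D2 X2 \<Phi> m f"
    then show "\<exists>F. limit_iso D1 X1 D2 X2 m f F" by (rule limit_iso_exists)
  next
    fix f F assume "compatible_selection D1 X1 D2 X2 \<Phi> m f" "limit_iso D1 X1 D2 X2 m f F"
    then show "\<exists>u\<in>carrier (profinite_completion D2). \<exists>h\<in>iso D1 D2.
        (\<forall>x\<in>carrier (profinite_completion D1).
           \<Phi> x = Inn (profinite_completion D2) u (completion_map D1 D2 h x)) \<and>
        maps_originals_onto D1 X1 D2 X2 (twisted_map D2 u F) \<and>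
        (\<exists>\<theta> \<theta>'. restricts_to D1 X1 D2 (twisted_map D2 u F) \<theta> \<and>
           simplicial_iso X1 X2 \<theta> \<and> vertex_equivariant D1 X1 h \<theta> \<and>
           descends_to X1 p1 p2 \<theta> \<theta>' \<and>
           simplicial_iso C1 C2 \<theta>' \<and>
           PL_homeomorphism (realization C1) (realization C2) (realize \<theta>') \<and>
           induces_up_to_conjugacy X1 p1 C1 X2 p2 C2 \<theta>' h)"
      by (rule limit_realized[OF rf])
  next
    assume "finite \<Lambda> \<and> subgroup P (BijGroup \<Lambda>) \<and>
      (\<forall>l\<in>\<Lambda>. invariant_subcomplex D1 X1 (Z1 l) \<and> invariant_subcomplex D2 X2 (Z2 l)) \<and>
      (\<forall>j. \<exists>f. level_iso D1 X1 D2 X2 \<Phi> (m j) f \<and>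
                (\<exists>\<sigma>\<in>P. preserves_families D1 D2 (m j) \<Lambda> Z1 Z2 \<sigma> f))"
    then have fin: "finite \<Lambda>" and sub: "subgroup P (BijGroup \<Lambda>)"
      and inv: "\<And>l. l \<in> \<Lambda> \<Longrightarrow> invariant_subcomplex D1 X1 (Z1 l)" "\<And>l. l \<in> \<Lambda> \<Longrightarrow> invariant_subcomplex D2 X2 (Z2 l)"
      and levels: "\<And>j. \<exists>f. level_iso D1 X1 D2 X2 \<Phi> (m j) f \<and>
                (\<exists>\<sigma>\<in>P. preserves_families D1 D2 (m j) \<Lambda> Z1 Z2 \<sigma> f)"
      by blast+
    have PB: "P \<subseteq> Bij \<Lambda>" using subgroup.subset[OF sub] by (simp add: BijGroup_def)
    have P: "\<sigma> l \<in> \<Lambda>" if "\<sigma> \<in> P" "l \<in> \<Lambda>" for \<sigma> l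
      using PB that Bij_imp_funcset by blast
    \<comment> \<open>Bijections in \<open>BijGroup\<close> are extensional, so over a finite label
      set there are only finitely many.\<close>
    have "P \<subseteq> \<Lambda> \<rightarrow>\<^sub>E \<Lambda>"
    proof
      fix \<sigma> assume \<sigma>: "\<sigma> \<in> P"
      then have "\<sigma> \<in> extensional \<Lambda>" using PB Bij_imp_extensional by blast
      then show "\<sigma> \<in> \<Lambda> \<rightarrow>\<^sub>E \<Lambda>" using P[OF \<sigma>] by (simp add: PiE_iff)
    qed
    then have finP: "finite P" by (rule finite_subset) (rule finite_PiE[OF fin fin])
    have Z: "\<And>l. l \<in> \<Lambda> \<Longrightarrow> Z1 l \<subseteq> X1" "\<And>l. l \<in> \<Lambda> \<Longrightarrow> Z2 l \<subseteq> X2"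
      using inv by (simp_all add: invariant_subcomplex_def)
    show "\<exists>f. compatible_selection D1 X1 D2 X2 \<Phi> m f \<and>
        (\<forall>j. \<exists>\<sigma>\<in>P. preserves_families D1 D2 (m j) \<Lambda> Z1 Z2 \<sigma> (f j))"
    proof -
      let ?Q = "\<lambda>j f. level_iso D1 X1 D2 X2 \<Phi> (m j) f \<and> (\<exists>\<sigma>\<in>P. preserves_families D1 D2 (m j) \<Lambda> Z1 Z2 \<sigma> f)"
      \<comment> \<open>A descended map preserves the families by the same permutation as the map
        above it, which is the stability that \<open>selection\<close> asks for.\<close>
      have "?Q j g" if jk: "j \<le> k" and Qf: "?Q k f" and g: "level_iso D1 X1 D2 X2 \<Phi> (m j) g"
        and desc: "level_descends D1 X1 D2 (m k) f (m j) g" for j k f g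
      proof -
        obtain \<sigma> where \<sigma>: "\<sigma> \<in> P" "preserves_families D1 D2 (m k) \<Lambda> Z1 Z2 \<sigma> f"
          using Qf by blast
        have "preserves_families D1 D2 (m j) \<Lambda> Z1 Z2 \<sigma> g"
          by (rule preserves_descends[OF Z P[OF \<sigma>(1)] desc monoD[OF assms(11) jk] \<sigma>(2)])
        then show ?thesis using g \<sigma>(1) by blast
      qed
      then have "\<exists>f. compatible_selection D1 X1 D2 X2 \<Phi> m f \<and> (\<forall>j. ?Q j (f j))"
        using levels by (intro selection[of ?Q]) simp_all
      then show ?thesis by blast
    qed
    fix f assume "compatible_selection D1 X1 D2 X2 \<Phi> m f \<and>
        (\<forall>j. \<exists>\<sigma>\<in>P. preserves_families D1 D2 (m j) \<Lambda> Z1 Z2 \<sigma> (f j))"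
    then have f: "compatible_selection D1 X1 D2 X2 \<Phi> m f"
      and pres: "\<And>j. \<exists>\<sigma>\<in>P. preserves_families D1 D2 (m j) \<Lambda> Z1 Z2 \<sigma> (f j)" by blast+
    have "\<exists>\<sigma>\<in>P. \<forall>j. preserves_families D1 D2 (m j) \<Lambda> Z1 Z2 \<sigma> (f j)"
      by (rule permutation_constant[OF f finP]) (fact P Z pres)+
    then obtain \<sigma> where \<sigma>: "\<sigma> \<in> P" "\<forall>j. preserves_families D1 D2 (m j) \<Lambda> Z1 Z2 \<sigma> (f j)" ..
    show "\<exists>\<sigma>\<in>P. (\<forall>j. preserves_families D1 D2 (m j) \<Lambda> Z1 Z2 \<sigma> (f j)) \<and>
        (\<forall>F. limit_iso D1 X1 D2 X2 m f F \<longrightarrow>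
           (\<forall>u\<in>carrier (profinite_completion D2). \<forall>\<theta> \<theta>'.
              restricts_to D1 X1 D2 (twisted_map D2 u F) \<theta> \<and>
              simplicial_iso X1 X2 \<theta> \<and> descends_to X1 p1 p2 \<theta> \<theta>' \<longrightarrow>
              (\<forall>l\<in>\<Lambda>.
                 (\<lambda>s. \<theta> ` s) ` Z1 l = Z2 (\<sigma> l) \<and>
                 realize \<theta>' ` realization ((\<lambda>s. p1 ` s) ` Z1 l) =
                   realization ((\<lambda>s. p2 ` s) ` Z2 (\<sigma> l)))))"
    proof (intro bexI[OF _ \<sigma>(1)] conjI[OF \<sigma>(2)] allI impI ballI, elim conjE)
      fix F u \<theta> \<theta>' l
      assume F: "limit_iso D1 X1 D2 X2 m f F" and u: "u \<in> carrier (profinite_completion D2)"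
        and restr: "restricts_to D1 X1 D2 (twisted_map D2 u F) \<theta>" and \<theta>: "simplicial_iso X1 X2 \<theta>"
        and \<theta>': "descends_to X1 p1 p2 \<theta> \<theta>'" and l: "l \<in> \<Lambda>"
      \<comment> \<open>The first chosen level already decides membership in the subcomplexes,
        whatever the \<open>u\<close> and \<open>\<theta>\<close> for which the twisted limit
        restricts to \<open>\<theta>\<close>.\<close>
      have "cmap (f 0) k ` orbits (K_group D1 (m 0)) (simplices (Z1 l) k) cell_act =
          orbits (K_group D2 (m 0)) (simplices (Z2 (\<sigma> l)) k) cell_act" for k
        using \<sigma>(2) l unfolding preserves_families_def level_complex_simps by blast
      from limit_preserves[OF f F u restr \<theta> inv(1)[OF l] inv(2)[OF P[OF \<sigma>(1) l]] this]
      have Y: "(\<lambda>s. \<theta> ` s) ` Z1 l = Z2 (\<sigma> l)" .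
      from realization_descends[OF \<theta>' Z(1)[OF l] Y] Y
      show "(\<lambda>s. \<theta> ` s) ` Z1 l = Z2 (\<sigma> l) \<and>
          realize \<theta>' ` realization ((\<lambda>s. p1 ` s) ` Z1 l) = realization ((\<lambda>s. p2 ` s) ` Z2 (\<sigma> l))"
        by blast
    qed
  qed
qed

end
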